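(* Let $p$ be a solution of IBVP-I with data $Q(t),\Psi(x,t)$ and let $p_s$ be the PSS solution with data $Q_s,\Phi(x)$ (defined in the context). Put $\overline p=p-\Psi$ and $\overline p_s=p_s-\Phi$. Suppose that for every $\beta\ge2$ there is a constant $C$ such that for all $t\ge1$ $$|\Delta_\gamma'(t)|+|\Delta_Q(t)|+\int_1^\infty\Big(\|\Psi_{tt}(\cdot,\tau)\|_{L^\beta(U)}+\|\nabla\Psi_t(\cdot,\tau)\|^2_{L^\beta(U)}\Big)d\tau\le C.$$ Then for every $\beta\ge2$ there is a constant $C$, independent of $t$, such that for all $t\ge1$ $$\int_U|\overline p_t-\overline p_{s,t}|^\beta\,dx=\int_U|\overline p_t+A|^\beta\,dx\le C.$$
   Context: Domain and nonlinearity. $U\subset\mathbb{R}^n$, $n\ge3$, is a bounded domain with $C^2$ boundary $\partial U=\Gamma_e\cup\Gamma_i$, $N$ is the outward unit normal. Let $g(s)=a_0+\sum_{j=1}^k a_js^{\alpha_j}$, $s\ge0$, with $0<\alpha_1<\dots<\alpha_k$ and $a_0,\dots,a_k>0$. Put $G(s)=sg(s)$, $K(\xi)=1/g(G^{-1}(\xi))$, $a=\alpha_k/(\alpha_k+1)\in(0,1)$. Standing assumption: $\alpha_k>\frac4{n-2}$, equivalently $a>\frac4{n+2}$. IBVP-I. $p_t=\nabla\cdot(K(|\nabla p|)\nabla p)$ in $U\times(0,\infty)$; $-\int_{\Gamma_i}K(|\nabla p|)\nabla p\cdot N\,ds=Q(t)$; $\partial p/\partial N=0$ on $\Gamma_e$;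 $p(\cdot,0)$ given; and $p|_{\Gamma_i}=\gamma(t)+\psi(x,t)$ with $\int_{\Gamma_i}\psi\,ds=0$, where $\psi$ is prescribed and $\gamma$ is not. $\Psi(x,t)$ is a function on $U$ with trace $\psi$ on $\Gamma_i$. PSS solution. Given a constant $Q_s$ and $\varphi(x)$ on $\Gamma_i$, let $A=Q_s/|U|$, let $\Phi(x)$ be a function on $U$ with trace $\varphi$ on $\Gamma_i$, and let $W$ solve $-A=\nabla\cdot(K(|\nabla W|)\nabla W)$ in $U$, $W=\varphi$ on $\Gamma_i$, $\partial W/\partial N=0$ on $\Gamma_e$; $p_s(x,t)=-At+W(x)$. Notation. $\Delta_Q=Q-Q_s$, $\Delta_\gamma(t)=\gamma(t)+At$. Solutions and data are assumed regular enough that all the quantities and derivatives involved are defined. *)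

theory Defs
  imports "HOL-Analysis.Analysis"
begin

section \<open>Derivatives\<close>

definition C1_on :: "'a::real_normed_vector set \<Rightarrow> ('a \<Rightarrow> 'b::real_normed_vector) \<Rightarrow> bool" where
  "C1_on S f \<longleftrightarrow> (\<exists>f' :: 'a \<Rightarrow> 'a \<Rightarrow>\<^sub>L 'b.
      (\<forall>x\<in>S. (f has_derivative blinfun_apply (f' x)) (at x within S)) \<and> continuous_on S f')"

definition C2_on :: "'a::euclidean_space set \<Rightarrow> ('a \<Rightarrow> real) \<Rightarrow> bool" where
  "C2_on S f \<longleftrightarrow> (\<exists>g. (\<forall>x\<in>S. GDERIV f x :> g x) \<and> C1_on S g)"

text \<open>The derivative is taken within \<open>S\<close>. For \<open>S = closure U\<close>, with \<open>U\<close> a \<open>C\<^sup>2\<close> domain, it is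
  unique; it is the usual gradient at points of \<open>U\<close>, and it gives the gradient up to the boundary
  at points of \<open>frontier U\<close>.\<close>

definition grad :: "'a::euclidean_space set \<Rightarrow> ('a \<Rightarrow> real) \<Rightarrow> 'a \<Rightarrow> 'a" where
  "grad S f x = (THE D. (f has_derivative (\<lambda>h. D \<bullet> h)) (at x within S))"

definition divergence :: "('a::euclidean_space \<Rightarrow> 'a) \<Rightarrow> 'a \<Rightarrow> real" where
  "divergence v x = (\<Sum>b\<in>Basis. frechet_derivative v (at x) b \<bullet> b)"

section \<open>Domains with twice continuously differentiable boundary\<close>

text \<open>Near \<open>x\<close>, the set \<open>U\<close> is the part below the graph of \<open>h\<close> in the direction \<open>\<nu>\<close>. A function of
  the \<open>n - 1\<close> coordinates orthogonal to \<open>\<nu>\<close> is encoded as a function on the whole space that is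
  constant along \<open>\<nu>\<close>.\<close>

definition C2_graph_at :: "'a::euclidean_space set \<Rightarrow> 'a \<Rightarrow> 'a \<Rightarrow> ('a \<Rightarrow> real) \<Rightarrow> bool" where
  "C2_graph_at U x \<nu> h \<longleftrightarrow>
     norm \<nu> = 1 \<and> C2_on UNIV h \<and> (\<forall>y s. h (y + s *\<^sub>R \<nu>) = h y) \<and>
     (\<exists>r>0. U \<inter> ball x r = {y \<in> ball x r. y \<bullet> \<nu> < h y})"

definition bounded_C2_domain :: "'a::euclidean_space set \<Rightarrow> bool" where
  "bounded_C2_domain U \<longleftrightarrow>
     U \<noteq> {} \<and> open U \<and> connected U \<and> bounded U \<and> (\<forall>x\<in>frontier U. \<exists>\<nu> h. C2_graph_at U x \<nu> h)"

text \<open>Near \<open>x\<close> the domain is \<open>{y. y \<bullet> \<nu> - h y < 0}\<close>, so the gradient \<open>\<nu> - \<nabla>h\<close> points outward.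
  Its direction does not depend on the choice of \<open>\<nu>\<close> and \<open>h\<close>.\<close>

definition outward_normal :: "'a::euclidean_space set \<Rightarrow> 'a \<Rightarrow> 'a" where
  "outward_normal U x = (THE N. \<exists>\<nu> h. C2_graph_at U x \<nu> h \<and> N = sgn (\<nu> - grad UNIV h x))"

definition normal_derivative :: "'a::euclidean_space set \<Rightarrow> ('a \<Rightarrow> real) \<Rightarrow> 'a \<Rightarrow> real" where
  "normal_derivative U w x = grad (closure U) w x \<bullet> outward_normal U x"

section \<open>Surface measure\<close>

text \<open>Hausdorff measure, normalised so that it agrees with the surface area on hypersurfaces.
  The covering sets are required to be bounded because \<open>diameter\<close> is a junk value on
  unbounded sets.\<close>

definition hausdorff_pre :: "real \<Rightarrow> real \<Rightarrow> 'a::euclidean_space set \<Rightarrow> ennreal" where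
  "hausdorff_pre s \<delta> A =
     (INF E \<in> {E :: nat \<Rightarrow> 'a set. A \<subseteq> (\<Union>i. E i) \<and> (\<forall>i. bounded (E i) \<and> diameter (E i) \<le> \<delta>)}.
        \<Sum>i. ennreal (unit_ball_vol s * (diameter (E i) / 2) powr s))"

definition hausdorff_outer :: "real \<Rightarrow> 'a::euclidean_space set \<Rightarrow> ennreal" where
  "hausdorff_outer s A = (SUP \<delta>\<in>{0<..}. hausdorff_pre s \<delta> A)"

definition hausdorff_measure :: "real \<Rightarrow> 'a::euclidean_space measure" where
  "hausdorff_measure s = measure_of UNIV (sets borel) (hausdorff_outer s)"

definition surface_integral :: "'a::euclidean_space set \<Rightarrow> ('a \<Rightarrow> real) \<Rightarrow> real" where
  "surface_integral \<Gamma> f = (LINT x:\<Gamma>|hausdorff_measure (real DIM('a) - 1). f x)"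

section \<open>The generalized Forchheimer nonlinearity\<close>

definition forch_g :: "nat \<Rightarrow> (nat \<Rightarrow> real) \<Rightarrow> (nat \<Rightarrow> real) \<Rightarrow> real \<Rightarrow> real" where
  "forch_g k a \<alpha> s = a 0 + (\<Sum>j=1..k. a j * s powr \<alpha> j)"

definition forch_G :: "nat \<Rightarrow> (nat \<Rightarrow> real) \<Rightarrow> (nat \<Rightarrow> real) \<Rightarrow> real \<Rightarrow> real" where
  "forch_G k a \<alpha> s = s * forch_g k a \<alpha> s"

definition forch_K :: "nat \<Rightarrow> (nat \<Rightarrow> real) \<Rightarrow> (nat \<Rightarrow> real) \<Rightarrow> real \<Rightarrow> real" where
  "forch_K k a \<alpha> \<xi> = 1 / forch_g k a \<alpha> (inv_into {0..} (forch_G k a \<alpha>) \<xi>)"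

definition flux :: "(real \<Rightarrow> real) \<Rightarrow> 'a::euclidean_space set \<Rightarrow> ('a \<Rightarrow> real) \<Rightarrow> 'a \<Rightarrow> 'a" where
  "flux K U w x = K (norm (grad (closure U) w x)) *\<^sub>R grad (closure U) w x"

section \<open>The boundary value problems\<close>

text \<open>Functions of space and time are curried. The following predicate says that \<open>f\<close> is
  continuously differentiable in space and in time on \<open>closure U \<times> (0, \<infinity>)\<close>.\<close>

definition C1_space_time :: "'a::euclidean_space set \<Rightarrow> ('a \<Rightarrow> real \<Rightarrow> real) \<Rightarrow> bool" where
  "C1_space_time U f \<longleftrightarrow>
     (\<forall>x\<in>closure U. \<forall>t>0. f x differentiable (at t)) \<and>
     (\<forall>x\<in>closure U. \<forall>t>0. (\<lambda>y. f y t) differentiable (at x within closure U)) \<and>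
     continuous_on (closure U \<times> {0<..}) (\<lambda>(x, t). deriv (f x) t) \<and>
     continuous_on (closure U \<times> {0<..}) (\<lambda>(x, t). grad (closure U) (\<lambda>y. f y t) x)"

text \<open>Classical solutions of IBVP-I. The trace on \<open>\<Gamma>\<^sub>i\<close> is prescribed by \<open>\<psi>\<close> only up to the unknown
  function \<open>\<gamma>\<close> of time, which is therefore part of the solution.\<close>

definition IBVP_I ::
  "(real \<Rightarrow> real) \<Rightarrow> 'a::euclidean_space set \<Rightarrow> 'a set \<Rightarrow> 'a set \<Rightarrow>
   (real \<Rightarrow> real) \<Rightarrow> ('a \<Rightarrow> real \<Rightarrow> real) \<Rightarrow> ('a \<Rightarrow> real) \<Rightarrow>
   ('a \<Rightarrow> real \<Rightarrow> real) \<Rightarrow> (real \<Rightarrow> real) \<Rightarrow> bool" where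
  "IBVP_I K U \<Gamma>i \<Gamma>e Q \<psi> p0 p \<gamma> \<longleftrightarrow>
     C1_space_time U p \<and> (\<forall>t>0. C2_on U (\<lambda>x. p x t)) \<and> (\<forall>t>0. \<gamma> differentiable (at t)) \<and>
     (\<forall>x\<in>U. \<forall>t>0. deriv (p x) t = divergence (flux K U (\<lambda>y. p y t)) x) \<and>
     (\<forall>t>0. - surface_integral \<Gamma>i (\<lambda>x. flux K U (\<lambda>y. p y t) x \<bullet> outward_normal U x) = Q t) \<and>
     (\<forall>t>0. \<forall>x\<in>\<Gamma>e. normal_derivative U (\<lambda>y. p y t) x = 0) \<and>
     continuous_on (U \<times> {0..}) (\<lambda>(x, t). p x t) \<and> (\<forall>x\<in>U. p x 0 = p0 x) \<and>
     (\<forall>t>0. \<forall>x\<in>\<Gamma>i. p x t = \<gamma> t + \<psi> x t) \<and>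
     (\<forall>t>0. surface_integral \<Gamma>i (\<lambda>x. \<psi> x t) = 0)"

text \<open>\<open>\<Psi>\<close> extends the boundary data \<open>\<psi>\<close>, and \<open>\<Psi>\<close>, \<open>\<Psi>\<^sub>t\<close>, \<open>\<nabla>\<Psi>\<close>, \<open>\<Psi>\<^sub>t\<^sub>t\<close>, \<open>\<nabla>\<Psi>\<^sub>t\<close> exist and are continuous.\<close>

definition lateral_extension ::
  "'a::euclidean_space set \<Rightarrow> 'a set \<Rightarrow> ('a \<Rightarrow> real \<Rightarrow> real) \<Rightarrow> ('a \<Rightarrow> real \<Rightarrow> real) \<Rightarrow> bool" where
  "lateral_extension U \<Gamma>i \<psi> \<Psi> \<longleftrightarrow>
     C1_space_time U \<Psi> \<and> C1_space_time U (\<lambda>x. deriv (\<Psi> x)) \<and>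
     (\<forall>t>0. \<forall>x\<in>\<Gamma>i. \<Psi> x t = \<psi> x t)"

definition PSS_profile ::
  "(real \<Rightarrow> real) \<Rightarrow> 'a::euclidean_space set \<Rightarrow> 'a set \<Rightarrow> 'a set \<Rightarrow>
   real \<Rightarrow> ('a \<Rightarrow> real) \<Rightarrow> ('a \<Rightarrow> real) \<Rightarrow> bool" where
  "PSS_profile K U \<Gamma>i \<Gamma>e A \<phi> W \<longleftrightarrow>
     C1_on (closure U) W \<and> C2_on U W \<and>
     (\<forall>x\<in>U. - A = divergence (flux K U W) x) \<and>
     (\<forall>x\<in>\<Gamma>i. W x = \<phi> x) \<and>
     (\<forall>x\<in>\<Gamma>e. normal_derivative U W x = 0)"

definition PSS_solution :: "real \<Rightarrow> ('a \<Rightarrow> real) \<Rightarrow> 'a \<Rightarrow> real \<Rightarrow> real" where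
  "PSS_solution A W x t = - A * t + W x"

text \<open>Used only for functions continuous on the compact set \<open>closure U\<close>, where the Bochner integral
  is a true integral rather than the default value \<open>0\<close>.\<close>

definition L_norm :: "real \<Rightarrow> 'a::euclidean_space set \<Rightarrow> ('a \<Rightarrow> 'b::real_normed_vector) \<Rightarrow> real" where
  "L_norm \<beta> U f = (LINT x:U|lborel. norm (f x) powr \<beta>) powr (1 / \<beta>)"

end

theory Submission
  imports Defs
begin

text \<open>Put \<open>u = p\<^sub>t - \<Psi>\<^sub>t + A\<close>, the rate whose moments are to be bounded. On \<open>\<Gamma>\<^sub>i\<close> it equals
  \<open>\<Delta>\<^sub>\<gamma>'\<close>, whose modulus stays below a constant \<open>M\<close>. Hence the truncated power
  \<open>sgn u (\<bar>u\<bar> - M)\<^sub>+\<^bsup>N - 1\<^esup>\<close> vanishes on \<open>\<Gamma>\<^sub>i\<close>, while the flux has no normal component on \<open>\<Gamma>\<^sub>e\<close>, so the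
  equation for \<open>p\<^sub>t\<close> can be tested with this function without any boundary term.

  The flux law \<open>\<xi> \<mapsto> K(\<bar>\<xi>\<bar>) \<xi>\<close> is the inverse of \<open>v \<mapsto> g(\<bar>v\<bar>) v\<close>, and the latter is strongly monotone
  with constant \<open>a\<^sub>0\<close> because \<open>g \<ge> a\<^sub>0\<close> is increasing. Therefore the flux law is cocoercive
  (\<open>law_cocoercive\<close>): its increment is paired with the increment of \<open>\<nabla>p\<close> to at least \<open>a\<^sub>0\<close> times its own square,
  and completing the square shows that only \<open>\<bar>\<nabla>\<Psi>\<^sub>t\<bar>\<^sup>2 / (4 a\<^sub>0)\<close> survives from the diffusion term
  (\<open>law_pairing_lower_bound\<close>). With \<open>E(t) = \<integral> (\<bar>u\<bar> - M)\<^sub>+\<^bsup>N\<^esup> dx\<close> this gives, after a scaled Young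
  inequality,
  \<open>E' \<le> (1 + E) (c\<^sub>1 \<parallel>\<nabla>\<Psi>\<^sub>t\<parallel>\<^sup>2 + c\<^sub>2 \<parallel>\<Psi>\<^sub>t\<^sub>t\<parallel>)\<close> in \<open>L\<^sup>N\<close> norms. The factor in parentheses is integrable in time by hypothesis, so
  Gronwall's inequality for \<open>ln (1 + E)\<close> bounds \<open>E\<close> uniformly in time, and \<open>\<bar>u\<bar>\<^bsup>\<beta>\<^esup>\<close> is controlled by
  \<open>1 + M\<^bsup>N\<^esup> + (\<bar>u\<bar> - M)\<^sub>+\<^bsup>N\<^esup>\<close> for any \<open>N \<ge> \<beta>\<close>.

  A classical solution need not possess the derivatives \<open>p\<^sub>t\<^sub>t\<close> and \<open>\<nabla>p\<^sub>t\<close>. The argument is therefore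
  carried out for the difference quotient of \<open>p - \<Psi> + A t\<close> over a time step \<open>h\<close>, whose boundary values are
  still bounded by \<open>M\<close> by the mean value theorem. The data terms then contain difference quotients of \<open>\<nabla>\<Psi>\<close>
  and \<open>\<Psi>\<^sub>t\<close>, which for small \<open>h\<close> are uniformly close to \<open>\<nabla>\<Psi>\<^sub>t\<close> and \<open>\<Psi>\<^sub>t\<^sub>t\<close> on each interval \<open>[1, T]\<close>; the
  resulting growth factor between the times \<open>1\<close> and \<open>T\<close> depends neither on \<open>h\<close> nor on \<open>T\<close>, and \<open>h \<rightarrow> 0\<close> finishes the proof
  (\<open>energy_growth\<close>, \<open>excess_moment_bounded\<close>).

  The integration by parts (\<open>green_identity\<close>) concerns a field \<open>F\<close> that is differentiable only in the interior
  and a test function \<open>\<eta>\<close> with \<open>\<eta> F \<cdot> N = 0\<close> on the boundary. After localisation by a partition of unity,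
  \<open>\<eta> F\<close> is multiplied by a cutoff which vanishes in a strip of width \<open>\<epsilon>\<close> along the boundary. The gradient of the
  cutoff is of size \<open>1 / \<epsilon>\<close> and normal to the boundary up to \<open>o(1)\<close>, and the strip has measure \<open>O(\<epsilon>)\<close>, so the error
  tends to zero.\<close>

section \<open>The Forchheimer law and its inverse\<close>

locale forchheimer =
  fixes k :: nat and a \<alpha> :: "nat \<Rightarrow> real"
  assumes coeff_pos: "\<And>j. j \<le> k \<Longrightarrow> a j > 0"
    and exponent_pos: "\<And>j. j \<in> {1..k} \<Longrightarrow> \<alpha> j > 0"
begin

abbreviation "g \<equiv> forch_g k a \<alpha>"
abbreviation "G \<equiv> forch_G k a \<alpha>"

definition law :: "'a::euclidean_space \<Rightarrow> 'a" where
  "law \<xi> = forch_K k a \<alpha> (norm \<xi>) *\<^sub>R \<xi>"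

text \<open>The map from velocity to pressure gradient, which \<open>law\<close> inverts.\<close>

definition resistance :: "'a::euclidean_space \<Rightarrow> 'a" where
  "resistance v = g (norm v) *\<^sub>R v"

lemma a0_pos: "a 0 > 0"
  using coeff_pos[of 0] by simp

lemma g_mono: "g s \<le> g t" if "0 \<le> s" "s \<le> t"
  unfolding forch_g_def using that coeff_pos exponent_pos
  by (auto intro!: sum_mono mult_left_mono powr_mono2 simp: less_imp_le)

lemma g_zero: "g 0 = a 0"
  by (simp add: forch_g_def)

lemma g_ge: "a 0 \<le> g s" if "0 \<le> s"
  using g_mono[of 0 s] that by (simp add: g_zero)

lemma continuous_on_g: "continuous_on {0..} g"
  unfolding forch_g_def
  by (intro continuous_intros continuous_on_powr') (use exponent_pos in force)+

lemma G_surj: "\<exists>s\<ge>0. G s = \<xi>" if "\<xi> \<ge> 0"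
proof -
  define M where "M = \<xi> / a 0"
  have M: "M \<ge> 0" using that a0_pos by (simp add: M_def)
  have "M * a 0 \<le> G M"
    unfolding forch_G_def using M g_ge[of M] by (intro mult_left_mono) auto
  then have "\<xi> \<le> G M" using a0_pos by (simp add: M_def)
  moreover have "continuous_on {0..M} G"
    unfolding forch_G_def
    by (intro continuous_intros continuous_on_subset[OF continuous_on_g]) auto
  ultimately show ?thesis
    using IVT'[of G 0 \<xi> M] that M by (auto simp: forch_G_def)
qed

lemma resistance_law: "resistance (law \<xi>) = \<xi>"
proof -
  define s where "s = inv_into {0..} G (norm \<xi>)"
  have mem: "norm \<xi> \<in> G ` {0..}"
    using G_surj[of "norm \<xi>"] by force
  have s0: "s \<ge> 0" using inv_into_into[OF mem] by (simp add: s_def)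
  have Gs: "s * g s = norm \<xi>"
    using f_inv_into_f[OF mem] by (simp add: s_def forch_G_def)
  have gs: "g s > 0" using g_ge[OF s0] a0_pos by simp
  have law: "law \<xi> = (1 / g s) *\<^sub>R \<xi>"
    by (simp add: law_def forch_K_def s_def)
  have "norm (law \<xi>) = s"
    using gs Gs by (simp add: law field_simps)
  then show ?thesis
    using gs by (simp add: resistance_def law)
qed

text \<open>Subtracting \<open>a 0\<close> from \<open>g\<close> leaves a nonnegative increasing factor, for which the map is monotone by the
  Cauchy-Schwarz inequality; the part \<open>a 0 *\<^sub>R v\<close> contributes the square.\<close>

lemma resistance_coercive:
  "a 0 * (norm (v - w))\<^sup>2 \<le> (resistance v - resistance w) \<bullet> (v - w)"
proof -
  define c d where "c = g (norm v) - a 0" and "d = g (norm w) - a 0"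
  have cd: "c \<ge> 0" "d \<ge> 0" using g_ge by (auto simp: c_def d_def)
  have "(c * norm v - d * norm w) * (norm v - norm w) \<ge> 0"
  proof (cases "norm v \<le> norm w")
    case True
    then have "c \<le> d" using g_mono[of "norm v" "norm w"] by (simp add: c_def d_def)
    then have "c * norm v \<le> d * norm w" using True cd by (intro mult_mono) auto
    then show ?thesis using True by (simp add: mult_nonpos_nonpos)
  next
    case False
    then have "d \<le> c" using g_mono[of "norm w" "norm v"] by (simp add: c_def d_def)
    then have "d * norm w \<le> c * norm v" using False cd by (intro mult_mono) auto
    then show ?thesis using False by simp
  qed
  moreover have "(c + d) * (v \<bullet> w) \<le> (c + d) * (norm v * norm w)"
    using cd by (intro mult_left_mono norm_cauchy_schwarz) auto
  ultimately have "0 \<le> c * (norm v)\<^sup>2 + d * (norm w)\<^sup>2 - (c + d) * (v \<bullet> w)"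
    by (simp add: algebra_simps power2_eq_square)
  also have "\<dots> = (c *\<^sub>R v - d *\<^sub>R w) \<bullet> (v - w)"
    by (simp add: inner_diff inner_commute algebra_simps power2_norm_eq_inner)
  also have "c *\<^sub>R v - d *\<^sub>R w = resistance v - resistance w - a 0 *\<^sub>R (v - w)"
    by (simp add: resistance_def c_def d_def algebra_simps)
  finally show ?thesis
    by (simp add: inner_diff_left power2_norm_eq_inner)
qed

lemma law_cocoercive:
  "a 0 * (norm (law \<xi> - law \<zeta>))\<^sup>2 \<le> (law \<xi> - law \<zeta>) \<bullet> (\<xi> - \<zeta>)"
  using resistance_coercive[of "law \<xi>" "law \<zeta>"]
  by (simp add: resistance_law inner_commute)

lemma law_lipschitz: "norm (law \<xi> - law \<zeta>) \<le> norm (\<xi> - \<zeta>) / a 0"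
proof -
  have "a 0 * (norm (law \<xi> - law \<zeta>))\<^sup>2 \<le> norm (law \<xi> - law \<zeta>) * norm (\<xi> - \<zeta>)"
    using law_cocoercive norm_cauchy_schwarz by (rule order_trans)
  then have "a 0 * norm (law \<xi> - law \<zeta>) \<le> norm (\<xi> - \<zeta>)"
    by (cases "law \<xi> = law \<zeta>") (auto simp: power2_eq_square)
  then show ?thesis using a0_pos by (simp add: field_simps)
qed

lemma continuous_on_law: "continuous_on S law"
proof (rule continuous_at_imp_continuous_on, rule ballI)
  fix x :: 'a
  have "((\<lambda>y. norm (y - x) / a 0) \<longlongrightarrow> 0) (at x)"
    using a0_pos by (auto intro!: tendsto_eq_intros)
  then have "((\<lambda>y. law y - law x) \<longlongrightarrow> 0) (at x)"
    by (rule Lim_null_comparison[rotated]) (simp add: law_lipschitz)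
  then show "isCont law x"
    unfolding isCont_def by (simp add: LIM_zero_iff)
qed

text \<open>At \<open>v = 0\<close> the exponents may be smaller than \<open>1\<close>, and then \<open>g\<close> itself is not differentiable;
  the factor \<open>v\<close> repairs this.\<close>

lemma resistance_differentiable: "resistance differentiable (at v)"
proof (cases "v = 0")
  case True
  have g0: "((\<lambda>w::'a. g (norm w)) \<longlongrightarrow> g 0) (at 0)"
  proof -
    have "continuous_on UNIV (\<lambda>w::'a. g (norm w))"
      by (rule continuous_on_compose2[OF continuous_on_g]) (auto intro: continuous_intros)
    then have "isCont (\<lambda>w::'a. g (norm w)) 0"
      by (simp add: continuous_on_eq_continuous_at)
    then show ?thesis by (simp add: isCont_def)
  qed
  have "(resistance has_derivative (\<lambda>h. a 0 *\<^sub>R h)) (at (0::'a))"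
    unfolding has_derivative_at_within
  proof (intro conjI)
    show "bounded_linear ((*\<^sub>R) (a 0) :: 'a \<Rightarrow> 'a)" by (rule bounded_linear_scaleR_right)
    have "((\<lambda>w::'a. norm (g (norm w) - g 0)) \<longlongrightarrow> 0) (at 0)"
      using g0 by (intro tendsto_norm_zero) (simp add: LIM_zero_iff)
    moreover have "\<forall>\<^sub>F y in at (0::'a). norm ((resistance y - resistance 0 - a 0 *\<^sub>R (y - 0)) /\<^sub>R norm (y - 0))
        = norm (g (norm y) - g 0)"
      unfolding eventually_at
    proof (intro exI[of _ 1] conjI ballI impI)
      fix y :: 'a assume "y \<noteq> 0 \<and> dist y 0 < 1"
      moreover have "resistance y - resistance 0 - a 0 *\<^sub>R (y - 0) = (g (norm y) - g 0) *\<^sub>R y"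
        by (simp add: resistance_def g_zero algebra_simps)
      ultimately show "norm ((resistance y - resistance 0 - a 0 *\<^sub>R (y - 0)) /\<^sub>R norm (y - 0))
        = norm (g (norm y) - g 0)"
        by (simp add: abs_mult)
    qed simp
    ultimately have "((\<lambda>y. norm ((resistance y - resistance 0 - a 0 *\<^sub>R (y - 0)) /\<^sub>R norm (y - 0))) \<longlongrightarrow> 0) (at (0::'a))"
      by (simp add: tendsto_cong)
    then show "((\<lambda>y. (resistance y - resistance 0 - a 0 *\<^sub>R (y - 0)) /\<^sub>R norm (y - 0)) \<longlongrightarrow> 0) (at (0::'a))"
      by (rule tendsto_norm_zero_cancel)
  qed
  then show ?thesis using True by (auto simp: differentiable_def)
next
  case False
  have "(\<lambda>w. g (norm w)) differentiable (at v)"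
    unfolding forch_g_def
  proof (intro differentiable_add differentiable_const differentiable_sum differentiable_mult finite_atLeastAtMost ballI)
    fix j assume "j \<in> {1..k}"
    have "((\<lambda>s. s powr \<alpha> j) has_derivative (\<lambda>h. \<alpha> j * norm v powr (\<alpha> j - 1) * h)) (at (norm v))"
      using has_real_derivative_powr[of "norm v" "\<alpha> j"] False
      by (simp add: has_field_derivative_def)
    from has_derivative_compose[OF has_derivative_norm[OF False] this]
    show "(\<lambda>w. norm w powr \<alpha> j) differentiable (at v)"
      by (auto simp: differentiable_def)
  qed
  then show ?thesis
    unfolding resistance_def by (intro differentiable_scaleR differentiable_ident)
qed

lemma resistance_derivative_coercive:
  assumes "(resistance has_derivative B) (at v)"
  shows "a 0 * (norm h)\<^sup>2 \<le> B h \<bullet> h"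
proof -
  interpret B: bounded_linear B using assms by (rule has_derivative_bounded_linear)
  have "((\<lambda>s::real. resistance (v + s *\<^sub>R h) \<bullet> h) has_derivative (\<lambda>s. B (s *\<^sub>R h) \<bullet> h)) (at 0)"
  proof (rule has_derivative_inner_left)
    show "((\<lambda>s. resistance (v + s *\<^sub>R h)) has_derivative (\<lambda>s. B (s *\<^sub>R h))) (at 0)"
    proof (rule has_derivative_compose[where f = "\<lambda>s. v + s *\<^sub>R h" and f' = "\<lambda>s. s *\<^sub>R h" and g = resistance and g' = B])
      show "((\<lambda>s. v + s *\<^sub>R h) has_derivative (\<lambda>s. s *\<^sub>R h)) (at 0)"
        by (auto intro!: derivative_eq_intros)
      show "(resistance has_derivative B) (at (v + 0 *\<^sub>R h))"
        using assms by simp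
    qed
  qed
  then have "((\<lambda>s::real. resistance (v + s *\<^sub>R h) \<bullet> h) has_field_derivative (B h \<bullet> h)) (at 0)"
    by (simp add: has_field_derivative_def B.scaleR mult_commute_abs)
  then have "((\<lambda>s. (resistance (v + s *\<^sub>R h) \<bullet> h - resistance v \<bullet> h) / s) \<longlongrightarrow> B h \<bullet> h) (at 0)"
    by (simp add: DERIV_def)
  then show ?thesis
  proof (rule tendsto_lowerbound)
    have "a 0 * (norm h)\<^sup>2 \<le> (resistance (v + s *\<^sub>R h) \<bullet> h - resistance v \<bullet> h) / s" if "s \<noteq> 0" for s
    proof -
      have "s\<^sup>2 * (a 0 * (norm h)\<^sup>2) \<le> s * (resistance (v + s *\<^sub>R h) \<bullet> h - resistance v \<bullet> h)"
        using resistance_coercive[of "v + s *\<^sub>R h" v]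
        by (simp add: power_mult_distrib inner_diff algebra_simps)
      also have "\<dots> = s\<^sup>2 * ((resistance (v + s *\<^sub>R h) \<bullet> h - resistance v \<bullet> h) / s)"
        using that by (simp add: power2_eq_square)
      finally show ?thesis
        by (rule mult_left_le_imp_le) (use that in simp)
    qed
    then show "\<forall>\<^sub>F s in at 0. a 0 * (norm h)\<^sup>2 \<le> (resistance (v + s *\<^sub>R h) \<bullet> h - resistance v \<bullet> h) / s"
      by (auto simp: eventually_at intro!: exI[of _ 1])
  qed simp
qed

text \<open>The inverse function theorem in its pointwise form: \<open>law\<close> is Lipschitz, and coercivity makes the derivative
  of its inverse invertible. The bound on the derivative makes that of the flux locally bounded.\<close>

lemma law_has_derivative:
  fixes \<xi> :: "'a::euclidean_space"
  obtains D where "(law has_derivative D) (at \<xi>)" "\<And>v. norm (D v) \<le> norm v / a 0"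
proof -
  obtain B where B: "(resistance has_derivative B) (at (law \<xi>))"
    using resistance_differentiable differentiable_def by blast
  interpret B: bounded_linear B using B by (rule has_derivative_bounded_linear)
  have lower: "a 0 * norm h \<le> norm (B h)" for h
  proof -
    have "a 0 * (norm h)\<^sup>2 \<le> norm (B h) * norm h"
      using resistance_derivative_coercive[OF B] norm_cauchy_schwarz by (rule order_trans)
    then show ?thesis by (cases "h = 0") (auto simp: power2_eq_square)
  qed
  have "inj B"
  proof (rule injI)
    fix x y assume "B x = B y"
    then have "a 0 * norm (x - y) \<le> 0" using lower[of "x - y"] by (simp add: B.diff)
    then show "x = y" using a0_pos by (simp add: mult_le_0_iff)
  qed
  then obtain D where D: "linear D" "\<And>x. D (B x) = x" "\<And>x. B (D x) = x"
    using linear_injective_isomorphism[OF B.linear] by blast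
  have "(law has_derivative D) (at \<xi>)"
  proof (rule has_derivative_inverse_basic[where T = UNIV])
    show "(resistance has_derivative B) (at (law \<xi>))" by (rule B)
    show "bounded_linear D" using D(1) by (simp add: linear_linear)
    show "D \<circ> B = id" using D(2) by auto
    show "continuous (at \<xi>) law"
      using continuous_on_law[of "UNIV :: 'a set"] by (simp add: continuous_on_eq_continuous_at)
  qed (auto simp: resistance_law)
  moreover have "norm (D v) \<le> norm v / a 0" for v
    using lower[of "D v"] a0_pos D(3) by (simp add: field_simps)
  ultimately show thesis by (rule that)
qed

text \<open>The estimate of the diffusion term: \<open>\<xi> - \<zeta>\<close> is the increment of \<open>\<nabla>p\<close> and \<open>\<theta>\<close> that of
  \<open>\<nabla>\<Psi>\<close>. By cocoercivity the left-hand side is at most \<open>f \<bar>\<theta>\<bar> - a 0 f\<^sup>2\<close> with \<open>f\<close> the increment of the flux.\<close>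

lemma law_pairing_lower_bound:
  "- ((law \<xi> - law \<zeta>) \<bullet> ((\<xi> - \<zeta>) - \<theta>)) \<le> (norm \<theta>)\<^sup>2 / (4 * a 0)"
proof -
  define f where "f = norm (law \<xi> - law \<zeta>)"
  have "(law \<xi> - law \<zeta>) \<bullet> \<theta> \<le> f * norm \<theta>" by (simp add: f_def norm_cauchy_schwarz)
  then have "- ((law \<xi> - law \<zeta>) \<bullet> ((\<xi> - \<zeta>) - \<theta>)) \<le> f * norm \<theta> - a 0 * f\<^sup>2"
    using law_cocoercive[of \<xi> \<zeta>] by (simp add: f_def inner_diff_right[of _ "\<xi> - \<zeta>"])
  also have "\<dots> \<le> (norm \<theta>)\<^sup>2 / (4 * a 0)"
  proof -
    have "0 \<le> (norm \<theta> - 2 * a 0 * f)\<^sup>2" by simp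
    then show ?thesis using a0_pos by (simp add: field_simps power2_eq_square)
  qed
  finally show ?thesis .
qed

end

section \<open>Integrals of bounded continuous functions\<close>

lemma set_integrable_bounded:
  fixes f :: "'a::euclidean_space \<Rightarrow> 'b::euclidean_space"
  assumes "S \<in> sets borel" "bounded S" "continuous_on S f" "\<And>x. x \<in> S \<Longrightarrow> norm (f x) \<le> B"
  shows "set_integrable lborel S f"
  unfolding set_integrable_def
proof (rule integrableI_bounded_set[where A = S and B = B])
  show "(\<lambda>x. indicator S x *\<^sub>R f x) \<in> borel_measurable lborel"
    using borel_measurable_continuous_on_indicator[OF assms(1,3)] by simp
  show "emeasure lborel S < \<infinity>"
    using assms(2) emeasure_bounded_finite by auto
qed (use assms in auto)

lemma bounded_convergence_on:
  fixes f :: "nat \<Rightarrow> 'a::euclidean_space \<Rightarrow> real"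
  assumes S: "S \<in> sets borel" "bounded S"
    and meas: "\<And>n. set_borel_measurable lborel S (f n)"
    and bound: "\<And>n x. x \<in> S \<Longrightarrow> \<bar>f n x\<bar> \<le> B"
    and lim: "\<And>x. x \<in> S \<Longrightarrow> (\<lambda>n. f n x) \<longlonglongrightarrow> F x"
  shows "(\<lambda>n. LINT x:S|lborel. f n x) \<longlonglongrightarrow> (LINT x:S|lborel. F x)"
    and "set_integrable lborel S F"
proof -
  let ?w = "\<lambda>x. indicator S x *\<^sub>R \<bar>B\<bar>"
  have fin: "emeasure lborel S < \<infinity>" using S(2) emeasure_bounded_finite by auto
  have w: "integrable lborel ?w"
    using S fin by (intro integrableI_bounded_set[where A = S and B = "\<bar>B\<bar>"]) auto
  have lim': "AE x in lborel. (\<lambda>n. indicator S x *\<^sub>R f n x) \<longlonglongrightarrow> indicator S x *\<^sub>R F x"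
    using lim by (intro AE_I2) (auto simp: indicator_def)
  have bound': "AE x in lborel. norm (indicator S x *\<^sub>R f n x) \<le> ?w x" for n
    by (intro AE_I2) (auto simp: indicator_def intro: order_trans[OF bound abs_ge_self])
  have meas': "(\<lambda>x. indicator S x *\<^sub>R f n x) \<in> borel_measurable lborel" for n
    using meas by (simp add: set_borel_measurable_def)
  have measF: "(\<lambda>x. indicator S x *\<^sub>R F x) \<in> borel_measurable lborel"
    by (rule borel_measurable_LIMSEQ_real[OF _ meas']) (use lim in \<open>auto simp: indicator_def\<close>)
  show "(\<lambda>n. LINT x:S|lborel. f n x) \<longlonglongrightarrow> (LINT x:S|lborel. F x)"
    unfolding set_lebesgue_integral_def
    by (rule integral_dominated_convergence[OF measF meas' w lim' bound'])
  show "set_integrable lborel S F"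
    unfolding set_integrable_def
    by (rule integrable_dominated_convergence[OF measF meas' w lim' bound'])
qed

lemma set_integrable_continuous_closure:
  fixes f :: "'a::euclidean_space \<Rightarrow> 'b::euclidean_space"
  assumes "open U" "bounded U" "continuous_on (closure U) f"
  shows "set_integrable lborel U f"
proof -
  have "bounded (f ` closure U)"
    using assms by (intro compact_imp_bounded compact_continuous_image) (auto simp: compact_closure)
  then obtain B where "\<And>x. x \<in> closure U \<Longrightarrow> norm (f x) \<le> B" by (auto simp: bounded_iff)
  then show ?thesis
    using assms(1,2) closure_subset[of U]
    by (intro set_integrable_bounded[where B = B] continuous_on_subset[OF assms(3)]) auto
qed

section \<open>Compactly supported fields have mean divergence zero\<close>

text \<open>The integral of a difference quotient of a compactly supported function vanishes, because
  Lebesgue measure is translation invariant; the quotients are bounded by the Lipschitz constant and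
  converge to the derivative.\<close>

lemma integral_derivative_compact_support:
  fixes V :: "'a::euclidean_space \<Rightarrow> real"
  assumes der: "\<And>x. (V has_derivative V' x) (at x)"
    and lip: "\<And>x v. \<bar>V' x v\<bar> \<le> L * norm v"
    and supp: "bounded S" "\<And>x. x \<notin> S \<Longrightarrow> V x = 0"
  shows "integrable lborel (\<lambda>x. V' x e)" and "(LINT x|lborel. V' x e) = 0"
proof -
  have cont: "continuous_on UNIV V"
    by (intro continuous_at_imp_continuous_on ballI has_derivative_continuous[OF der])
  obtain R where R: "\<And>x. x \<in> S \<Longrightarrow> norm x \<le> R" using supp(1) bounded_iff by blast
  define B where "B = cball (0::'a) (R + norm e)"
  have outB: "V (x + s *\<^sub>R e) = 0" if "x \<notin> B" "0 \<le> s" "s \<le> 1" for x s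
  proof -
    have "R + norm e < norm x" using that by (simp add: B_def)
    moreover have "norm x \<le> norm (x + s *\<^sub>R e) + s * norm e"
      using norm_triangle_ineq4[of "x + s *\<^sub>R e" "s *\<^sub>R e"] that by simp
    moreover have "s * norm e \<le> norm e" using that by (simp add: mult_left_le_one_le)
    ultimately have "R < norm (x + s *\<^sub>R e)" by linarith
    then show ?thesis using R[of "x + s *\<^sub>R e"] supp(2) by (meson not_le)
  qed
  have B: "B \<in> sets borel" "bounded B" by (auto simp: B_def)
  define h :: "nat \<Rightarrow> real" where "h n = inverse (real (Suc n))" for n
  have h: "0 < h n" "h n \<le> 1" for n by (auto simp: h_def divide_simps)
  have h_lim: "h \<longlonglongrightarrow> 0" unfolding h_def by (rule LIMSEQ_inverse_real_of_nat)
  define q where "q n x = (V (x + h n *\<^sub>R e) - V x) / h n" for n x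
  have cont_shift: "continuous_on UNIV (\<lambda>x. V (x + h n *\<^sub>R e))" for n
    by (rule continuous_on_compose2[OF cont]) (auto intro: continuous_intros)
  have cont_q: "continuous_on UNIV (q n)" for n
    unfolding q_def using h(1)[of n] by (intro continuous_intros cont_shift cont) auto
  have lim_q: "(\<lambda>n. q n x) \<longlonglongrightarrow> V' x e" for x
  proof -
    interpret V': bounded_linear "V' x" using der by (rule has_derivative_bounded_linear)
    have "((\<lambda>s. V (x + s *\<^sub>R e)) has_derivative (\<lambda>s. V' x (s *\<^sub>R e))) (at 0)"
    proof (rule has_derivative_compose[where f = "\<lambda>s. x + s *\<^sub>R e" and f' = "\<lambda>s. s *\<^sub>R e" and g = V and g' = "V' x"])
      show "((\<lambda>s. x + s *\<^sub>R e) has_derivative (\<lambda>s. s *\<^sub>R e)) (at 0)"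
        by (auto intro!: derivative_eq_intros)
      show "(V has_derivative V' x) (at (x + 0 *\<^sub>R e))"
        using der by simp
    qed
    then have "((\<lambda>s. V (x + s *\<^sub>R e)) has_field_derivative V' x e) (at 0)"
      by (simp add: has_field_derivative_def V'.scaleR mult_commute_abs)
    then have "((\<lambda>s. (V (x + s *\<^sub>R e) - V x) / s) \<longlongrightarrow> V' x e) (at 0)"
      by (simp add: DERIV_def)
    moreover have "filterlim h (at 0) sequentially"
      unfolding filterlim_at using h_lim h(1) by (auto simp: less_imp_neq[symmetric])
    ultimately show ?thesis
      unfolding q_def by (rule filterlim_compose)
  qed
  have bound_q: "\<bar>q n x\<bar> \<le> L * norm e" for n x
  proof -
    have "norm (V (x + h n *\<^sub>R e) - V x) \<le> L * norm (x + h n *\<^sub>R e - x)"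
      by (rule differentiable_bound[of UNIV V V'])
         (use der lip in \<open>auto intro!: onorm_le\<close>)
    then show ?thesis using h(1)[of n] by (simp add: q_def field_simps)
  qed
  have zero_q: "q n x = 0" if "x \<notin> B" for n x
    using outB[OF that, of "h n"] outB[OF that, of 0] h(1,2)[of n] by (simp add: q_def)
  have zero_V': "V' x e = 0" if "x \<notin> B" for x
    using lim_q[of x] zero_q[OF that] by (simp add: LIMSEQ_const_iff)
  have int_V: "integrable lborel V"
  proof -
    have "compact B" by (simp add: B_def)
    then obtain C where "\<And>x. x \<in> B \<Longrightarrow> norm (V x) \<le> C"
      using compact_imp_bounded[OF compact_continuous_image[OF continuous_on_subset[OF cont]], of B]
      by (auto simp: bounded_iff)
    then have "set_integrable lborel B V"
      using B continuous_on_subset[OF cont] by (intro set_integrable_bounded) auto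
    moreover have "indicator B x *\<^sub>R V x = V x" for x
      using outB[of x 0] by (cases "x \<in> B") auto
    ultimately show ?thesis by (simp only: set_integrable_def)
  qed
  have shift: "integrable lborel (\<lambda>x. V (x + h n *\<^sub>R e))"
    "(LINT x|lborel. V (x + h n *\<^sub>R e)) = (LINT x|lborel. V x)" for n
  proof -
    let ?c = "h n *\<^sub>R e"
    have meas: "(+) ?c \<in> measurable lborel borel" "V \<in> borel_measurable borel"
      using borel_measurable_continuous_onI[OF cont] by simp_all
    show "integrable lborel (\<lambda>x. V (x + ?c))"
      using integrable_distr[OF meas(1), of V] int_V by (simp add: lborel_distr_plus add.commute)
    show "(LINT x|lborel. V (x + ?c)) = (LINT x|lborel. V x)"
      using integral_distr[OF meas] by (simp add: lborel_distr_plus add.commute)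
  qed
  have int_q: "(LINT x:B|lborel. q n x) = 0" for n
  proof -
    have "(LINT x:B|lborel. q n x) = (LINT x|lborel. q n x)"
      unfolding set_lebesgue_integral_def
      by (rule Bochner_Integration.integral_cong) (use zero_q in \<open>auto simp: indicator_def\<close>)
    also have "\<dots> = 0"
      unfolding q_def using shift int_V by simp
    finally show ?thesis .
  qed
  have meas_q: "set_borel_measurable lborel B (q n)" for n
    unfolding set_borel_measurable_def
    using borel_measurable_continuous_on_indicator[OF B(1) continuous_on_subset[OF cont_q]] by simp
  have conv: "(\<lambda>n. LINT x:B|lborel. q n x) \<longlonglongrightarrow> (LINT x:B|lborel. V' x e)" "set_integrable lborel B (\<lambda>x. V' x e)"
    by (rule bounded_convergence_on[OF B meas_q bound_q lim_q])+
  have ind: "indicator B x *\<^sub>R V' x e = V' x e" for x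
    using zero_V'[of x] by (cases "x \<in> B") auto
  show "integrable lborel (\<lambda>x. V' x e)"
    using conv(2) by (simp only: set_integrable_def ind)
  show "(LINT x|lborel. V' x e) = 0"
    using conv(1) unfolding int_q LIMSEQ_const_iff by (simp only: set_lebesgue_integral_def ind)
qed

lemma integral_divergence_compact_support:
  fixes V :: "'a::euclidean_space \<Rightarrow> 'a"
  assumes der: "\<And>x. (V has_derivative V' x) (at x)"
    and lip: "\<And>x v. norm (V' x v) \<le> L * norm v"
    and supp: "bounded S" "\<And>x. x \<notin> S \<Longrightarrow> V x = 0"
  shows "(LINT x|lborel. (\<Sum>b\<in>Basis. V' x b \<bullet> b)) = 0"
proof -
  have *: "integrable lborel (\<lambda>x. V' x b \<bullet> b)" "(LINT x|lborel. V' x b \<bullet> b) = 0" if b: "b \<in> Basis" for b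
  proof -
    have d: "((\<lambda>x. V x \<bullet> b) has_derivative (\<lambda>v. V' x v \<bullet> b)) (at x)" for x
      by (rule has_derivative_inner_left[OF der])
    have l: "\<bar>V' x v \<bullet> b\<bar> \<le> L * norm v" for x v
      using Basis_le_norm[OF b, of "V' x v"] lip[of x v] by simp
    show "integrable lborel (\<lambda>x. V' x b \<bullet> b)" "(LINT x|lborel. V' x b \<bullet> b) = 0"
      by (rule integral_derivative_compact_support[OF d l supp(1)]; simp add: supp(2))+
  qed
  then show ?thesis by simp
qed

lemma has_derivative_scalar_mult_field:
  fixes F :: "'a::euclidean_space \<Rightarrow> 'a"
  assumes "(\<xi> has_derivative (\<lambda>v. d \<bullet> v)) (at x)" "(F has_derivative F') (at x)"
  shows "((\<lambda>y. \<xi> y *\<^sub>R F y) has_derivative (\<lambda>v. \<xi> x *\<^sub>R F' v + (d \<bullet> v) *\<^sub>R F x)) (at x)"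
  using has_derivative_scaleR[OF assms] by simp

text \<open>The divergence of \<open>\<xi> F\<close> is \<open>\<xi> div F + F \<cdot> \<nabla>\<xi>\<close>. Extended by zero, \<open>\<xi> F\<close> is differentiable on
  the whole space with bounded derivative, since \<open>\<xi>\<close> vanishes off a compact subset of \<open>U\<close>.\<close>

lemma green_compact_support:
  fixes F :: "'a::euclidean_space \<Rightarrow> 'a"
  assumes U: "open U"
    and F: "\<And>x. x \<in> U \<Longrightarrow> (F has_derivative F' x) (at x)"
      "\<And>C. compact C \<Longrightarrow> C \<subseteq> U \<Longrightarrow> \<exists>L. \<forall>x\<in>C. \<forall>v. norm (F' x v) \<le> L * norm v"
    and \<xi>: "\<And>x. x \<in> U \<Longrightarrow> (\<xi> has_derivative (\<lambda>v. d\<xi> x \<bullet> v)) (at x)"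
      "\<And>x. x \<in> S \<Longrightarrow> norm (d\<xi> x) \<le> C"
    and S: "compact S" "S \<subseteq> U" "\<And>x. x \<in> U - S \<Longrightarrow> \<xi> x = 0 \<and> d\<xi> x = 0"
  shows "(LINT x:U|lborel. \<xi> x * (\<Sum>b\<in>Basis. F' x b \<bullet> b) + F x \<bullet> d\<xi> x) = 0"
proof -
  define V where "V x = (if x \<in> U then \<xi> x *\<^sub>R F x else 0)" for x
  define V' where "V' x v = (if x \<in> S then \<xi> x *\<^sub>R F' x v + (d\<xi> x \<bullet> v) *\<^sub>R F x else 0)" for x v
  have V0: "V x = 0" if "x \<notin> S" for x
    using S(3)[of x] that by (auto simp: V_def)
  have der: "(V has_derivative V' x) (at x)" for x
  proof (cases "x \<in> S")
    case True
    then have xU: "x \<in> U" using S(2) by blast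
    have "((\<lambda>y. \<xi> y *\<^sub>R F y) has_derivative V' x) (at x)"
      unfolding V'_def using True has_derivative_scalar_mult_field[OF \<xi>(1)[OF xU] F(1)[OF xU]] by simp
    then show ?thesis
      by (rule has_derivative_transform_within_open[OF _ U xU]) (simp add: V_def)
  next
    case False
    have "((\<lambda>y. 0) has_derivative V' x) (at x)"
      unfolding V'_def using False by simp
    then show ?thesis
      by (rule has_derivative_transform_within_open[where s = "- S"])
         (use S(1) False V0 in \<open>auto simp: compact_imp_closed\<close>)
  qed
  obtain L where L: "\<And>x v. x \<in> S \<Longrightarrow> norm (F' x v) \<le> L * norm v"
    using F(2)[OF S(1,2)] by blast
  have "bounded (F ` S)" "bounded (\<xi> ` S)"
    using S(1,2) F(1) \<xi>(1)
    by (auto intro!: compact_imp_bounded compact_continuous_image continuous_at_imp_continuous_on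
        intro: has_derivative_continuous)
  then obtain M M' where M: "\<And>x. x \<in> S \<Longrightarrow> norm (F x) \<le> M" "\<And>x. x \<in> S \<Longrightarrow> \<bar>\<xi> x\<bar> \<le> M'"
    unfolding bounded_iff by auto
  have lip: "norm (V' x v) \<le> (\<bar>M'\<bar> * \<bar>L\<bar> + \<bar>C\<bar> * \<bar>M\<bar>) * norm v" for x v
  proof (cases "x \<in> S")
    case True
    have "norm (F' x v) \<le> \<bar>L\<bar> * norm v"
      using L[OF True, of v] by (meson abs_ge_self mult_right_mono norm_ge_zero order_trans)
    then have "norm (\<xi> x *\<^sub>R F' x v) \<le> \<bar>M'\<bar> * (\<bar>L\<bar> * norm v)"
      using M(2)[OF True] by (auto intro!: mult_mono)
    moreover have "\<bar>d\<xi> x \<bullet> v\<bar> \<le> \<bar>C\<bar> * norm v"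
      using Cauchy_Schwarz_ineq2[of "d\<xi> x" v] \<xi>(2)[OF True]
      by (meson abs_ge_self mult_right_mono norm_ge_zero order_trans)
    then have "norm ((d\<xi> x \<bullet> v) *\<^sub>R F x) \<le> (\<bar>C\<bar> * norm v) * \<bar>M\<bar>"
      using M(1)[OF True] by (auto intro!: mult_mono)
    ultimately have "norm (\<xi> x *\<^sub>R F' x v + (d\<xi> x \<bullet> v) *\<^sub>R F x) \<le> \<bar>M'\<bar> * (\<bar>L\<bar> * norm v) + (\<bar>C\<bar> * norm v) * \<bar>M\<bar>"
      by (rule norm_triangle_mono)
    then show ?thesis using True by (simp add: V'_def algebra_simps)
  qed (simp add: V'_def)
  have "(LINT x|lborel. (\<Sum>b\<in>Basis. V' x b \<bullet> b)) = 0"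
    by (rule integral_divergence_compact_support[OF der lip compact_imp_bounded[OF S(1)] V0])
  moreover have "(\<Sum>b\<in>Basis. V' x b \<bullet> b) = indicator U x *\<^sub>R (\<xi> x * (\<Sum>b\<in>Basis. F' x b \<bullet> b) + F x \<bullet> d\<xi> x)" for x
  proof (cases "x \<in> S")
    case True
    have "(\<Sum>b\<in>Basis. V' x b \<bullet> b) = \<xi> x * (\<Sum>b\<in>Basis. F' x b \<bullet> b) + (\<Sum>b\<in>Basis. (F x \<bullet> b) * (d\<xi> x \<bullet> b))"
      using True by (simp add: V'_def inner_add_left sum.distrib sum_distrib_left mult.commute)
    then show ?thesis using True S(2) euclidean_inner[of "F x" "d\<xi> x"] by auto
  next
    case False
    then show ?thesis using S(3)[of x] by (cases "x \<in> U") (auto simp: V'_def)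
  qed
  ultimately show ?thesis by (simp add: set_lebesgue_integral_def)
qed

section \<open>Gradients and charts of the boundary\<close>

lemma grad_eqI:
  assumes "(f has_derivative (\<lambda>h. D \<bullet> h)) (at x)" "open S" "x \<in> S" "S \<subseteq> T"
  shows "grad T f x = D"
proof -
  have at: "at x within T = at x"
    using assms(2-4) at_within_interior interior_maximal by blast
  show ?thesis
    unfolding grad_def at
  proof (rule the_equality)
    fix E assume "(f has_derivative (\<lambda>h. E \<bullet> h)) (at x)"
    then have "(\<lambda>h. E \<bullet> h) = (\<lambda>h. D \<bullet> h)"
      by (rule has_derivative_unique) (rule assms(1))
    then show "E = D" by (metis vector_eq_rdot)
  qed (rule assms(1))
qed

lemma has_derivative_grad:
  assumes "f differentiable (at x within T)" "open S" "x \<in> S" "S \<subseteq> T"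
  shows "(f has_derivative (\<lambda>h. grad T f x \<bullet> h)) (at x)"
proof -
  have at: "at x within T = at x"
    using assms(2-4) at_within_interior interior_maximal by blast
  then obtain D where D: "(f has_derivative D) (at x)"
    using assms(1) by (auto simp: differentiable_def)
  interpret D: bounded_linear D using D by (rule has_derivative_bounded_linear)
  have "D = (\<lambda>h. (\<Sum>b\<in>Basis. D b *\<^sub>R b) \<bullet> h)"
  proof
    fix h
    have "D h = D (\<Sum>b\<in>Basis. (h \<bullet> b) *\<^sub>R b)" by (simp add: euclidean_representation)
    also have "\<dots> = (\<Sum>b\<in>Basis. D b *\<^sub>R b) \<bullet> h"
      by (simp add: D.sum D.scaleR inner_sum_left inner_commute[of h] mult.commute)
    finally show "D h = (\<Sum>b\<in>Basis. D b *\<^sub>R b) \<bullet> h" .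
  qed
  with D have *: "(f has_derivative (\<lambda>h. (\<Sum>b\<in>Basis. D b *\<^sub>R b) \<bullet> h)) (at x)" by simp
  from grad_eqI[OF * assms(2-4)] * show ?thesis by simp
qed

lemma chart_nbhd:
  assumes "C2_graph_at U x \<nu> h"
  shows "\<exists>r>0. \<forall>y\<in>ball x r. (y \<in> U \<longleftrightarrow> 0 < h y - y \<bullet> \<nu>) \<and> C2_graph_at U y \<nu> h"
proof -
  obtain r where r: "r > 0" "U \<inter> ball x r = {y \<in> ball x r. y \<bullet> \<nu> < h y}"
    using assms by (auto simp: C2_graph_at_def)
  have "C2_graph_at U y \<nu> h" if "y \<in> ball x r" for y
  proof -
    have sub: "ball y (r - dist x y) \<subseteq> ball x r" by (simp add: ball_subset_ball_iff dist_commute)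
    have "U \<inter> ball y (r - dist x y) = {z \<in> ball y (r - dist x y). z \<bullet> \<nu> < h z}"
      using r(2) sub by blast
    moreover have "r - dist x y > 0" using that by simp
    ultimately show ?thesis using assms unfolding C2_graph_at_def by blast
  qed
  with r show ?thesis by (intro exI[of _ r]) auto
qed

lemma chart_derivative:
  assumes "C2_graph_at U x \<nu> h"
  shows "(h has_derivative (\<lambda>v. grad UNIV h y \<bullet> v)) (at y)"
    and "continuous_on UNIV (grad UNIV h)"
    and "grad UNIV h y \<bullet> \<nu> = 0"
proof -
  obtain g where g: "\<And>x. GDERIV h x :> g x" "C1_on UNIV g"
    using assms by (auto simp: C2_graph_at_def C2_on_def)
  have d: "(h has_derivative (\<lambda>v. g y \<bullet> v)) (at y)" for y
    using g(1)[of y] by (simp add: gderiv_def inner_commute)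
  have grad: "grad UNIV h = g"
    using grad_eqI[OF d open_UNIV] by auto
  show h: "(h has_derivative (\<lambda>v. grad UNIV h y \<bullet> v)) (at y)" by (simp add: grad d)
  show "continuous_on UNIV (grad UNIV h)"
    using g(2) unfolding C1_on_def grad
    by (auto intro!: continuous_at_imp_continuous_on intro: has_derivative_continuous)
  have "((\<lambda>s::real. h (y + s *\<^sub>R \<nu>)) has_derivative (\<lambda>s. grad UNIV h y \<bullet> (s *\<^sub>R \<nu>))) (at 0)"
  proof (rule has_derivative_compose[where f = "\<lambda>s. y + s *\<^sub>R \<nu>" and f' = "\<lambda>s. s *\<^sub>R \<nu>" and g = h and g' = "\<lambda>v. grad UNIV h y \<bullet> v"])
    show "((\<lambda>s. y + s *\<^sub>R \<nu>) has_derivative (\<lambda>s. s *\<^sub>R \<nu>)) (at 0)"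
      by (auto intro!: derivative_eq_intros)
  qed (use h in simp)
  moreover have "(\<lambda>s::real. h (y + s *\<^sub>R \<nu>)) = (\<lambda>s. h y)"
    using assms by (simp add: C2_graph_at_def)
  ultimately have "((\<lambda>s::real. h y) has_derivative (\<lambda>s. grad UNIV h y \<bullet> (s *\<^sub>R \<nu>))) (at 0)"
    by simp
  then have "(\<lambda>s::real. grad UNIV h y \<bullet> (s *\<^sub>R \<nu>)) = (\<lambda>s. 0)"
    by (rule has_derivative_unique) simp
  from fun_cong[OF this, of 1] show "grad UNIV h y \<bullet> \<nu> = 0" by simp
qed

lemma chart_frontier:
  assumes c: "C2_graph_at U x \<nu> h" and "open U" "x \<in> frontier U"
  shows "h x - x \<bullet> \<nu> = 0"
proof -
  obtain r where r: "r > 0" "\<And>y. y \<in> ball x r \<Longrightarrow> (y \<in> U \<longleftrightarrow> 0 < h y - y \<bullet> \<nu>) \<and> C2_graph_at U y \<nu> h"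
    using chart_nbhd[OF c] by metis
  have "x \<notin> U" using assms(2,3) by (simp add: frontier_def interior_open)
  then have "h x - x \<bullet> \<nu> \<le> 0" using r by fastforce
  moreover have "h x - x \<bullet> \<nu> \<ge> 0"
  proof (rule ccontr)
    assume neg: "\<not> h x - x \<bullet> \<nu> \<ge> 0"
    have "continuous (at x) (\<lambda>y. h y - y \<bullet> \<nu>)"
      by (intro continuous_intros has_derivative_continuous[OF chart_derivative(1)[OF c]])
    then have "\<forall>\<^sub>F y in at x. h y - y \<bullet> \<nu> < 0"
      unfolding continuous_at by (rule order_tendstoD(2)) (use neg in simp)
    then obtain d where d: "d > 0" "\<And>y. y \<noteq> x \<Longrightarrow> dist y x < d \<Longrightarrow> h y - y \<bullet> \<nu> < 0"
      by (auto simp: eventually_at)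
    have "x \<in> closure U" using assms(3) by (simp add: frontier_def)
    then obtain y where "y \<in> U" "dist y x < min d r"
      using d(1) r(1) unfolding closure_approachable by (meson min_less_iff_conj)
    with d(2) r(2)[of y] \<open>x \<notin> U\<close> show False by (force simp: dist_commute)
  qed
  ultimately show ?thesis by simp
qed

lemma chart_normal_nonzero:
  assumes c: "C2_graph_at U x \<nu> h"
  shows "\<nu> - grad UNIV h y \<noteq> 0"
proof
  assume "\<nu> - grad UNIV h y = 0"
  then have "(\<nu> - grad UNIV h y) \<bullet> \<nu> = 0" by simp
  then have "\<nu> \<bullet> \<nu> = 0" using chart_derivative(3)[OF c] by (simp add: inner_diff_left)
  moreover have "norm \<nu> = 1" using c by (simp add: C2_graph_at_def)
  ultimately show False by auto
qed

text \<open>Moving from \<open>x\<close> in a direction which the first chart sees as pointing inward leads into \<open>U\<close>; if the second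
  chart saw it as pointing strictly outward, it would lead out of \<open>U\<close>.\<close>

lemma chart_half_space:
  assumes c: "C2_graph_at U x \<nu> h" "C2_graph_at U x \<nu>' h'" and U: "open U" "x \<in> frontier U"
    and v: "(\<nu> - grad UNIV h x) \<bullet> v < 0"
  shows "(\<nu>' - grad UNIV h' x) \<bullet> v \<le> 0"
proof (rule ccontr)
  assume "\<not> ?thesis"
  then have v': "(grad UNIV h' x - \<nu>') \<bullet> v < 0" by (simp add: inner_diff_left)
  have v: "(grad UNIV h x - \<nu>) \<bullet> v > 0" using v by (simp add: inner_diff_left)
  have der: "((\<lambda>s. h (x + s *\<^sub>R v) - (x + s *\<^sub>R v) \<bullet> \<nu>) has_field_derivative (grad UNIV h x - \<nu>) \<bullet> v) (at 0)"
    if c: "C2_graph_at U x \<nu> h" for \<nu> h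
  proof -
    have "((\<lambda>s::real. h (x + s *\<^sub>R v)) has_derivative (\<lambda>s. grad UNIV h x \<bullet> (s *\<^sub>R v))) (at 0)"
    proof (rule has_derivative_compose[where f = "\<lambda>s. x + s *\<^sub>R v" and f' = "\<lambda>s. s *\<^sub>R v" and g = h and g' = "\<lambda>v. grad UNIV h x \<bullet> v"])
      show "((\<lambda>s. x + s *\<^sub>R v) has_derivative (\<lambda>s. s *\<^sub>R v)) (at 0)"
        by (auto intro!: derivative_eq_intros)
    qed (use chart_derivative(1)[OF c] in simp)
    moreover have "((\<lambda>s::real. (x + s *\<^sub>R v) \<bullet> \<nu>) has_derivative (\<lambda>s. (s *\<^sub>R v) \<bullet> \<nu>)) (at 0)"
      by (auto intro!: derivative_eq_intros)
    ultimately have "((\<lambda>s::real. h (x + s *\<^sub>R v) - (x + s *\<^sub>R v) \<bullet> \<nu>) has_derivative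
        (\<lambda>s. grad UNIV h x \<bullet> (s *\<^sub>R v) - (s *\<^sub>R v) \<bullet> \<nu>)) (at 0)"
      by (rule has_derivative_diff)
    then show ?thesis
      unfolding has_field_derivative_def
      by (rule has_derivative_eq_rhs) (auto simp: inner_diff_left inner_commute algebra_simps)
  qed
  obtain r where r: "r > 0" "\<And>y. y \<in> ball x r \<Longrightarrow> (y \<in> U \<longleftrightarrow> 0 < h y - y \<bullet> \<nu>) \<and> C2_graph_at U y \<nu> h"
    using chart_nbhd[OF c(1)] by metis
  obtain r' where r': "r' > 0" "\<And>y. y \<in> ball x r' \<Longrightarrow> (y \<in> U \<longleftrightarrow> 0 < h' y - y \<bullet> \<nu>') \<and> C2_graph_at U y \<nu>' h'"
    using chart_nbhd[OF c(2)] by metis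
  obtain d where d: "d > 0" "\<And>s. 0 < s \<Longrightarrow> s < d \<Longrightarrow> 0 < h (x + s *\<^sub>R v) - (x + s *\<^sub>R v) \<bullet> \<nu>"
    using DERIV_pos_inc_right[OF der[OF c(1)] v] chart_frontier[OF c(1) U]
    by (simp only: scaleR_zero_left add_0_right add_0) blast
  obtain d' where d': "d' > 0" "\<And>s. 0 < s \<Longrightarrow> s < d' \<Longrightarrow> h' (x + s *\<^sub>R v) - (x + s *\<^sub>R v) \<bullet> \<nu>' < 0"
    using DERIV_neg_dec_right[OF der[OF c(2)] v'] chart_frontier[OF c(2) U]
    by (simp only: scaleR_zero_left add_0_right add_0) blast
  have "v \<noteq> 0" using v by auto
  \<comment> \<open>A step so short that both charts and both sign statements apply.\<close>
  define s where "s = min (min (d / 2) (d' / 2)) (min (r / (2 * norm v)) (r' / (2 * norm v)))"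
  have "s > 0" using d d' r r' \<open>v \<noteq> 0\<close> by (simp add: s_def)
  moreover have "s \<le> d / 2" "s \<le> d' / 2" "s \<le> r / (2 * norm v)" "s \<le> r' / (2 * norm v)"
    by (simp_all add: s_def)
  ultimately have s: "0 < s" "s < d" "s < d'" "s * norm v < r" "s * norm v < r'"
    using d(1) d'(1) r(1) r'(1) \<open>v \<noteq> 0\<close> by (simp_all add: field_simps)
  then have "x + s *\<^sub>R v \<in> ball x r" "x + s *\<^sub>R v \<in> ball x r'"
    by (simp_all add: dist_norm)
  then have "0 < h' (x + s *\<^sub>R v) - (x + s *\<^sub>R v) \<bullet> \<nu>'"
    using r(2) r'(2) d(2)[OF s(1,2)] by blast
  then show False using d'(2)[OF s(1,3)] by linarith
qed

text \<open>Two charts at \<open>x\<close> describe the same set, so their half-spaces of inward directions agree up to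
  boundary, and a half-space determines its unit normal.\<close>

lemma outward_normal_chart:
  assumes c: "C2_graph_at U x \<nu> h" and U: "open U" "x \<in> frontier U"
  shows "outward_normal U x = sgn (\<nu> - grad UNIV h x)"
  unfolding outward_normal_def
proof (rule the_equality)
  show "\<exists>\<nu>' h'. C2_graph_at U x \<nu>' h' \<and> sgn (\<nu> - grad UNIV h x) = sgn (\<nu>' - grad UNIV h' x)"
    using c by blast
  fix N assume "\<exists>\<nu>' h'. C2_graph_at U x \<nu>' h' \<and> N = sgn (\<nu>' - grad UNIV h' x)"
  then obtain \<nu>' h' where c': "C2_graph_at U x \<nu>' h'" and N: "N = sgn (\<nu>' - grad UNIV h' x)" by blast
  define m where "m = \<nu> - grad UNIV h x"
  define m' where "m' = \<nu>' - grad UNIV h' x"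
  have m: "m \<noteq> 0" "m' \<noteq> 0"
    unfolding m_def m'_def by (rule chart_normal_nonzero[OF c], rule chart_normal_nonzero[OF c'])
  show "N = sgn (\<nu> - grad UNIV h x)"
  proof (rule ccontr)
    assume "N \<noteq> sgn (\<nu> - grad UNIV h x)"
    then have ne: "sgn m' \<noteq> sgn m" by (simp add: N m_def m'_def)
    have one: "sgn m \<bullet> sgn m = 1" "sgn m' \<bullet> sgn m' = 1"
      using m by (simp_all add: norm_sgn flip: power2_norm_eq_inner)
    have "0 < (norm (sgn m' - sgn m))\<^sup>2" using ne by simp
    then have lt: "sgn m \<bullet> sgn m' < 1"
      using one by (simp add: power2_norm_eq_inner inner_diff inner_commute)
    \<comment> \<open>The direction \<open>sgn m' - sgn m\<close> points inward for \<open>m\<close> and outward for \<open>m'\<close>.\<close>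
    have "m \<bullet> (sgn m' - sgn m) = norm m * (sgn m \<bullet> (sgn m' - sgn m))"
      using m by (simp add: sgn_div_norm)
    also have "\<dots> < 0" using m lt one by (simp add: inner_diff_right mult_pos_neg)
    finally have "m' \<bullet> (sgn m' - sgn m) \<le> 0"
      using chart_half_space[OF c c' U] by (simp add: m_def m'_def)
    moreover have "m' \<bullet> (sgn m' - sgn m) = norm m' * (sgn m' \<bullet> (sgn m' - sgn m))"
      using m by (simp add: sgn_div_norm)
    moreover have "sgn m' \<bullet> (sgn m' - sgn m) > 0" using lt one by (simp add: inner_diff_right inner_commute)
    ultimately show False using m by (simp add: mult_le_0_iff)
  qed
qed

section \<open>Cutoff functions\<close>

lemma has_real_derivative_pos_part_power:
  assumes "n \<ge> 1"
  shows "((\<lambda>x::real. max 0 x ^ Suc n) has_real_derivative real (Suc n) * max 0 x ^ n) (at x)"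
proof -
  consider "x > 0" | "x < 0" | "x = 0" by linarith
  then show ?thesis
  proof cases
    case 1
    have "((\<lambda>x::real. x ^ Suc n) has_real_derivative real (Suc n) * x ^ n) (at x)"
      using DERIV_pow[of "Suc n" x] by simp
    then have "((\<lambda>x::real. max 0 x ^ Suc n) has_real_derivative real (Suc n) * x ^ n) (at x)"
      by (rule has_field_derivative_transform_within_open[of _ _ _ "{0<..}"]) (use 1 in auto)
    then show ?thesis using 1 by simp
  next
    case 2
    have "((\<lambda>x::real. max 0 x ^ Suc n) has_real_derivative 0) (at x)"
      by (rule has_field_derivative_transform_within_open[of "\<lambda>x. 0" _ _ "{..<0}"]) (use 2 in auto)
    then show ?thesis using 2 assms by (simp add: power_0_left del: power_Suc)
  next
    case 3
    have "((\<lambda>h::real. \<bar>h\<bar> ^ n) \<longlongrightarrow> 0) (at 0)"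
      using tendsto_power[OF tendsto_rabs[OF tendsto_ident_at[of "0::real" UNIV]], of n] assms
      by (simp add: power_0_left)
    then have "((\<lambda>h::real. max 0 h ^ Suc n / h) \<longlongrightarrow> 0) (at 0)"
    proof (rule Lim_null_comparison[rotated])
      have "norm (max 0 h ^ Suc n / h) \<le> \<bar>h\<bar> ^ n" for h :: real
        by (cases "h > 0") auto
      then show "\<forall>\<^sub>F h::real in at 0. norm (max 0 h ^ Suc n / h) \<le> \<bar>h\<bar> ^ n" by simp
    qed
    then show ?thesis using 3 assms by (simp add: DERIV_def power_0_left del: power_Suc)
  qed
qed

text \<open>A second difference of the squared positive part: continuously differentiable, equal to \<open>0\<close> up to \<open>1\<close>
  and to \<open>1\<close> from \<open>2\<close> on. Vanishing up to \<open>1\<close>, not merely at \<open>0\<close>, makes the supports compact.\<close>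

definition cutoff :: "real \<Rightarrow> real" where
  "cutoff s = 2 * ((max 0 (s - 1))\<^sup>2 - 2 * (max 0 (s - 3/2))\<^sup>2 + (max 0 (s - 2))\<^sup>2)"

definition cutoff' :: "real \<Rightarrow> real" where
  "cutoff' s = 4 * (max 0 (s - 1) - 2 * max 0 (s - 3/2) + max 0 (s - 2))"

lemma cutoff_derivative: "(cutoff has_real_derivative cutoff' s) (at s)"
proof -
  have *: "((\<lambda>s. (max 0 (s - c))\<^sup>2) has_real_derivative 2 * max 0 (s - c)) (at s)" for c
  proof -
    have "((\<lambda>s. max 0 (s - c) ^ Suc 1) has_real_derivative (real (Suc 1) * max 0 (s - c) ^ 1) * 1) (at s)"
    proof (rule DERIV_chain2[where f = "\<lambda>x. max 0 x ^ Suc 1" and g = "\<lambda>s. s - c"])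
      show "((\<lambda>x. max 0 x ^ Suc 1) has_real_derivative real (Suc 1) * max 0 (s - c) ^ 1) (at (s - c))"
        by (rule has_real_derivative_pos_part_power) simp
    qed (auto intro!: derivative_eq_intros)
    then show ?thesis by (simp add: numeral_2_eq_2)
  qed
  show ?thesis
    unfolding cutoff_def cutoff'_def
    by (rule derivative_eq_intros * refl)+ (simp add: algebra_simps)
qed

lemma cutoff_below: "cutoff s = 0" "cutoff' s = 0" if "s \<le> 1"
  using that by (auto simp: cutoff_def cutoff'_def)

lemma cutoff_above: "cutoff s = 1" "cutoff' s = 0" if "2 \<le> s"
  using that by (simp_all add: cutoff_def cutoff'_def max_def power2_eq_square algebra_simps)

lemma cutoff'_bounds: "0 \<le> cutoff' s" "cutoff' s \<le> 2"
  by (auto simp: cutoff'_def max_def)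

lemma cutoff_bounds: "0 \<le> cutoff s" "cutoff s \<le> 1"
proof -
  have mono: "cutoff s \<le> cutoff t" if "s \<le> t" for s t
    by (rule DERIV_nonneg_imp_nondecreasing[OF that])
       (use cutoff_derivative cutoff'_bounds(1) in blast)
  show "0 \<le> cutoff s" using mono[of "min s 1" s] by (simp add: cutoff_below)
  show "cutoff s \<le> 1" using mono[of s "max s 2"] by (simp add: cutoff_above)
qed

text \<open>The \<open>m\<close> translates of the strip by multiples of \<open>\<nu> / m\<close> are disjoint, have equal measure, and lie in
  a ball of radius \<open>R + 1\<close>.\<close>

lemma measure_strip:
  fixes \<nu> :: "'a::euclidean_space"
  assumes \<nu>: "norm \<nu> = 1" and cont: "continuous_on UNIV \<rho>"
    and \<rho>: "\<And>y s. \<rho> (y + s *\<^sub>R \<nu>) = \<rho> y - s"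
    and m: "m > (0::nat)"
  shows "real m * measure lborel (cball x R \<inter> {y. 0 < \<rho> y \<and> \<rho> y < 1 / real m}) \<le> measure lborel (cball x (R + 1))"
proof -
  define S where "S = cball x R \<inter> {y. 0 < \<rho> y \<and> \<rho> y < 1 / real m}"
  have meas: "S \<in> sets borel"
    unfolding S_def using cont
    by (intro sets.Int borel_closed closed_cball borel_open open_Collect_conj open_Collect_less)
       (auto intro: continuous_intros)
  define T where "T j = (+) ((real j / real m) *\<^sub>R \<nu>) -` S" for j
  have T_meas: "T j \<in> sets borel" for j
    unfolding T_def using measurable_sets_borel[OF _ meas, of "(+) ((real j / real m) *\<^sub>R \<nu>)"] by simp
  have em: "emeasure lborel (T j) = emeasure lborel S" for j
  proof -
    have "emeasure lborel S = emeasure (distr lborel borel ((+) ((real j / real m) *\<^sub>R \<nu>))) S"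
      by (simp add: lborel_distr_plus)
    also have "\<dots> = emeasure lborel (T j)"
      using meas by (subst emeasure_distr) (auto simp: T_def)
    finally show ?thesis by simp
  qed
  have T_rho: "real j < real m * \<rho> y \<and> real m * \<rho> y < real j + 1" if "y \<in> T j" for y j
  proof -
    have "0 < \<rho> (y + (real j / real m) *\<^sub>R \<nu>)" "\<rho> (y + (real j / real m) *\<^sub>R \<nu>) < 1 / real m"
      using that by (auto simp: T_def S_def add.commute)
    then have "real j / real m < \<rho> y" "\<rho> y < (real j + 1) / real m"
      by (simp_all add: \<rho> add_divide_distrib)
    then show ?thesis using m by (simp_all add: pos_less_divide_eq pos_divide_less_eq mult.commute)
  qed
  have disj: "disjoint_family_on T {..<m}"
    unfolding disjoint_family_on_def
  proof (intro ballI impI)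
    fix i j :: nat assume "i \<noteq> j"
    have False if "y \<in> T i" "y \<in> T j" for y
      using T_rho[OF that(1)] T_rho[OF that(2)] \<open>i \<noteq> j\<close> by linarith
    then show "T i \<inter> T j = {}" by blast
  qed
  have sub: "(\<Union>j<m. T j) \<subseteq> cball x (R + 1)"
  proof
    fix y assume "y \<in> (\<Union>j<m. T j)"
    then obtain j where j: "j < m" "y \<in> T j" by blast
    then have "dist x (y + (real j / real m) *\<^sub>R \<nu>) \<le> R" by (auto simp: T_def S_def add.commute)
    moreover have "dist (y + (real j / real m) *\<^sub>R \<nu>) y \<le> 1"
      using j m \<nu> by (simp add: dist_norm)
    ultimately show "y \<in> cball x (R + 1)"
      using dist_triangle[of x y "y + (real j / real m) *\<^sub>R \<nu>"] by simp
  qed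
  have "of_nat m * emeasure lborel S = (\<Sum>j<m. emeasure lborel (T j))" by (simp add: em)
  also have "\<dots> = emeasure lborel (\<Union>j<m. T j)"
    using T_meas disj by (intro sum_emeasure) auto
  also have "\<dots> \<le> emeasure lborel (cball x (R + 1))"
    using sub by (intro emeasure_mono) auto
  finally have "of_nat m * emeasure lborel S \<le> emeasure lborel (cball x (R + 1))" .
  moreover have "emeasure lborel A = ennreal (measure lborel A)" if "bounded A" for A :: "'a set"
    using emeasure_bounded_finite[OF that] by (intro emeasure_eq_ennreal_measure) simp
  then have "emeasure lborel S = ennreal (measure lborel S)"
    "emeasure lborel (cball x (R + 1)) = ennreal (measure lborel (cball x (R + 1)))"
    by (simp_all add: S_def bounded_Int)
  ultimately show ?thesis
    unfolding S_def[symmetric] by (simp add: ennreal_of_nat_eq_real_of_nat flip: ennreal_mult)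
qed

text \<open>The unnormalised functions of a partition of unity.\<close>

definition bump :: "real \<Rightarrow> 'a::euclidean_space \<Rightarrow> 'a \<Rightarrow> real" where
  "bump r x y = (max 0 (r\<^sup>2 - (y - x) \<bullet> (y - x)))\<^sup>2"

definition bump_grad :: "real \<Rightarrow> 'a::euclidean_space \<Rightarrow> 'a \<Rightarrow> 'a" where
  "bump_grad r x y = (- 4 * max 0 (r\<^sup>2 - (y - x) \<bullet> (y - x))) *\<^sub>R (y - x)"

lemma bump_derivative: "(bump r x has_derivative (\<lambda>v. bump_grad r x y \<bullet> v)) (at y)"
proof -
  have inner: "((\<lambda>y. r\<^sup>2 - (y - x) \<bullet> (y - x)) has_derivative (\<lambda>v. - 2 * ((y - x) \<bullet> v))) (at y)"
    by (auto intro!: derivative_eq_intros simp: inner_commute)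
  have outer: "((\<lambda>s::real. max 0 s ^ Suc 1) has_derivative (*) (real (Suc 1) * max 0 s ^ 1)) (at s)" for s
    using has_real_derivative_pos_part_power[of 1 s] unfolding has_field_derivative_def by simp
  have "((\<lambda>y. max 0 (r\<^sup>2 - (y - x) \<bullet> (y - x)) ^ Suc 1) has_derivative
      (\<lambda>v. (real (Suc 1) * max 0 (r\<^sup>2 - (y - x) \<bullet> (y - x)) ^ 1) * (- 2 * ((y - x) \<bullet> v)))) (at y)"
    by (rule has_derivative_compose[OF inner outer])
  moreover have "bump r x = (\<lambda>y. max 0 (r\<^sup>2 - (y - x) \<bullet> (y - x)) ^ Suc 1)"
    by (simp add: fun_eq_iff bump_def power2_eq_square)
  ultimately show ?thesis
    by (simp only:) (erule has_derivative_eq_rhs, simp add: bump_grad_def mult.assoc)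
qed

lemma bump_continuous: "continuous_on T (bump r x)" "continuous_on T (bump_grad r x)"
  unfolding bump_def bump_grad_def by (intro continuous_intros)+

lemma bump_pos: "bump r x y > 0" if "y \<in> ball x r"
proof -
  have "norm (y - x) < r" using that by (simp add: dist_norm norm_minus_commute)
  then have "(norm (y - x))\<^sup>2 < r\<^sup>2" by (intro power_strict_mono) auto
  then show ?thesis by (simp add: bump_def power2_norm_eq_inner)
qed

lemma bump_outside: "bump r x y = 0" "bump_grad r x y = 0" if "y \<notin> cball x r" "r > 0"
proof -
  have "r < norm (y - x)" using that by (simp add: dist_norm norm_minus_commute)
  then have "r\<^sup>2 \<le> (norm (y - x))\<^sup>2" using that by (intro power_mono) auto
  then have "max 0 (r\<^sup>2 - (y - x) \<bullet> (y - x)) = 0" by (simp add: power2_norm_eq_inner)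
  then show "bump r x y = 0" "bump_grad r x y = 0" by (simp_all add: bump_def bump_grad_def)
qed

lemma bump_nonneg: "bump r x y \<ge> 0"
  by (simp add: bump_def)

section \<open>Green's identity for vanishing normal component\<close>

text \<open>A field with a classical divergence \<open>f\<close> in the interior. The derivative \<open>F'\<close> may blow up at the boundary,
  but \<open>F\<close> and \<open>f\<close> extend continuously to it.\<close>

locale divergence_field =
  fixes U :: "'a::euclidean_space set" and F :: "'a \<Rightarrow> 'a" and F' :: "'a \<Rightarrow> 'a \<Rightarrow> 'a" and f :: "'a \<Rightarrow> real"
  assumes domain: "bounded_C2_domain U"
    and F_cont: "continuous_on (closure U) F"
    and F_deriv: "\<And>x. x \<in> U \<Longrightarrow> (F has_derivative F' x) (at x)"
    and F'_bound: "\<And>C. compact C \<Longrightarrow> C \<subseteq> U \<Longrightarrow> \<exists>L. \<forall>x\<in>C. \<forall>v. norm (F' x v) \<le> L * norm v"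
    and f_cont: "continuous_on (closure U) f"
    and div_F: "\<And>x. x \<in> U \<Longrightarrow> f x = (\<Sum>b\<in>Basis. F' x b \<bullet> b)"
begin

text \<open>The last condition says that \<open>\<zeta> F\<close> has no normal component on the boundary.\<close>

definition test_function :: "('a \<Rightarrow> real) \<Rightarrow> ('a \<Rightarrow> 'a) \<Rightarrow> bool" where
  "test_function \<zeta> d\<zeta> \<longleftrightarrow> continuous_on (closure U) \<zeta> \<and> continuous_on (closure U) d\<zeta> \<and>
     (\<forall>x\<in>U. (\<zeta> has_derivative (\<lambda>v. d\<zeta> x \<bullet> v)) (at x)) \<and>
     (\<forall>x\<in>frontier U. \<zeta> x = 0 \<or> F x \<bullet> outward_normal U x = 0)"

text \<open>The integral of the divergence of \<open>\<zeta> F\<close>, which is linear in \<open>\<zeta>\<close> and hence can be computed by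
  localisation.\<close>

definition green_defect :: "('a \<Rightarrow> real) \<Rightarrow> ('a \<Rightarrow> 'a) \<Rightarrow> real" where
  "green_defect \<zeta> d\<zeta> = (LINT x:U|lborel. \<zeta> x * f x + F x \<bullet> d\<zeta> x)"

lemma open_U: "open U" and bounded_U: "bounded U"
  using domain by (auto simp: bounded_C2_domain_def)

lemma compact_closure_U: "compact (closure U)"
  using bounded_U by (simp add: compact_closure)

lemma sets_U: "U \<in> sets borel"
  using open_U by simp

lemma set_integrable_continuous:
  "continuous_on (closure U) (g :: 'a \<Rightarrow> 'b::euclidean_space) \<Longrightarrow> set_integrable lborel U g"
  by (rule set_integrable_continuous_closure[OF open_U bounded_U])

lemma green_interior:
  assumes \<zeta>: "test_function \<zeta> d\<zeta>"
    and S: "compact S" "S \<subseteq> U" "\<And>x. x \<notin> S \<Longrightarrow> \<zeta> x = 0 \<and> d\<zeta> x = 0"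
  shows "green_defect \<zeta> d\<zeta> = 0"
proof -
  have "continuous_on S d\<zeta>"
    using \<zeta> S(2) closure_subset unfolding test_function_def by (meson continuous_on_subset order_trans)
  then have "bounded (d\<zeta> ` S)" using S(1) by (intro compact_imp_bounded compact_continuous_image)
  then obtain C where C: "\<And>x. x \<in> S \<Longrightarrow> norm (d\<zeta> x) \<le> C" by (auto simp: bounded_iff)
  have "(LINT x:U|lborel. \<zeta> x * (\<Sum>b\<in>Basis. F' x b \<bullet> b) + F x \<bullet> d\<zeta> x) = 0"
    by (rule green_compact_support[OF open_U F_deriv F'_bound _ C S(1,2)])
       (use \<zeta> S(3) in \<open>auto simp: test_function_def\<close>)
  then show ?thesis
    unfolding green_defect_def
    by (subst set_lebesgue_integral_cong[where g = "\<lambda>x. \<zeta> x * (\<Sum>b\<in>Basis. F' x b \<bullet> b) + F x \<bullet> d\<zeta> x"])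
       (use sets_U in \<open>auto simp: div_F\<close>)
qed

text \<open>In a boundary chart, \<open>\<rho>\<close> is the depth below the boundary. The identity holds for \<open>\<zeta>\<close> times the cutoff
  \<open>\<eta> m = cutoff (2 m \<rho>)\<close>, and the error is the integral of \<open>\<eta>' m * \<omega>\<close> with \<open>\<omega> = \<zeta> F \<cdot> \<nabla>\<rho>\<close>. As \<open>\<nabla>\<rho>\<close> is normal on the
  boundary, \<open>\<omega>\<close> is continuous and vanishes there; \<open>\<eta>' m\<close> is of size \<open>m\<close> and lives on a strip of measure
  \<open>O(1 / m)\<close>, so the error tends to zero.\<close>

lemma green_boundary:
  assumes \<zeta>: "test_function \<zeta> d\<zeta>"
    and c: "C2_graph_at U x0 \<nu> h"
    and r: "\<And>y. y \<in> cball x0 r \<Longrightarrow> (y \<in> U \<longleftrightarrow> 0 < h y - y \<bullet> \<nu>) \<and> C2_graph_at U y \<nu> h"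
    and supp: "\<And>y. y \<notin> cball x0 r \<Longrightarrow> \<zeta> y = 0 \<and> d\<zeta> y = 0"
  shows "green_defect \<zeta> d\<zeta> = 0"
proof -
  define \<rho> where "\<rho> y = h y - y \<bullet> \<nu>" for y
  define d\<rho> where "d\<rho> y = grad UNIV h y - \<nu>" for y
  have \<rho>_deriv: "(\<rho> has_derivative (\<lambda>v. d\<rho> y \<bullet> v)) (at y)" for y
    unfolding \<rho>_def d\<rho>_def
    by (rule has_derivative_eq_rhs[OF has_derivative_diff[OF chart_derivative(1)[OF c] has_derivative_inner_left[OF has_derivative_ident]]])
       (simp add: fun_eq_iff inner_diff_left inner_commute[of \<nu>])
  have \<rho>_cont: "continuous_on T \<rho>" for T
    by (intro continuous_at_imp_continuous_on ballI has_derivative_continuous[OF \<rho>_deriv])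
  have d\<rho>_cont: "continuous_on T d\<rho>" for T
    unfolding d\<rho>_def by (intro continuous_intros continuous_on_subset[OF chart_derivative(2)[OF c]]) simp
  have \<nu>: "norm \<nu> = 1" using c by (simp add: C2_graph_at_def)
  have \<rho>_shift: "\<rho> (y + s *\<^sub>R \<nu>) = \<rho> y - s" for y s
  proof -
    have "h (y + s *\<^sub>R \<nu>) = h y" using c by (simp add: C2_graph_at_def)
    moreover have "\<nu> \<bullet> \<nu> = 1" using \<nu> by (simp add: norm_eq_1)
    ultimately show ?thesis by (simp add: \<rho>_def inner_add_left)
  qed
  have cutoff_cont: "continuous_on T cutoff" "continuous_on T cutoff'" for T
  proof -
    show "continuous_on T cutoff"
      by (intro continuous_at_imp_continuous_on ballI DERIV_isCont[OF cutoff_derivative])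
    show "continuous_on T cutoff'" unfolding cutoff'_def by (intro continuous_intros)
  qed
  have \<zeta>_cont: "continuous_on (closure U) \<zeta>" and d\<zeta>_cont: "continuous_on (closure U) d\<zeta>"
    and \<zeta>_deriv: "\<And>x. x \<in> U \<Longrightarrow> (\<zeta> has_derivative (\<lambda>v. d\<zeta> x \<bullet> v)) (at x)"
    and \<zeta>_bdry: "\<And>x. x \<in> frontier U \<Longrightarrow> \<zeta> x = 0 \<or> F x \<bullet> outward_normal U x = 0"
    using \<zeta> by (auto simp: test_function_def)
  define \<omega> where "\<omega> y = \<zeta> y * (F y \<bullet> d\<rho> y)" for y
  have \<omega>_cont: "continuous_on (closure U) \<omega>"
    unfolding \<omega>_def by (intro continuous_intros \<zeta>_cont F_cont d\<rho>_cont)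
  define H where "H y = \<zeta> y * f y + F y \<bullet> d\<zeta> y" for y
  have H_cont: "continuous_on (closure U) H"
    unfolding H_def by (intro continuous_intros \<zeta>_cont f_cont F_cont d\<zeta>_cont)
  define \<eta> where "\<eta> m y = cutoff (2 * real m * \<rho> y)" for m y
  define \<eta>' where "\<eta>' m y = 2 * real m * cutoff' (2 * real m * \<rho> y)" for m y
  have \<eta>_deriv: "(\<eta> m has_derivative (\<lambda>v. (\<eta>' m y *\<^sub>R d\<rho> y) \<bullet> v)) (at y)" for m y
  proof -
    have "((\<lambda>y. 2 * real m * \<rho> y) has_derivative (\<lambda>v. 2 * real m * (d\<rho> y \<bullet> v))) (at y)"
      by (intro derivative_intros \<rho>_deriv)
    from has_derivative_compose[OF this cutoff_derivative[unfolded has_field_derivative_def]]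
    show ?thesis unfolding \<eta>_def \<eta>'_def by (rule has_derivative_eq_rhs) (auto simp: fun_eq_iff)
  qed
  have \<eta>_cont: "continuous_on T (\<eta> m)" "continuous_on T (\<eta>' m)" for T m
    unfolding \<eta>_def \<eta>'_def
    by (intro continuous_intros continuous_on_compose2[OF cutoff_cont(1)[of UNIV]]
        continuous_on_compose2[OF cutoff_cont(2)[of UNIV]] \<rho>_cont; simp)+

  have identity: "(LINT y:U|lborel. \<eta> m y * H y) = - (LINT y:U|lborel. \<eta>' m y * \<omega> y)" if "m > 0" for m
  proof -
    define \<xi> where "\<xi> y = \<zeta> y * \<eta> m y" for y
    define d\<xi> where "d\<xi> y = \<eta> m y *\<^sub>R d\<zeta> y + (\<zeta> y * \<eta>' m y) *\<^sub>R d\<rho> y" for y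
    define S where "S = closure U \<inter> cball x0 r \<inter> {y. 1 / (2 * real m) \<le> \<rho> y}"
    have "closed {y. 1 / (2 * real m) \<le> \<rho> y}"
      by (intro closed_Collect_le \<rho>_cont) auto
    then have S: "compact S"
      unfolding S_def by (intro compact_Int_closed compact_closure_U closed_cball)
    have SU: "S \<subseteq> U"
    proof
      fix y assume y: "y \<in> S"
      then have "0 < \<rho> y" using \<open>m > 0\<close> by (auto simp: S_def intro: less_le_trans[rotated])
      then show "y \<in> U" using r y by (auto simp: S_def \<rho>_def)
    qed
    have null: "\<xi> y = 0 \<and> d\<xi> y = 0" if "y \<in> U - S" for y
    proof (cases "y \<in> cball x0 r")
      case True
      then have "\<rho> y < 1 / (2 * real m)" using that closure_subset by (fastforce simp: S_def)
      then have "2 * real m * \<rho> y \<le> 1" using \<open>m > 0\<close> by (simp add: field_simps)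
      then show ?thesis by (simp add: \<xi>_def d\<xi>_def \<eta>_def \<eta>'_def cutoff_below)
    qed (simp add: supp \<xi>_def d\<xi>_def)
    have d\<xi>_cont: "continuous_on (closure U) d\<xi>"
      unfolding d\<xi>_def by (intro continuous_intros \<eta>_cont d\<zeta>_cont \<zeta>_cont d\<rho>_cont)
    have "bounded (d\<xi> ` S)"
      using S continuous_on_subset[OF d\<xi>_cont, of S] by (intro compact_imp_bounded compact_continuous_image) (auto simp: S_def)
    then obtain C where C: "\<And>x. x \<in> S \<Longrightarrow> norm (d\<xi> x) \<le> C" by (auto simp: bounded_iff)
    have der: "(\<xi> has_derivative (\<lambda>v. d\<xi> y \<bullet> v)) (at y)" if "y \<in> U" for y
      unfolding \<xi>_def d\<xi>_def
      by (rule has_derivative_eq_rhs[OF has_derivative_mult[OF \<zeta>_deriv[OF that] \<eta>_deriv]])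
         (auto simp: fun_eq_iff inner_add_left algebra_simps)
    have "(LINT x:U|lborel. \<xi> x * (\<Sum>b\<in>Basis. F' x b \<bullet> b) + F x \<bullet> d\<xi> x) = 0"
      by (rule green_compact_support[OF open_U F_deriv F'_bound der C S SU null])
    moreover have "(LINT x:U|lborel. \<xi> x * (\<Sum>b\<in>Basis. F' x b \<bullet> b) + F x \<bullet> d\<xi> x)
        = (LINT y:U|lborel. \<eta> m y * H y + \<eta>' m y * \<omega> y)"
      by (rule set_lebesgue_integral_cong)
         (use sets_U in \<open>auto simp: div_F[symmetric] \<xi>_def d\<xi>_def H_def \<omega>_def inner_add_right algebra_simps\<close>)
    moreover have "\<dots> = (LINT y:U|lborel. \<eta> m y * H y) + (LINT y:U|lborel. \<eta>' m y * \<omega> y)"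
      by (intro set_integral_add set_integrable_continuous continuous_intros \<eta>_cont H_cont \<omega>_cont)
    ultimately show ?thesis by linarith
  qed

  have "(\<lambda>m. LINT y:U|lborel. \<eta> m y * H y) \<longlonglongrightarrow> (LINT y:U|lborel. H y)"
  proof -
    have "bounded (H ` closure U)"
      by (intro compact_imp_bounded compact_continuous_image H_cont compact_closure_U)
    then obtain B where B: "\<And>y. y \<in> closure U \<Longrightarrow> \<bar>H y\<bar> \<le> B" by (auto simp: bounded_iff)
    show ?thesis
    proof (rule bounded_convergence_on(1)[OF sets_U bounded_U])
      show "set_borel_measurable lborel U (\<lambda>y. \<eta> m y * H y)" for m
      proof -
        have "set_integrable lborel U (\<lambda>y. \<eta> m y * H y)"
          by (intro set_integrable_continuous continuous_intros \<eta>_cont H_cont)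
        then show ?thesis by (simp add: set_integrable_def set_borel_measurable_def borel_measurable_integrable)
      qed
      show "\<bar>\<eta> m y * H y\<bar> \<le> B" if "y \<in> U" for m y
      proof -
        have "\<bar>\<eta> m y\<bar> * \<bar>H y\<bar> \<le> 1 * B"
          using that closure_subset B cutoff_bounds by (intro mult_mono) (auto simp: \<eta>_def)
        then show ?thesis by (simp add: abs_mult)
      qed
      show "(\<lambda>m. \<eta> m y * H y) \<longlonglongrightarrow> H y" if y: "y \<in> U" for y
      proof (cases "y \<in> cball x0 r")
        case True
        then have "\<rho> y > 0" using r y by (simp add: \<rho>_def)
        have "\<eta> m y = 1" if "real m \<ge> 1 / \<rho> y" for m
          using that \<open>\<rho> y > 0\<close> by (simp add: \<eta>_def cutoff_above field_simps)
        then have "\<forall>\<^sub>F m in sequentially. \<eta> m y * H y = H y"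
          unfolding eventually_sequentially
          by (metis mult_1 nat_ceiling_le_eq)
        then show ?thesis by (rule tendsto_eventually)
      next
        case False
        then show ?thesis by (simp add: H_def supp)
      qed
    qed
  qed
  moreover have "(\<lambda>m. LINT y:U|lborel. \<eta>' m y * \<omega> y) \<longlonglongrightarrow> 0"
  proof (rule LIMSEQ_I)
    fix e :: real assume e: "e > 0"
    define B where "B = measure lborel (cball x0 (r + 1))"
    define \<delta> where "\<delta> = e / (4 * (B + 1))"
    have B: "B \<ge> 0" by (simp add: B_def)
    have \<delta>: "\<delta> > 0" using e B by (simp add: \<delta>_def)
    \<comment> \<open>Off the compact set \<open>Z\<close> the integrand is small, and on \<open>Z\<close> the depth has a positive minimum.\<close>
    define Z where "Z = {y \<in> closure U \<inter> cball x0 r. \<delta> \<le> \<bar>\<omega> y\<bar>}"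
    have "compact Z"
    proof -
      have "continuous_on (closure U \<inter> cball x0 r) (\<lambda>y. \<bar>\<omega> y\<bar>)"
        by (intro continuous_intros continuous_on_subset[OF \<omega>_cont]) auto
      then have "closed ((closure U \<inter> cball x0 r) \<inter> (\<lambda>y. \<bar>\<omega> y\<bar>) -` {\<delta>..})"
        by (rule continuous_closed_preimage) auto
      moreover have "Z = (closure U \<inter> cball x0 r) \<inter> (\<lambda>y. \<bar>\<omega> y\<bar>) -` {\<delta>..}"
        by (auto simp: Z_def)
      ultimately have "closed Z" by simp
      then show ?thesis
        using compact_Int_closed[OF compact_closure_U, of Z] by (simp add: Z_def Int_absorb1 subset_iff)
    qed
    have pos: "\<rho> y > 0" if "y \<in> Z" for y
    proof -
      have yr: "y \<in> cball x0 r" "y \<in> closure U" "\<omega> y \<noteq> 0" using that \<delta> by (auto simp: Z_def)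
      have "y \<in> U"
      proof (rule ccontr)
        assume "y \<notin> U"
        then have fr: "y \<in> frontier U" using yr open_U by (simp add: frontier_def interior_open)
        have cy: "C2_graph_at U y \<nu> h" using r yr by blast
        have "F y \<bullet> sgn (\<nu> - grad UNIV h y) = 0"
          using \<zeta>_bdry[OF fr] yr(3) outward_normal_chart[OF cy open_U fr] by (auto simp: \<omega>_def)
        then have "F y \<bullet> d\<rho> y = 0"
          using chart_normal_nonzero[OF cy, of y] by (auto simp: sgn_div_norm d\<rho>_def inner_diff_right)
        then show False using yr(3) by (simp add: \<omega>_def)
      qed
      then show ?thesis using r yr by (simp add: \<rho>_def)
    qed
    obtain \<mu> where \<mu>: "\<mu> > 0" "\<And>y. y \<in> Z \<Longrightarrow> \<mu> \<le> \<rho> y"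
    proof (cases "Z = {}")
      case False
      obtain z where "z \<in> Z" "\<And>y. y \<in> Z \<Longrightarrow> \<rho> z \<le> \<rho> y"
        using continuous_attains_inf[OF \<open>compact Z\<close> False \<rho>_cont] by blast
      with pos show thesis by (intro that[of "\<rho> z"]) auto
    qed (use that[of 1] in auto)
    have "norm ((LINT y:U|lborel. \<eta>' m y * \<omega> y) - 0) < e" if m: "m \<ge> Suc (nat \<lceil>1 / \<mu>\<rceil>)" for m
    proof -
      have "m > 0" using m by simp
      have "1 / \<mu> < real m" using m by linarith
      then have m\<mu>: "1 / real m < \<mu>" using \<mu> \<open>m > 0\<close> by (simp add: field_simps)
      define T where "T = cball x0 r \<inter> {y. 0 < \<rho> y \<and> \<rho> y < 1 / real m}"
      have T_meas: "T \<in> sets borel"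
        unfolding T_def
        by (intro sets.Int borel_closed closed_cball borel_open open_Collect_conj open_Collect_less \<rho>_cont) auto
      have T_fin: "emeasure lborel T < \<infinity>"
        by (rule emeasure_bounded_finite) (simp add: T_def bounded_Int)
      have ptw: "norm (indicator U y *\<^sub>R (\<eta>' m y * \<omega> y)) \<le> indicator T y *\<^sub>R (4 * real m * \<delta>)" for y
      proof (cases "y \<in> U \<and> \<eta>' m y * \<omega> y \<noteq> 0")
        case True
        then have y: "y \<in> U" "\<eta>' m y \<noteq> 0" "\<omega> y \<noteq> 0" by auto
        have yr: "y \<in> cball x0 r" using y(3) supp by (auto simp: \<omega>_def)
        have "2 * real m * \<rho> y < 2" using y(2) cutoff_above(2)[of "2 * real m * \<rho> y"] by (fastforce simp: \<eta>'_def)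
        then have \<rho>y: "\<rho> y < 1 / real m" using \<open>m > 0\<close> by (simp add: field_simps)
        have yT: "y \<in> T" using yr y(1) r \<rho>y by (auto simp: T_def \<rho>_def)
        have "y \<notin> Z" using \<mu>(2)[of y] \<rho>y m\<mu> by auto
        then have "\<bar>\<omega> y\<bar> \<le> \<delta>" using y(1) yr closure_subset by (force simp: Z_def)
        moreover have "\<bar>\<eta>' m y\<bar> \<le> 4 * real m"
          using cutoff'_bounds[of "2 * real m * \<rho> y"] mult_left_mono[OF cutoff'_bounds(2)[of "2 * real m * \<rho> y"], of "2 * real m"]
          by (simp add: \<eta>'_def abs_mult)
        ultimately have "\<bar>\<eta>' m y\<bar> * \<bar>\<omega> y\<bar> \<le> (4 * real m) * \<delta>" by (intro mult_mono) auto
        then show ?thesis using yT y(1) by (simp add: abs_mult)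
      qed (use \<delta> in \<open>auto simp: indicator_def\<close>)
      have int1: "integrable lborel (\<lambda>y. indicator U y *\<^sub>R (\<eta>' m y * \<omega> y))"
      proof -
        have "continuous_on (closure U) (\<lambda>y. \<eta>' m y * \<omega> y)"
          by (intro continuous_intros \<eta>_cont \<omega>_cont)
        from set_integrable_continuous[OF this] show ?thesis by (simp add: set_integrable_def)
      qed
      have int2: "integrable lborel (\<lambda>y. indicator T y *\<^sub>R (4 * real m * \<delta>))"
        using T_meas T_fin by (intro integrableI_bounded_set[where A = T and B = "4 * real m * \<delta>"]) (auto simp: \<delta> less_imp_le)
      have "norm (LINT y:U|lborel. \<eta>' m y * \<omega> y) \<le> (LINT y|lborel. indicator T y *\<^sub>R (4 * real m * \<delta>))"
        unfolding set_lebesgue_integral_def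
        by (rule Bochner_Integration.integral_norm_bound_integral[OF int1 int2 ptw])
      also have "\<dots> = 4 * \<delta> * (real m * measure lborel T)"
        by (simp add: mult.commute)
      also have "\<dots> \<le> 4 * \<delta> * B"
        using measure_strip[OF \<nu> \<rho>_cont \<rho>_shift \<open>m > 0\<close>, of x0 r] \<delta>
        by (intro mult_left_mono) (auto simp: T_def B_def)
      also have "\<dots> < e" using e B by (simp add: \<delta>_def field_simps)
      finally show ?thesis by simp
    qed
    then show "\<exists>no. \<forall>m\<ge>no. norm ((LINT y:U|lborel. \<eta>' m y * \<omega> y) - 0) < e" by blast
  qed
  then have "(\<lambda>m. - (LINT y:U|lborel. \<eta>' m y * \<omega> y)) \<longlonglongrightarrow> - 0" by (rule tendsto_minus)
  then have "(\<lambda>m. LINT y:U|lborel. \<eta> m y * H y) \<longlonglongrightarrow> - 0"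
    by (rule Lim_transform_eventually)
       (use identity in \<open>auto simp: eventually_sequentially intro!: exI[of _ 1]\<close>)
  ultimately show ?thesis
    unfolding green_defect_def H_def[symmetric] using LIMSEQ_unique by fastforce
qed

lemma green_local:
  assumes "x \<in> closure U"
  shows "\<exists>r>0. \<forall>\<zeta> d\<zeta>. test_function \<zeta> d\<zeta> \<longrightarrow> (\<forall>y. y \<notin> cball x r \<longrightarrow> \<zeta> y = 0 \<and> d\<zeta> y = 0)
    \<longrightarrow> green_defect \<zeta> d\<zeta> = 0"
proof (cases "x \<in> U")
  case True
  then obtain r where r: "r > 0" "cball x r \<subseteq> U" using open_U open_contains_cball by blast
  show ?thesis
  proof (intro exI[of _ r] conjI allI impI r(1))
    fix \<zeta> d\<zeta> assume "test_function \<zeta> d\<zeta>" "\<forall>y. y \<notin> cball x r \<longrightarrow> \<zeta> y = 0 \<and> d\<zeta> y = 0"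
    then show "green_defect \<zeta> d\<zeta> = 0"
      by (intro green_interior[where S = "cball x r"] r(2)) auto
  qed
next
  case False
  then have "x \<in> frontier U" using assms open_U by (simp add: frontier_def interior_open)
  then obtain \<nu> h where c: "C2_graph_at U x \<nu> h"
    using domain unfolding bounded_C2_domain_def by blast
  obtain r where r: "r > 0" "\<And>y. y \<in> ball x r \<Longrightarrow> (y \<in> U \<longleftrightarrow> 0 < h y - y \<bullet> \<nu>) \<and> C2_graph_at U y \<nu> h"
    using chart_nbhd[OF c] by metis
  show ?thesis
  proof (intro exI[of _ "r / 2"] conjI allI impI)
    show "r / 2 > 0" using r by simp
    fix \<zeta> d\<zeta> assume t: "test_function \<zeta> d\<zeta>" "\<forall>y. y \<notin> cball x (r / 2) \<longrightarrow> \<zeta> y = 0 \<and> d\<zeta> y = 0"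
    have "y \<in> ball x r" if "y \<in> cball x (r / 2)" for y using that r(1) by simp
    then show "green_defect \<zeta> d\<zeta> = 0"
      using t(2) r(2) by (intro green_boundary[OF t(1) c, of "r / 2"]) blast+
  qed
qed

text \<open>Divide \<open>\<eta>\<close> by the sum \<open>S\<close> of the bump functions of a finite cover; then the products \<open>\<zeta> x\<close> of this quotient
  with the bump functions add up to \<open>\<eta>\<close>, and the local identity applies to each of them.\<close>

lemma green_identity:
  assumes \<eta>: "test_function \<eta> d\<eta>"
  shows "(LINT x:U|lborel. \<eta> x * f x) = - (LINT x:U|lborel. F x \<bullet> d\<eta> x)"
proof -
  obtain R where R: "\<And>x. x \<in> closure U \<Longrightarrow> R x > 0"
    "\<And>x \<zeta> d\<zeta>. x \<in> closure U \<Longrightarrow> test_function \<zeta> d\<zeta> \<Longrightarrow> (\<And>y. y \<notin> cball x (R x) \<Longrightarrow> \<zeta> y = 0 \<and> d\<zeta> y = 0)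
       \<Longrightarrow> green_defect \<zeta> d\<zeta> = 0"
    using green_local by metis
  obtain D where D: "D \<subseteq> closure U" "finite D" "closure U \<subseteq> (\<Union>x\<in>D. ball x (R x))"
    using compactE_image[OF compact_closure_U, of "closure U" "\<lambda>x. ball x (R x)"] R(1)
    by (metis (no_types, lifting) UN_I centre_in_ball open_ball subsetI)
  define S where "S y = (\<Sum>x\<in>D. bump (R x) x y)" for y
  define dS where "dS y = (\<Sum>x\<in>D. bump_grad (R x) x y)" for y
  have S_pos: "S y > 0" if y: "y \<in> closure U" for y
  proof -
    obtain x where "x \<in> D" "y \<in> ball x (R x)" using D(3) y by blast
    then show ?thesis unfolding S_def
      by (intro sum_pos2[OF D(2) \<open>x \<in> D\<close>] bump_pos bump_nonneg)
  qed
  have S_cont: "continuous_on T S" "continuous_on T dS" for T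
    unfolding S_def dS_def by (intro continuous_on_sum bump_continuous)+
  have S_deriv: "(S has_derivative (\<lambda>v. dS y \<bullet> v)) (at y)" for y
    unfolding S_def dS_def inner_sum_left by (intro has_derivative_sum bump_derivative)
  have \<eta>_cont: "continuous_on (closure U) \<eta>" "continuous_on (closure U) d\<eta>"
    and \<eta>_deriv: "\<And>x. x \<in> U \<Longrightarrow> (\<eta> has_derivative (\<lambda>v. d\<eta> x \<bullet> v)) (at x)"
    and \<eta>_bdry: "\<And>x. x \<in> frontier U \<Longrightarrow> \<eta> x = 0 \<or> F x \<bullet> outward_normal U x = 0"
    using \<eta> by (auto simp: test_function_def)
  have S_ne: "S y \<noteq> 0" if "y \<in> closure U" for y using S_pos[OF that] by simp
  define \<theta> where "\<theta> y = \<eta> y / S y" for y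
  define d\<theta> where "d\<theta> y = (1 / (S y * S y)) *\<^sub>R (S y *\<^sub>R d\<eta> y - \<eta> y *\<^sub>R dS y)" for y
  have \<theta>_cont: "continuous_on (closure U) \<theta>" "continuous_on (closure U) d\<theta>"
    unfolding \<theta>_def d\<theta>_def by (intro continuous_intros \<eta>_cont S_cont; simp add: S_ne)+
  have \<theta>_deriv: "(\<theta> has_derivative (\<lambda>v. d\<theta> y \<bullet> v)) (at y)" if "y \<in> U" for y
    unfolding \<theta>_def d\<theta>_def
    by (rule has_derivative_eq_rhs[OF has_derivative_divide'[OF \<eta>_deriv[OF that] S_deriv]])
       (use S_ne[of y] that closure_subset[of U] in \<open>auto simp: fun_eq_iff inner_diff_left field_simps\<close>)
  define \<zeta> where "\<zeta> x y = bump (R x) x y * \<theta> y" for x y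
  define d\<zeta> where "d\<zeta> x y = bump (R x) x y *\<^sub>R d\<theta> y + \<theta> y *\<^sub>R bump_grad (R x) x y" for x y
  have \<zeta>_cont: "continuous_on (closure U) (\<zeta> x)" "continuous_on (closure U) (d\<zeta> x)" for x
    unfolding \<zeta>_def d\<zeta>_def by (intro continuous_intros \<theta>_cont bump_continuous)+
  have test: "test_function (\<zeta> x) (d\<zeta> x)" for x
    unfolding test_function_def
  proof (intro conjI ballI \<zeta>_cont)
    fix y assume "y \<in> U"
    show "(\<zeta> x has_derivative (\<lambda>v. d\<zeta> x y \<bullet> v)) (at y)"
      unfolding \<zeta>_def d\<zeta>_def
      by (rule has_derivative_eq_rhs[OF has_derivative_mult[OF bump_derivative \<theta>_deriv[OF \<open>y \<in> U\<close>]]])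
         (auto simp: fun_eq_iff inner_add_left algebra_simps)
  next
    fix y assume "y \<in> frontier U"
    then show "\<zeta> x y = 0 \<or> F y \<bullet> outward_normal U y = 0" using \<eta>_bdry by (auto simp: \<zeta>_def \<theta>_def)
  qed
  have zero: "green_defect (\<zeta> x) (d\<zeta> x) = 0" if "x \<in> D" for x
    using that D(1) R by (intro R(2)[OF _ test]) (auto simp: \<zeta>_def d\<zeta>_def bump_outside)
  have int: "integrable lborel (\<lambda>y. indicator U y *\<^sub>R (\<zeta> x y * f y + F y \<bullet> d\<zeta> x y))" for x
    unfolding set_integrable_def[symmetric]
    by (intro set_integrable_continuous continuous_intros \<zeta>_cont f_cont F_cont)
  have sum: "(\<Sum>x\<in>D. \<zeta> x y * f y + F y \<bullet> d\<zeta> x y) = \<eta> y * f y + F y \<bullet> d\<eta> y" if "y \<in> U" for y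
  proof -
    have S: "S y \<noteq> 0" using that closure_subset S_ne by blast
    have "(\<Sum>x\<in>D. \<zeta> x y) = S y * \<theta> y"
      by (simp add: \<zeta>_def S_def sum_distrib_right)
    then have 1: "(\<Sum>x\<in>D. \<zeta> x y) = \<eta> y"
      using S by (simp add: \<theta>_def)
    have "(\<Sum>x\<in>D. d\<zeta> x y) = S y *\<^sub>R d\<theta> y + \<theta> y *\<^sub>R dS y"
      by (simp add: d\<zeta>_def S_def dS_def sum.distrib scaleR_sum_left scaleR_sum_right)
    also have "\<dots> = d\<eta> y"
      using S by (simp add: d\<theta>_def \<theta>_def algebra_simps)
    finally have 2: "(\<Sum>x\<in>D. d\<zeta> x y) = d\<eta> y" .
    show ?thesis unfolding sum.distrib using 1 2 by (metis inner_sum_right sum_distrib_right)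
  qed
  have "(LINT y:U|lborel. \<eta> y * f y + F y \<bullet> d\<eta> y) = (LINT y:U|lborel. (\<Sum>x\<in>D. \<zeta> x y * f y + F y \<bullet> d\<zeta> x y))"
    by (rule set_lebesgue_integral_cong) (use sets_U sum in auto)
  also have "\<dots> = (\<Sum>x\<in>D. green_defect (\<zeta> x) (d\<zeta> x))"
    unfolding set_lebesgue_integral_def green_defect_def scaleR_sum_right
    by (rule Bochner_Integration.integral_sum) (rule int)
  also have "\<dots> = 0" by (simp add: zero)
  finally have "(LINT y:U|lborel. \<eta> y * f y + F y \<bullet> d\<eta> y) = 0" .
  moreover have "(LINT y:U|lborel. \<eta> y * f y + F y \<bullet> d\<eta> y) = (LINT y:U|lborel. \<eta> y * f y) + (LINT y:U|lborel. F y \<bullet> d\<eta> y)"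
    by (intro set_integral_add set_integrable_continuous continuous_intros \<eta>_cont f_cont F_cont)
  ultimately show ?thesis by linarith
qed

end

section \<open>Functions of space and time\<close>

text \<open>Differentiation under the integral sign, by bounded convergence of the difference quotients.\<close>

lemma has_real_derivative_set_integral:
  fixes f :: "'a::euclidean_space \<Rightarrow> real \<Rightarrow> real"
  assumes U: "U \<in> sets borel" "bounded U" and \<delta>: "\<delta> > 0"
    and der: "\<And>x s. x \<in> U \<Longrightarrow> \<bar>s - t\<bar> < \<delta> \<Longrightarrow> (f x has_real_derivative f' x s) (at s)"
    and bound: "\<And>x s. x \<in> U \<Longrightarrow> \<bar>s - t\<bar> < \<delta> \<Longrightarrow> \<bar>f' x s\<bar> \<le> B"
    and int: "\<And>s. \<bar>s - t\<bar> < \<delta> \<Longrightarrow> set_integrable lborel U (\<lambda>x. f x s)"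
  shows "((\<lambda>s. LINT x:U|lborel. f x s) has_real_derivative (LINT x:U|lborel. f' x t)) (at t)"
  unfolding DERIV_def tendsto_at_iff_sequentially
proof (intro allI impI)
  fix X :: "nat \<Rightarrow> real" assume X: "\<forall>i. X i \<in> UNIV - {0}" "X \<longlonglongrightarrow> 0"
  define q where "q n x = (if \<bar>X n\<bar> < \<delta> then (f x (t + X n) - f x t) / X n else 0)" for n x
  have X0: "X n \<noteq> 0" for n using X(1) by auto
  have small: "\<forall>\<^sub>F n in sequentially. \<bar>X n\<bar> < \<delta>"
    using X(2) \<delta> by (auto simp: tendsto_iff dist_real_def)
  have q_int: "(LINT x:U|lborel. q n x) = ((LINT x:U|lborel. f x (t + X n)) - (LINT x:U|lborel. f x t)) / X n"
    "set_integrable lborel U (q n)" if "\<bar>X n\<bar> < \<delta>" for n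
  proof -
    have i: "set_integrable lborel U (\<lambda>x. f x (t + X n))" "set_integrable lborel U (\<lambda>x. f x t)"
      using int[of "t + X n"] int[of t] that \<delta> by auto
    show "set_integrable lborel U (q n)"
      unfolding q_def using that by (auto intro!: set_integrable_divide set_integral_diff i)
    show "(LINT x:U|lborel. q n x) = ((LINT x:U|lborel. f x (t + X n)) - (LINT x:U|lborel. f x t)) / X n"
      unfolding q_def using that set_integral_diff(2)[OF i] by (simp add: set_integral_divide_zero)
  qed
  have "(\<lambda>n. LINT x:U|lborel. q n x) \<longlonglongrightarrow> (LINT x:U|lborel. f' x t)"
  proof (rule bounded_convergence_on(1)[OF U])
    show "set_borel_measurable lborel U (q n)" for n
    proof (cases "\<bar>X n\<bar> < \<delta>")
      case True
      then show ?thesis using q_int(2)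
        by (simp add: set_integrable_def set_borel_measurable_def borel_measurable_integrable)
    qed (simp add: q_def set_borel_measurable_def)
    show "\<bar>q n x\<bar> \<le> \<bar>B\<bar>" if x: "x \<in> U" for n x
    proof (cases "\<bar>X n\<bar> < \<delta>")
      case True
      have "norm (f x (t + X n) - f x t) \<le> \<bar>B\<bar> * norm (t + X n - t)"
      proof (rule field_differentiable_bound[of "{t - \<bar>X n\<bar>..t + \<bar>X n\<bar>}"])
        fix s assume s: "s \<in> {t - \<bar>X n\<bar>..t + \<bar>X n\<bar>}"
        then have s': "\<bar>s - t\<bar> < \<delta>" using True by auto
        show "(f x has_real_derivative f' x s) (at s within {t - \<bar>X n\<bar>..t + \<bar>X n\<bar>})"
          by (rule DERIV_subset[OF der[OF x s']]) simp
        show "norm (f' x s) \<le> \<bar>B\<bar>" using bound[OF x s'] by simp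
      qed auto
      then show ?thesis using True X0[of n] by (simp add: q_def field_simps abs_divide)
    qed (simp add: q_def)
    show "(\<lambda>n. q n x) \<longlonglongrightarrow> f' x t" if x: "x \<in> U" for x
    proof -
      have "((\<lambda>h. (f x (t + h) - f x t) / h) \<longlongrightarrow> f' x t) (at 0)"
        using der[OF x, of t] \<delta> by (simp add: DERIV_def)
      then have "(\<lambda>n. (f x (t + X n) - f x t) / X n) \<longlonglongrightarrow> f' x t"
        using X by (auto simp: tendsto_at_iff_sequentially comp_def)
      then show ?thesis
        by (rule Lim_transform_eventually) (use small in \<open>auto simp: q_def elim: eventually_mono\<close>)
    qed
  qed
  then show "((\<lambda>h. ((LINT x:U|lborel. f x (t + h)) - (LINT x:U|lborel. f x t)) / h) \<circ> X)
      \<longlonglongrightarrow> (LINT x:U|lborel. f' x t)"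
    unfolding comp_def
    by (rule Lim_transform_eventually) (use small q_int(1) in \<open>auto elim: eventually_mono\<close>)
qed

lemma power_mult_le_sum_powers:
  fixes a b :: real
  assumes "a \<ge> 0" "b \<ge> 0"
  shows "a ^ i * b ^ j \<le> a ^ (i + j) + b ^ (i + j)"
proof (cases "a \<le> b")
  case True
  then have "a ^ i * b ^ j \<le> b ^ i * b ^ j" using assms by (intro mult_right_mono power_mono) auto
  then show ?thesis using assms by (simp add: power_add add_increasing)
next
  case False
  then have "a ^ i * b ^ j \<le> a ^ i * a ^ j" using assms by (intro mult_left_mono power_mono) auto
  then show ?thesis using assms by (simp add: power_add add_increasing2)
qed

text \<open>Young's inequality applied to \<open>w\<close> and \<open>X / \<mu>\<close>. The factor \<open>\<mu> ^ j\<close> keeps the degree of homogeneity of the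
  data, which are only known to be integrable in time in exactly this degree.\<close>

lemma integral_power_mult_le:
  fixes w X :: "'a::euclidean_space \<Rightarrow> real"
  assumes U: "open U" "bounded U"
    and cont: "continuous_on (closure U) w" "continuous_on (closure U) X"
    and pos: "\<And>x. x \<in> U \<Longrightarrow> w x \<ge> 0" "\<And>x. x \<in> U \<Longrightarrow> X x \<ge> 0"
    and \<mu>: "\<mu> > 0" "(LINT x:U|lborel. X x ^ (i + j)) \<le> \<mu> ^ (i + j)"
  shows "(LINT x:U|lborel. w x ^ i * X x ^ j) \<le> \<mu> ^ j * (1 + (LINT x:U|lborel. w x ^ (i + j)))"
proof -
  have int: "set_integrable lborel U (\<lambda>x. w x ^ i * X x ^ j)"
    "set_integrable lborel U (\<lambda>x. w x ^ (i + j))"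
    "set_integrable lborel U (\<lambda>x. X x ^ (i + j))"
    by (intro set_integrable_continuous_closure[OF U] continuous_intros cont)+
  have "(LINT x:U|lborel. w x ^ i * X x ^ j)
      \<le> (LINT x:U|lborel. \<mu> ^ j * (w x ^ (i + j) + X x ^ (i + j) / \<mu> ^ (i + j)))"
  proof (rule set_integral_mono[OF int(1)])
    show "set_integrable lborel U (\<lambda>x. \<mu> ^ j * (w x ^ (i + j) + X x ^ (i + j) / \<mu> ^ (i + j)))"
      by (intro set_integrable_mult_right set_integral_add set_integrable_divide int)
    fix x assume x: "x \<in> U"
    have "w x ^ i * X x ^ j = \<mu> ^ j * (w x ^ i * (X x / \<mu>) ^ j)"
      using \<mu>(1) by (simp add: power_divide)
    also have "\<dots> \<le> \<mu> ^ j * (w x ^ (i + j) + (X x / \<mu>) ^ (i + j))"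
      using \<mu>(1) pos[OF x] by (intro mult_left_mono power_mult_le_sum_powers) auto
    finally show "w x ^ i * X x ^ j \<le> \<mu> ^ j * (w x ^ (i + j) + X x ^ (i + j) / \<mu> ^ (i + j))"
      by (simp add: power_divide)
  qed
  also have "\<dots> = \<mu> ^ j * ((LINT x:U|lborel. w x ^ (i + j)) + (LINT x:U|lborel. X x ^ (i + j)) / \<mu> ^ (i + j))"
    using int by (simp add: set_integral_add set_integral_divide_zero)
  also have "\<dots> \<le> \<mu> ^ j * ((LINT x:U|lborel. w x ^ (i + j)) + 1)"
    using \<mu> by (intro mult_left_mono add_left_mono) (auto simp: divide_le_eq)
  finally show ?thesis by (simp add: add.commute)
qed

lemma gronwall_one_plus:
  fixes E E' g :: "real \<Rightarrow> real"
  assumes "a \<le> b"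
    and der: "\<And>t. t \<in> {a..b} \<Longrightarrow> (E has_real_derivative E' t) (at t)"
    and nonneg: "\<And>t. t \<in> {a..b} \<Longrightarrow> E t \<ge> 0"
    and le: "\<And>t. t \<in> {a..b} \<Longrightarrow> E' t \<le> (1 + E t) * g t"
    and g: "g integrable_on {a..b}" "integral {a..b} g \<le> C"
  shows "1 + E b \<le> (1 + E a) * exp C"
proof -
  have "((\<lambda>t. E' t / (1 + E t)) has_integral (ln (1 + E b) - ln (1 + E a))) {a..b}"
  proof (rule fundamental_theorem_of_calculus[OF assms(1)])
    fix t assume t: "t \<in> {a..b}"
    have "((\<lambda>t. ln (1 + E t)) has_real_derivative E' t / (1 + E t)) (at t)"
      using nonneg[OF t] by (auto intro!: derivative_eq_intros der[OF t])
    then show "((\<lambda>t. ln (1 + E t)) has_vector_derivative E' t / (1 + E t)) (at t within {a..b})"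
      using has_real_derivative_iff_has_vector_derivative has_vector_derivative_at_within by blast
  qed
  then have "ln (1 + E b) - ln (1 + E a) \<le> integral {a..b} g"
    using g(1)
    by (rule has_integral_le[OF _ integrable_integral])
       (use le nonneg in \<open>simp add: pos_divide_le_eq add_pos_nonneg mult.commute\<close>)
  then have "ln (1 + E b) \<le> ln (1 + E a) + C" using g(2) by simp
  then have "exp (ln (1 + E b)) \<le> exp (ln (1 + E a) + C)" by simp
  then show ?thesis using nonneg[of a] nonneg[of b] assms(1) by (simp add: exp_add)
qed

lemma uniform_continuity_in_time:
  fixes g :: "'a::euclidean_space \<times> real \<Rightarrow> 'b::metric_space"
  assumes "bounded U" "continuous_on (closure U \<times> {0<..}) g" "\<delta> > 0"
  obtains h where "h > 0"
    "\<And>x t s. x \<in> closure U \<Longrightarrow> 1 \<le> t \<Longrightarrow> t \<le> T \<Longrightarrow> t \<le> s \<Longrightarrow> s \<le> t + h \<Longrightarrow> dist (g (x, s)) (g (x, t)) < \<delta>"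
proof -
  let ?Z = "closure U \<times> {1..T + 1}"
  have "compact ?Z" using assms(1) by (intro compact_Times) (auto simp: compact_closure)
  moreover have "continuous_on ?Z g" by (rule continuous_on_subset[OF assms(2)]) auto
  ultimately have "uniformly_continuous_on ?Z g" by (rule compact_uniformly_continuous[rotated])
  then obtain d where d: "d > 0" "\<And>y z. y \<in> ?Z \<Longrightarrow> z \<in> ?Z \<Longrightarrow> dist z y < d \<Longrightarrow> dist (g z) (g y) < \<delta>"
    using assms(3) unfolding uniformly_continuous_on_def by metis
  show thesis
  proof (rule that[of "min 1 (d / 2)"])
    show "min 1 (d / 2) > 0" using d(1) by simp
    fix x t s assume "x \<in> closure U" "1 \<le> t" "t \<le> T" "t \<le> s" "s \<le> t + min 1 (d / 2)"
    then show "dist (g (x, s)) (g (x, t)) < \<delta>"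
      using d(1) by (intro d(2)) (auto simp: dist_Pair_Pair dist_real_def)
  qed
qed

lemma bounded_in_time_interval:
  fixes g :: "'a::euclidean_space \<times> real \<Rightarrow> 'b::real_normed_vector"
  assumes "bounded U" "continuous_on (closure U \<times> {0<..}) g" "a > 0"
  obtains B where "B \<ge> 0" "\<And>x t. x \<in> closure U \<Longrightarrow> a \<le> t \<Longrightarrow> t \<le> b \<Longrightarrow> norm (g (x, t)) \<le> B"
proof -
  let ?Z = "closure U \<times> {a..b}"
  have "compact ?Z" using assms(1) by (intro compact_Times) (auto simp: compact_closure)
  moreover have "continuous_on ?Z g" by (rule continuous_on_subset[OF assms(2)]) (use assms(3) in auto)
  ultimately have "bounded (g ` ?Z)" by (intro compact_imp_bounded compact_continuous_image)
  then obtain B where "\<And>z. z \<in> ?Z \<Longrightarrow> norm (g z) \<le> B" by (auto simp: bounded_iff)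
  then have "norm (g (x, t)) \<le> max 0 B" if "x \<in> closure U" "a \<le> t" "t \<le> b" for x t
    using that by (auto simp: le_max_iff_disj)
  then show thesis by (intro that[of "max 0 B"]) auto
qed

lemma continuous_at_fixed_time:
  assumes "continuous_on (closure U \<times> {0<..}) g" "t > (0::real)"
  shows "continuous_on (closure U) (\<lambda>x. g (x, t))"
  by (rule continuous_on_compose2[OF assms(1)]) (use assms(2) in \<open>auto intro: continuous_intros\<close>)

lemma continuous_on_integral_power:
  fixes g :: "'a::euclidean_space \<times> real \<Rightarrow> 'b::real_normed_vector"
  assumes U: "open U" "bounded U" and g: "continuous_on (closure U \<times> {0<..}) g"
  shows "continuous_on {0<..} (\<lambda>t. LINT x:U|lborel. norm (g (x, t)) ^ N)"
  unfolding continuous_on_sequentially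
proof (intro allI ballI impI)
  fix X :: "nat \<Rightarrow> real" and t assume t: "t \<in> {0<..}" and X: "(\<forall>n. X n \<in> {0<..}) \<and> X \<longlonglongrightarrow> t"
  have "compact (insert t (range X))" using X by (intro compact_sequence_with_limit) auto
  then have "compact (closure U \<times> insert t (range X))" using U by (intro compact_Times) (auto simp: compact_closure)
  moreover have "continuous_on (closure U \<times> insert t (range X)) g"
    by (rule continuous_on_subset[OF g]) (use X t in auto)
  ultimately have "bounded (g ` (closure U \<times> insert t (range X)))"
    by (intro compact_imp_bounded compact_continuous_image)
  then obtain B where B: "\<And>x n. x \<in> closure U \<Longrightarrow> norm (g (x, X n)) \<le> B"
    by (auto simp: bounded_iff)
  show "((\<lambda>t. LINT x:U|lborel. norm (g (x, t)) ^ N) \<circ> X) \<longlonglongrightarrow> (LINT x:U|lborel. norm (g (x, t)) ^ N)"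
    unfolding comp_def
  proof (rule bounded_convergence_on(1)[OF _ U(2)])
    show "U \<in> sets borel" using U by simp
    show "set_borel_measurable lborel U (\<lambda>x. norm (g (x, X n)) ^ N)" for n
    proof -
      have "continuous_on (closure U) (\<lambda>x. norm (g (x, X n)) ^ N)"
        using X by (intro continuous_intros continuous_at_fixed_time[OF g]) auto
      from set_integrable_continuous_closure[OF U this] show ?thesis
        by (simp add: set_integrable_def set_borel_measurable_def borel_measurable_integrable)
    qed
    show "\<bar>norm (g (x, X n)) ^ N\<bar> \<le> B ^ N" if "x \<in> U" for n x
      using B[of x n] that closure_subset[of U] by (auto intro!: power_mono)
    show "(\<lambda>n. norm (g (x, X n)) ^ N) \<longlonglongrightarrow> norm (g (x, t)) ^ N" if "x \<in> U" for x
    proof -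
      have "continuous_on {0<..} (\<lambda>t. g (x, t))"
        by (rule continuous_on_compose2[OF g]) (use that closure_subset in \<open>auto intro: continuous_intros\<close>)
      then have "(\<lambda>n. g (x, X n)) \<longlonglongrightarrow> g (x, t)"
        using X t by (auto simp: continuous_on_sequentially comp_def)
      then show ?thesis by (intro tendsto_intros)
    qed
  qed
qed

lemma sum_powers_le_power_sum:
  fixes a b :: real
  assumes "a \<ge> 0" "b \<ge> 0" "n \<ge> 1"
  shows "a ^ n + b ^ n \<le> (a + b) ^ n"
  using assms(3)
proof (induction n rule: nat_induct_at_least)
  case (Suc n)
  have "a ^ Suc n + b ^ Suc n \<le> (a + b) * (a ^ n + b ^ n)"
    using assms(1,2) by (simp add: algebra_simps)
  also have "\<dots> \<le> (a + b) * (a + b) ^ n"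
    using Suc.IH assms(1,2) by (intro mult_left_mono) auto
  finally show ?case by simp
qed simp

lemma L_norm_eq:
  assumes "N \<ge> 1"
  shows "L_norm (real N) U f = (LINT x:U|lborel. norm (f x) ^ N) powr (1 / real N)"
proof -
  have "norm (f x) powr real N = norm (f x) ^ N" for x
    using assms by (cases "f x = 0") (auto simp: powr_realpow)
  then show ?thesis by (simp add: L_norm_def)
qed

lemma L_norm_power:
  assumes "N \<ge> 1"
  shows "L_norm (real N) U f ^ N = (LINT x:U|lborel. norm (f x) ^ N)"
proof -
  note L = L_norm_eq[OF assms, of U f]
  have I: "(LINT x:U|lborel. norm (f x) ^ N) \<ge> 0"
    unfolding set_lebesgue_integral_def by (intro Bochner_Integration.integral_nonneg) simp
  show ?thesis
  proof (cases "(LINT x:U|lborel. norm (f x) ^ N) = 0")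
    case True
    then show ?thesis using assms by (simp add: L)
  next
    case False
    then have "((LINT x:U|lborel. norm (f x) ^ N) powr (1 / real N)) ^ N = (LINT x:U|lborel. norm (f x) ^ N)"
      using I assms by (subst powr_realpow[symmetric]) (auto simp: powr_powr)
    then show ?thesis by (simp add: L)
  qed
qed

lemma L_norm_nonneg: "L_norm \<beta> U f \<ge> 0"
  by (simp add: L_norm_def)

lemma L_norm_continuous_in_time:
  fixes g :: "'a::euclidean_space \<times> real \<Rightarrow> 'b::real_normed_vector"
  assumes U: "open U" "bounded U" and g: "continuous_on (closure U \<times> {0<..}) g" and N: "N \<ge> 1"
  shows "continuous_on {0<..} (\<lambda>t. L_norm (real N) U (\<lambda>x. g (x, t)))"
proof -
  have "(LINT x:U|lborel. norm (g (x, t)) ^ N) \<ge> 0" for t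
    unfolding set_lebesgue_integral_def by (intro Bochner_Integration.integral_nonneg) simp
  then show ?thesis
    unfolding L_norm_eq[OF N] using N
    by (intro continuous_on_powr' continuous_on_integral_power U g continuous_on_const) auto
qed

text \<open>The pointwise bound by \<open>norm g + \<delta>\<close> raises the \<open>N\<close>-th moment by at most \<open>e ^ N\<close> if \<open>\<delta>\<close> is small,
  uniformly in \<open>t\<close>, since \<open>g\<close> is bounded and \<open>r \<mapsto> r ^ N\<close> is uniformly continuous on bounded sets.\<close>

lemma L_norm_perturbation:
  fixes g :: "'a::euclidean_space \<times> real \<Rightarrow> 'b::euclidean_space"
  assumes U: "open U" "bounded U" and g: "continuous_on (closure U \<times> {0<..}) g"
    and N: "N \<ge> 1" and e: "e > 0"
  obtains \<delta> where "\<delta> > 0"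
    "\<And>t X. 1 \<le> t \<Longrightarrow> t \<le> T \<Longrightarrow> continuous_on (closure U) X \<Longrightarrow>
      (\<And>x. x \<in> U \<Longrightarrow> 0 \<le> X x \<and> X x \<le> norm (g (x, t)) + \<delta>) \<Longrightarrow>
      (LINT x:U|lborel. X x ^ N) \<le> (L_norm (real N) U (\<lambda>x. g (x, t)) + e) ^ N"
proof -
  obtain B where B: "B \<ge> 0" "\<And>x t. x \<in> closure U \<Longrightarrow> 1 \<le> t \<Longrightarrow> t \<le> T \<Longrightarrow> norm (g (x, t)) \<le> B"
    by (rule bounded_in_time_interval[OF U(2) g, of 1 T]) auto
  define V where "V = measure lborel U"
  have V: "V \<ge> 0" by (simp add: V_def)
  \<comment> \<open>An increase of the integrand by \<open>\<kappa>\<close> costs at most \<open>e ^ N\<close>; the summand \<open>1\<close> only avoids division by zero.\<close>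
  define \<kappa> where "\<kappa> = e ^ N / (V + 1)"
  have \<kappa>: "\<kappa> > 0" using e V by (simp add: \<kappa>_def)
  have "uniformly_continuous_on {0..B + 1} (\<lambda>r::real. r ^ N)"
    by (intro compact_uniformly_continuous continuous_intros) simp
  then obtain d where d: "d > 0" "\<And>r s. r \<in> {0..B + 1} \<Longrightarrow> s \<in> {0..B + 1} \<Longrightarrow> dist s r < d \<Longrightarrow> dist (s ^ N) (r ^ N) < \<kappa>"
    using \<kappa> unfolding uniformly_continuous_on_def by metis
  define \<delta> where "\<delta> = min 1 (d / 2)"
  have \<delta>: "\<delta> > 0" "\<delta> \<le> 1" "\<delta> < d" using d(1) by (auto simp: \<delta>_def)
  have step: "(r + \<delta>) ^ N \<le> r ^ N + \<kappa>" if "0 \<le> r" "r \<le> B" for r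
    using d(2)[of r "r + \<delta>"] that \<delta> by (simp add: dist_real_def)
  show thesis
  proof (rule that[OF \<delta>(1)])
    fix t X assume t: "1 \<le> t" "t \<le> T" and X: "continuous_on (closure U) X"
      and le: "\<And>x. x \<in> U \<Longrightarrow> 0 \<le> X x \<and> X x \<le> norm (g (x, t)) + \<delta>"
    have gc: "continuous_on (closure U) (\<lambda>x. norm (g (x, t)) ^ N)"
      using t by (intro continuous_intros continuous_at_fixed_time[OF g]) simp
    note int = set_integrable_continuous_closure[OF U gc]
      set_integrable_continuous_closure[OF U continuous_on_const[of _ \<kappa>]]
    have "(LINT x:U|lborel. X x ^ N) \<le> (LINT x:U|lborel. norm (g (x, t)) ^ N + \<kappa>)"
    proof (rule set_integral_mono)
      show "set_integrable lborel U (\<lambda>x. X x ^ N)"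
        by (intro set_integrable_continuous_closure U continuous_intros X)
      show "set_integrable lborel U (\<lambda>x. norm (g (x, t)) ^ N + \<kappa>)"
        by (intro set_integral_add int)
      fix x assume x: "x \<in> U"
      then have xc: "x \<in> closure U" using closure_subset by blast
      have "X x ^ N \<le> (norm (g (x, t)) + \<delta>) ^ N" using le[OF x] by (intro power_mono) auto
      also have "\<dots> \<le> norm (g (x, t)) ^ N + \<kappa>" using B(2)[OF xc t] by (intro step) auto
      finally show "X x ^ N \<le> norm (g (x, t)) ^ N + \<kappa>" .
    qed
    also have "\<dots> = (LINT x:U|lborel. norm (g (x, t)) ^ N) + (LINT x:U|lborel. \<kappa>)"
      by (intro set_integral_add int)
    also have "(LINT x:U|lborel. \<kappa>) = V * \<kappa>"
      using U by (simp add: set_lebesgue_integral_def V_def)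
    also have "V * \<kappa> \<le> e ^ N"
      using e V by (simp add: \<kappa>_def divide_le_eq algebra_simps)
    also have "(LINT x:U|lborel. norm (g (x, t)) ^ N) = L_norm (real N) U (\<lambda>x. g (x, t)) ^ N"
      using L_norm_power[OF N] by metis
    also have "L_norm (real N) U (\<lambda>x. g (x, t)) ^ N + e ^ N \<le> (L_norm (real N) U (\<lambda>x. g (x, t)) + e) ^ N"
      using e N by (intro sum_powers_le_power_sum L_norm_nonneg) auto
    finally show "(LINT x:U|lborel. X x ^ N) \<le> (L_norm (real N) U (\<lambda>x. g (x, t)) + e) ^ N" by simp
  qed
qed

text \<open>Differentiating \<open>f y s - f y t = \<integral> f\<^sub>t y \<tau> d\<tau>\<close> under the integral sign shows that the increment of the
  gradient is the integral of the gradient of \<open>f\<^sub>t\<close>. This replaces the commutation of \<open>\<nabla>\<close> with the time derivative.\<close>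

lemma grad_increment_le:
  fixes f :: "'a::euclidean_space \<Rightarrow> real \<Rightarrow> real"
  assumes U: "open U" "x \<in> U"
    and f: "C1_space_time U f" "C1_space_time U (\<lambda>x. deriv (f x))"
    and t: "0 < t" "t \<le> s"
    and bound: "\<And>\<tau>. \<tau> \<in> {t..s} \<Longrightarrow> norm (grad (closure U) (\<lambda>y. deriv (f y) \<tau>) x) \<le> c"
  shows "norm (grad (closure U) (\<lambda>y. f y s) x - grad (closure U) (\<lambda>y. f y t) x) \<le> c * (s - t)"
proof -
  have Ucl: "U \<subseteq> closure U" by (rule closure_subset)
  obtain r where r: "r > 0" "ball x r \<subseteq> U" using U open_contains_ball by blast
  define fx where "fx y \<tau> = blinfun_inner_right (grad (closure U) (\<lambda>z. deriv (f z) \<tau>) y)" for y \<tau>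
  have cont: "continuous_on (closure U \<times> {0<..}) (\<lambda>(y, \<tau>). fx y \<tau>)"
  proof -
    have "continuous_on (closure U \<times> {0<..}) (\<lambda>(y, \<tau>). grad (closure U) (\<lambda>z. deriv (f z) \<tau>) y)"
      using f(2) by (simp add: C1_space_time_def)
    then have "continuous_on (closure U \<times> {0<..}) (\<lambda>z. blinfun_inner_right (case z of (y, \<tau>) \<Rightarrow> grad (closure U) (\<lambda>z. deriv (f z) \<tau>) y))"
      by (rule bounded_linear.continuous_on[OF bounded_linear_blinfun_inner_right])
    then show ?thesis by (simp add: fx_def case_prod_beta)
  qed
  have int: "((\<lambda>\<tau>. deriv (f y) \<tau>) has_integral (f y s - f y t)) (cbox t s)" if "y \<in> U" for y
    unfolding cbox_interval
  proof (rule fundamental_theorem_of_calculus[OF t(2)])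
    fix \<tau> assume "\<tau> \<in> {t..s}"
    then have "f y differentiable (at \<tau>)" using that Ucl t f(1) by (auto simp: C1_space_time_def)
    then have "(f y has_real_derivative deriv (f y) \<tau>) (at \<tau>)"
      using DERIV_deriv_iff_real_differentiable by blast
    then show "(f y has_vector_derivative deriv (f y) \<tau>) (at \<tau> within {t..s})"
      using has_real_derivative_iff_has_vector_derivative has_vector_derivative_at_within by blast
  qed
  have "((\<lambda>y. integral (cbox t s) (deriv (f y))) has_derivative blinfun_apply (integral (cbox t s) (fx x))) (at x within ball x r)"
  proof (rule leibniz_rule)
    fix y \<tau> assume y: "y \<in> ball x r" and \<tau>: "\<tau> \<in> cbox t s"
    have "((\<lambda>y. deriv (f y) \<tau>) has_derivative (\<lambda>h. grad (closure U) (\<lambda>z. deriv (f z) \<tau>) y \<bullet> h)) (at y)"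
    proof (rule has_derivative_grad[OF _ U(1) _ Ucl])
      show "y \<in> U" using y r(2) by blast
      then have "y \<in> closure U" "0 < \<tau>" using Ucl \<tau> t by auto
      then show "(\<lambda>y. deriv (f y) \<tau>) differentiable (at y within closure U)"
        using f(2) by (simp add: C1_space_time_def)
    qed
    then have "((\<lambda>y. deriv (f y) \<tau>) has_derivative blinfun_apply (fx y \<tau>)) (at y)"
      by (simp add: fx_def blinfun_inner_right.rep_eq)
    then show "((\<lambda>y. deriv (f y) \<tau>) has_derivative blinfun_apply (fx y \<tau>)) (at y within ball x r)"
      by (rule has_derivative_at_withinI)
  next
    fix y assume "y \<in> ball x r"
    then show "deriv (f y) integrable_on cbox t s" using int r(2) by blast
  next
    show "continuous_on (ball x r \<times> cbox t s) (\<lambda>(y, \<tau>). fx y \<tau>)"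
      by (rule continuous_on_subset[OF cont]) (use r(2) Ucl t in auto)
  qed (use r in auto)
  then have "((\<lambda>y. integral (cbox t s) (deriv (f y))) has_derivative blinfun_apply (integral (cbox t s) (fx x))) (at x)"
    unfolding at_within_open[OF centre_in_ball[THEN iffD2, OF r(1)] open_ball] .
  then have 1: "((\<lambda>y. f y s - f y t) has_derivative blinfun_apply (integral (cbox t s) (fx x))) (at x)"
    by (rule has_derivative_transform_within_open[OF _ U]) (rule integral_unique[OF int])
  define D where "D = grad (closure U) (\<lambda>y. f y s) x - grad (closure U) (\<lambda>y. f y t) x"
  have g: "((\<lambda>y. f y \<tau>) has_derivative (\<lambda>h. grad (closure U) (\<lambda>y. f y \<tau>) x \<bullet> h)) (at x)" if "\<tau> > 0" for \<tau>
    by (rule has_derivative_grad[OF _ U Ucl]) (use f(1) U(2) Ucl that in \<open>auto simp: C1_space_time_def\<close>)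
  have "((\<lambda>y. f y s - f y t) has_derivative (\<lambda>h. D \<bullet> h)) (at x)"
    unfolding D_def inner_diff_left using t by (intro has_derivative_diff g) auto
  then have D: "D \<bullet> h = blinfun_apply (integral (cbox t s) (fx x)) h" for h
    using has_derivative_unique[OF 1] by metis
  have "norm (integral (cbox t s) (fx x)) \<le> c * (s - t)"
    unfolding cbox_interval
  proof (rule integral_bound[OF t(2)])
    have "continuous_on {t..s} (\<lambda>\<tau>. case (x, \<tau>) of (y, \<tau>) \<Rightarrow> fx y \<tau>)"
      by (rule continuous_on_compose2[OF cont]) (use t U(2) Ucl in \<open>auto intro!: continuous_intros\<close>)
    then show "continuous_on {t..s} (fx x)" by simp
    show "norm (fx x \<tau>) \<le> c" if "\<tau> \<in> {t..s}" for \<tau>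
    proof -
      have "norm (fx x \<tau>) \<le> norm (grad (closure U) (\<lambda>z. deriv (f z) \<tau>) x)"
        by (rule norm_blinfun_bound) (auto simp: fx_def blinfun_inner_right.rep_eq Cauchy_Schwarz_ineq2)
      then show "norm (fx x \<tau>) \<le> c" using bound[OF \<open>\<tau> \<in> {t..s}\<close>] by simp
    qed
  qed
  then have "norm (blinfun_apply (integral (cbox t s) (fx x)) D) \<le> c * (s - t) * norm D"
    using norm_blinfun[of "integral (cbox t s) (fx x)" D] by (meson mult_right_mono norm_ge_zero order_trans)
  then have "norm D * norm D \<le> c * (s - t) * norm D"
    by (simp only: D[symmetric] real_norm_def power2_norm_eq_inner[symmetric] power2_eq_square abs_mult abs_norm_cancel)
  then have "norm D \<le> c * (s - t)" if "D \<noteq> 0" using that by simp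
  moreover have "0 \<le> c * (s - t)"
    using bound[of t] t by (intro mult_nonneg_nonneg) (auto intro: order_trans[OF norm_ge_zero])
  ultimately show ?thesis unfolding D_def[symmetric] by (cases "D = 0") auto
qed

section \<open>The truncated power\<close>

definition excess :: "real \<Rightarrow> real \<Rightarrow> real" where
  "excess M s = max 0 (\<bar>s\<bar> - M)"

text \<open>The odd function whose modulus is \<open>excess M s ^ Suc m\<close>. Being a difference of powers of positive parts, it is
  continuously differentiable for \<open>m \<ge> 1\<close>.\<close>

definition excess_force :: "real \<Rightarrow> nat \<Rightarrow> real \<Rightarrow> real" where
  "excess_force M m s = max 0 (s - M) ^ Suc m - max 0 (- s - M) ^ Suc m"

lemma excess_nonneg: "excess M s \<ge> 0"
  by (simp add: excess_def)

lemma excess_power: "excess M s ^ n = max 0 (s - M) ^ n + max 0 (- s - M) ^ n" if "M \<ge> 0" "n \<ge> 1"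
  using that by (cases "s \<ge> 0") (auto simp: excess_def max_def power_0_left)

lemma abs_excess_force: "\<bar>excess_force M m s\<bar> = excess M s ^ Suc m" if "M \<ge> 0"
proof (cases "s \<ge> 0")
  case True
  then have "max 0 (- s - M) = 0" using that by simp
  then show ?thesis using True by (simp add: excess_def excess_force_def abs_mult power_abs)
next
  case False
  then have "max 0 (s - M) = 0" using that by simp
  then show ?thesis using False by (simp add: excess_def excess_force_def abs_mult power_abs)
qed

lemma excess_force_derivative:
  assumes "M \<ge> 0" "m \<ge> 1"
  shows "(excess_force M m has_real_derivative real (Suc m) * excess M s ^ m) (at s)"
    and "((\<lambda>s. excess M s ^ Suc (Suc m)) has_real_derivative real (Suc (Suc m)) * excess_force M m s) (at s)"
proof -
  have pos: "((\<lambda>s. max 0 (s - M) ^ Suc k) has_real_derivative (real (Suc k) * max 0 (s - M) ^ k) * 1) (at s)" if "k \<ge> 1" for k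
  proof (rule DERIV_chain2[where f = "\<lambda>x. max 0 x ^ Suc k" and g = "\<lambda>s. s - M"])
    show "((\<lambda>x. max 0 x ^ Suc k) has_real_derivative real (Suc k) * max 0 (s - M) ^ k) (at (s - M))"
      by (rule has_real_derivative_pos_part_power[OF that])
  qed (auto intro!: derivative_eq_intros)
  have neg: "((\<lambda>s. max 0 (- s - M) ^ Suc k) has_real_derivative (real (Suc k) * max 0 (- s - M) ^ k) * (- 1)) (at s)" if "k \<ge> 1" for k
  proof (rule DERIV_chain2[where f = "\<lambda>x. max 0 x ^ Suc k" and g = "\<lambda>s. - s - M"])
    show "((\<lambda>x. max 0 x ^ Suc k) has_real_derivative real (Suc k) * max 0 (- s - M) ^ k) (at (- s - M))"
      by (rule has_real_derivative_pos_part_power[OF that])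
  qed (auto intro!: derivative_eq_intros)
  show "(excess_force M m has_real_derivative real (Suc m) * excess M s ^ m) (at s)"
    unfolding excess_force_def excess_power[OF assms]
    by (rule DERIV_cong[OF DERIV_diff[OF pos neg]]) (use assms in \<open>simp_all add: algebra_simps\<close>)
  have *: "(\<lambda>s. excess M s ^ Suc (Suc m)) = (\<lambda>s. max 0 (s - M) ^ Suc (Suc m) + max 0 (- s - M) ^ Suc (Suc m))"
    using excess_power[OF assms(1), of "Suc (Suc m)"] by auto
  show "((\<lambda>s. excess M s ^ Suc (Suc m)) has_real_derivative real (Suc (Suc m)) * excess_force M m s) (at s)"
    unfolding *
    by (rule DERIV_cong[OF DERIV_add[OF pos neg]])
       (simp_all add: excess_force_def algebra_simps)
qed

lemma continuous_excess: "continuous_on T (excess M)"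
  unfolding excess_def by (intro continuous_intros)

lemma continuous_excess_force: "continuous_on T (excess_force M m)"
  unfolding excess_force_def by (intro continuous_intros)

section \<open>Time increments of a Forchheimer flow\<close>

context forchheimer
begin

lemma flux_eq_law: "flux (forch_K k a \<alpha>) U w x = law (grad (closure U) w x)"
  by (simp add: flux_def law_def)

lemma flux_derivative:
  fixes U :: "'a::euclidean_space set"
  assumes U: "open U" and w: "C2_on U w"
  shows "\<exists>F'. (\<forall>x\<in>U. (flux (forch_K k a \<alpha>) U w has_derivative F' x) (at x)) \<and>
    (\<forall>C. compact C \<longrightarrow> C \<subseteq> U \<longrightarrow> (\<exists>L. \<forall>x\<in>C. \<forall>v. norm (F' x v) \<le> L * norm v))"
proof -
  obtain q where q: "\<And>x. x \<in> U \<Longrightarrow> GDERIV w x :> q x" "C1_on U q"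
    using w by (auto simp: C2_on_def)
  obtain q' where q': "\<And>x. x \<in> U \<Longrightarrow> (q has_derivative blinfun_apply (q' x)) (at x within U)" "continuous_on U q'"
    using q(2) by (auto simp: C1_on_def)
  have grad: "grad (closure U) w x = q x" if "x \<in> U" for x
    by (rule grad_eqI[OF _ U that closure_subset]) (use q(1)[OF that] in \<open>simp add: gderiv_def inner_commute\<close>)
  have "\<forall>\<xi>::'a. \<exists>D. (law has_derivative D) (at \<xi>) \<and> (\<forall>v. norm (D v) \<le> norm v / a 0)"
    using law_has_derivative by blast
  from choice[OF this] obtain D where
    "\<forall>\<xi>::'a. (law has_derivative D \<xi>) (at \<xi>) \<and> (\<forall>v. norm (D \<xi> v) \<le> norm v / a 0)" ..
  then have D: "\<And>\<xi>::'a. (law has_derivative D \<xi>) (at \<xi>)" "\<And>(\<xi>::'a) v. norm (D \<xi> v) \<le> norm v / a 0"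
    by simp_all
  define F' where "F' x v = D (q x) (blinfun_apply (q' x) v)" for x v
  have "(flux (forch_K k a \<alpha>) U w has_derivative F' x) (at x)" if x: "x \<in> U" for x
  proof -
    have "(q has_derivative blinfun_apply (q' x)) (at x)"
      using q'(1)[OF x] unfolding at_within_open[OF x U] .
    then have "((\<lambda>x. law (q x)) has_derivative (\<lambda>v. D (q x) (blinfun_apply (q' x) v))) (at x)"
      using D(1)[of "q x"]
      by (rule has_derivative_compose[where f = q and f' = "blinfun_apply (q' x)" and g = law and g' = "D (q x)"])
    then have "((\<lambda>x. law (q x)) has_derivative F' x) (at x)" by (simp add: F'_def[abs_def])
    then show ?thesis
      by (rule has_derivative_transform_within_open[OF _ U x]) (simp add: flux_eq_law grad)
  qed
  moreover have "\<exists>L. \<forall>x\<in>C. \<forall>v. norm (F' x v) \<le> L * norm v" if C: "compact C" "C \<subseteq> U" for C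
  proof -
    have "bounded (q' ` C)"
      by (intro compact_imp_bounded compact_continuous_image continuous_on_subset[OF q'(2)] C)
    then obtain L where L: "\<And>x. x \<in> C \<Longrightarrow> norm (q' x) \<le> L" by (auto simp: bounded_iff)
    have "norm (F' x v) \<le> (L / a 0) * norm v" if "x \<in> C" for x v
    proof -
      have "norm (q' x v) \<le> L * norm v"
        using norm_blinfun[of "q' x" v] L[OF that] by (meson mult_right_mono norm_ge_zero order_trans)
      then show ?thesis
        using D(2)[of "q x" "q' x v"] a0_pos by (simp add: F'_def field_simps)
    qed
    then show ?thesis by blast
  qed
  ultimately show ?thesis by blast
qed

end

locale forchheimer_flow = forchheimer k a \<alpha> for k a \<alpha> +
  fixes U \<Gamma>i \<Gamma>e :: "'a::euclidean_space set" and Q \<gamma> :: "real \<Rightarrow> real" and A M :: real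
    and p \<psi> \<Psi> :: "'a \<Rightarrow> real \<Rightarrow> real" and p0 :: "'a \<Rightarrow> real"
  assumes domain: "bounded_C2_domain U"
    and frontier: "frontier U = \<Gamma>e \<union> \<Gamma>i"
    and solution: "IBVP_I (forch_K k a \<alpha>) U \<Gamma>i \<Gamma>e Q \<psi> p0 p \<gamma>"
    and extension: "lateral_extension U \<Gamma>i \<psi> \<Psi>"
    and boundary_rate: "\<And>t. t \<ge> 1 \<Longrightarrow> \<bar>deriv (\<lambda>s. \<gamma> s + A * s) t\<bar> \<le> M"
begin

abbreviation "grad_p t x \<equiv> grad (closure U) (\<lambda>y. p y t) x"
abbreviation "grad_\<Psi> t x \<equiv> grad (closure U) (\<lambda>y. \<Psi> y t) x"
abbreviation "grad_\<Psi>t t x \<equiv> grad (closure U) (\<lambda>y. deriv (\<Psi> y) t) x"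

definition u :: "'a \<Rightarrow> real \<Rightarrow> real" where
  "u x t = deriv (p x) t - deriv (\<Psi> x) t + A"

text \<open>The difference quotient in time of \<open>p - \<Psi> + A t\<close>; it tends to \<open>u\<close> as \<open>h \<rightarrow> 0\<close>.\<close>

definition dq :: "real \<Rightarrow> 'a \<Rightarrow> real \<Rightarrow> real" where
  "dq h x t = ((p x (t + h) - \<Psi> x (t + h)) - (p x t - \<Psi> x t)) / h + A"

definition dq_grad :: "real \<Rightarrow> 'a \<Rightarrow> real \<Rightarrow> 'a" where
  "dq_grad h x t = (1 / h) *\<^sub>R ((grad_p (t + h) x - grad_p t x) - (grad_\<Psi> (t + h) x - grad_\<Psi> t x))"

lemma open_U: "open U" and bounded_U: "bounded U"
  using domain by (auto simp: bounded_C2_domain_def)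

lemma U_closure: "x \<in> U \<Longrightarrow> x \<in> closure U"
  using closure_subset by blast

lemma M_nonneg: "M \<ge> 0"
  using boundary_rate[of 1] by linarith

lemma C1_p: "C1_space_time U p" and C1_\<Psi>: "C1_space_time U \<Psi>" and C1_\<Psi>t: "C1_space_time U (\<lambda>x. deriv (\<Psi> x))"
  using solution extension by (auto simp: IBVP_I_def lateral_extension_def)

lemma time_derivative:
  assumes "C1_space_time U f" "x \<in> closure U" "t > 0"
  shows "(f x has_real_derivative deriv (f x) t) (at t)"
  using assms unfolding C1_space_time_def DERIV_deriv_iff_real_differentiable by blast

lemma space_derivative:
  assumes "C1_space_time U f" "x \<in> U" "t > 0"
  shows "((\<lambda>y. f y t) has_derivative (\<lambda>v. grad (closure U) (\<lambda>y. f y t) x \<bullet> v)) (at x)"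
  by (rule has_derivative_grad[OF _ open_U assms(2) closure_subset])
     (use assms U_closure in \<open>auto simp: C1_space_time_def\<close>)

lemma C1_continuous:
  assumes "C1_space_time U f"
  shows "continuous_on (closure U \<times> {0<..}) (\<lambda>z. deriv (f (fst z)) (snd z))"
    and "continuous_on (closure U \<times> {0<..}) (\<lambda>z. grad (closure U) (\<lambda>y. f y (snd z)) (fst z))"
    and "t > 0 \<Longrightarrow> continuous_on (closure U) (\<lambda>x. f x t)"
    and "t > 0 \<Longrightarrow> continuous_on (closure U) (\<lambda>x. deriv (f x) t)"
    and "t > 0 \<Longrightarrow> continuous_on (closure U) (\<lambda>x. grad (closure U) (\<lambda>y. f y t) x)"
proof -
  show 1: "continuous_on (closure U \<times> {0<..}) (\<lambda>z. deriv (f (fst z)) (snd z))"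
    and 2: "continuous_on (closure U \<times> {0<..}) (\<lambda>z. grad (closure U) (\<lambda>y. f y (snd z)) (fst z))"
    using assms by (simp_all add: C1_space_time_def case_prod_beta')
  assume t: "t > 0"
  show "continuous_on (closure U) (\<lambda>x. f x t)"
    unfolding continuous_on_eq_continuous_within
    using assms t by (auto simp: C1_space_time_def intro!: differentiable_imp_continuous_within)
  show "continuous_on (closure U) (\<lambda>x. deriv (f x) t)"
    using continuous_at_fixed_time[OF 1 t] by simp
  show "continuous_on (closure U) (\<lambda>x. grad (closure U) (\<lambda>y. f y t) x)"
    using continuous_at_fixed_time[OF 2 t] by simp
qed

lemma u_continuous: "continuous_on (closure U \<times> {0<..}) (\<lambda>z. u (fst z) (snd z))"
  unfolding u_def by (intro continuous_intros C1_continuous(1) C1_p C1_\<Psi>)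

lemma potential_derivative:
  assumes "x \<in> closure U" "t > 0"
  shows "((\<lambda>s. p x s - \<Psi> x s + A * s) has_real_derivative u x t) (at t)"
  unfolding u_def
  by (rule derivative_eq_intros time_derivative[OF C1_p assms] time_derivative[OF C1_\<Psi> assms] refl)+ simp

lemma dq_eq: "dq h x t = ((p x (t + h) - \<Psi> x (t + h) + A * (t + h)) - (p x t - \<Psi> x t + A * t)) / h" if "h \<noteq> 0"
  using that by (simp add: dq_def field_simps)

lemma dq_mean_value:
  assumes "x \<in> closure U" "t > 0" "h > 0"
  obtains s where "t < s" "s < t + h" "dq h x t = u x s"
proof -
  obtain s where "t < s" "s < t + h"
    "(p x (t + h) - \<Psi> x (t + h) + A * (t + h)) - (p x t - \<Psi> x t + A * t) = (t + h - t) * u x s"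
    using MVT2[of t "t + h" "\<lambda>s. p x s - \<Psi> x s + A * s" "u x"] potential_derivative assms by force
  then show thesis using assms by (intro that[of s]) (auto simp: dq_eq)
qed

lemma dq_tendsto:
  assumes "x \<in> closure U" "t > 0"
  shows "((\<lambda>h. dq h x t) \<longlongrightarrow> u x t) (at 0)"
proof -
  have "((\<lambda>h. ((p x (t + h) - \<Psi> x (t + h) + A * (t + h)) - (p x t - \<Psi> x t + A * t)) / h) \<longlongrightarrow> u x t) (at 0)"
    using potential_derivative[OF assms] by (simp add: DERIV_def)
  then show ?thesis
    by (rule Lim_transform_eventually) (auto simp: eventually_at dq_eq intro!: exI[of _ 1])
qed

text \<open>On \<open>\<Gamma>\<^sub>i\<close> the function \<open>p - \<Psi>\<close> equals \<open>\<gamma>\<close>, so the quotient is a value of \<open>\<Delta>\<^sub>\<gamma>'\<close> at an intermediate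
  time.\<close>

lemma dq_boundary:
  assumes x: "x \<in> \<Gamma>i" and t: "t \<ge> 1" and h: "h > 0"
  shows "\<bar>dq h x t\<bar> \<le> M"
proof -
  have bd: "p x s - \<Psi> x s = \<gamma> s" if "s > 0" for s
    using solution extension x that by (auto simp: IBVP_I_def lateral_extension_def)
  have der: "((\<lambda>s. \<gamma> s + A * s) has_real_derivative deriv (\<lambda>s. \<gamma> s + A * s) s) (at s)" if "s > 0" for s
  proof -
    have "\<gamma> differentiable (at s)" using solution that by (auto simp: IBVP_I_def)
    then have "(\<lambda>s. \<gamma> s + A * s) differentiable (at s)" by (intro derivative_intros)
    then show ?thesis unfolding DERIV_deriv_iff_real_differentiable .
  qed
  obtain s where s: "t < s" "s < t + h" "(\<gamma> (t + h) + A * (t + h)) - (\<gamma> t + A * t) = (t + h - t) * deriv (\<lambda>s. \<gamma> s + A * s) s"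
    using MVT2[of t "t + h" "\<lambda>s. \<gamma> s + A * s" "deriv (\<lambda>s. \<gamma> s + A * s)"] der t h by force
  have "dq h x t = deriv (\<lambda>s. \<gamma> s + A * s) s"
    using s(3) h t bd[of t] bd[of "t + h"] by (simp add: dq_def field_simps)
  then show ?thesis using boundary_rate[of s] s t by simp
qed

lemma dq_continuous: "continuous_on (closure U) (\<lambda>x. dq h x t)" if "t > 0" "h > 0"
  unfolding dq_def using that
  by (intro continuous_intros C1_continuous(3) C1_p C1_\<Psi>) auto

lemma dq_grad_continuous: "continuous_on (closure U) (\<lambda>x. dq_grad h x t)" if "t > 0" "h > 0"
  unfolding dq_grad_def using that
  by (intro continuous_intros C1_continuous(5) C1_p C1_\<Psi>) auto

lemma dq_space_derivative:
  assumes "x \<in> U" "t > 0" "h > 0"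
  shows "((\<lambda>y. dq h y t) has_derivative (\<lambda>v. dq_grad h x t \<bullet> v)) (at x)"
proof -
  have p: "((\<lambda>y. p y s) has_derivative (\<lambda>v. grad_p s x \<bullet> v)) (at x)" if "s > 0" for s
    by (rule space_derivative[OF C1_p assms(1) that])
  have \<Psi>: "((\<lambda>y. \<Psi> y s) has_derivative (\<lambda>v. grad_\<Psi> s x \<bullet> v)) (at x)" if "s > 0" for s
    by (rule space_derivative[OF C1_\<Psi> assms(1) that])
  have "((\<lambda>y. (1 / h) *\<^sub>R ((p y (t + h) - \<Psi> y (t + h)) - (p y t - \<Psi> y t)) + A) has_derivative
     (\<lambda>v. (1 / h) *\<^sub>R ((grad_p (t + h) x \<bullet> v - grad_\<Psi> (t + h) x \<bullet> v) - (grad_p t x \<bullet> v - grad_\<Psi> t x \<bullet> v)) + 0)) (at x)"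
    using assms by (intro has_derivative_add has_derivative_const has_derivative_scaleR_right has_derivative_diff p \<Psi>) auto
  moreover have "(\<lambda>y. dq h y t) = (\<lambda>y. (1 / h) *\<^sub>R ((p y (t + h) - \<Psi> y (t + h)) - (p y t - \<Psi> y t)) + A)"
    by (simp add: fun_eq_iff dq_def)
  ultimately show ?thesis
    unfolding dq_grad_def
    by (simp only:) (erule has_derivative_eq_rhs, simp add: fun_eq_iff inner_diff_left algebra_simps)
qed

lemma dq_time_derivative:
  assumes "x \<in> closure U" "t > 0" "h > 0"
  shows "((\<lambda>t. dq h x t) has_real_derivative (u x (t + h) - u x t) / h) (at t)"
proof -
  have "((\<lambda>t. p x (t + h) - \<Psi> x (t + h) + A * (t + h)) has_real_derivative u x (t + h)) (at t)"
    using DERIV_shift[of "\<lambda>s. p x s - \<Psi> x s + A * s" "u x (t + h)" t h] potential_derivative[OF assms(1), of "t + h"] assms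
    by simp
  then have "((\<lambda>t. ((p x (t + h) - \<Psi> x (t + h) + A * (t + h)) - (p x t - \<Psi> x t + A * t)) / h) has_real_derivative (u x (t + h) - u x t) / h) (at t)"
    by (intro DERIV_cdivide DERIV_diff potential_derivative assms)
  moreover have "(\<lambda>t. dq h x t) = (\<lambda>t. ((p x (t + h) - \<Psi> x (t + h) + A * (t + h)) - (p x t - \<Psi> x t + A * t)) / h)"
    using dq_eq assms(3) by auto
  ultimately show ?thesis by simp
qed

lemma dq_bounded:
  assumes "0 < s1" "h > 0"
  obtains B where "B \<ge> 0" "\<And>x t. x \<in> closure U \<Longrightarrow> s1 \<le> t \<Longrightarrow> t \<le> s2 \<Longrightarrow> \<bar>dq h x t\<bar> \<le> B"
    "\<And>x t. x \<in> closure U \<Longrightarrow> s1 \<le> t \<Longrightarrow> t \<le> s2 \<Longrightarrow> \<bar>(u x (t + h) - u x t) / h\<bar> \<le> 2 * B / h"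
proof -
  obtain B where B: "B \<ge> 0" "\<And>x t. x \<in> closure U \<Longrightarrow> s1 \<le> t \<Longrightarrow> t \<le> s2 + h \<Longrightarrow> \<bar>u x t\<bar> \<le> B"
    using bounded_in_time_interval[OF bounded_U u_continuous assms(1)] by (metis fst_conv snd_conv real_norm_def)
  show thesis
  proof (rule that[OF B(1)])
    fix x t assume x: "x \<in> closure U" and t: "s1 \<le> t" "t \<le> s2"
    obtain s where "t < s" "s < t + h" "dq h x t = u x s"
      using dq_mean_value[OF x _ assms(2), of t] t assms by auto
    then show "\<bar>dq h x t\<bar> \<le> B" using B(2)[OF x, of s] t by auto
    have "\<bar>u x (t + h) - u x t\<bar> \<le> 2 * B" using B(2)[OF x, of t] B(2)[OF x, of "t + h"] t assms by auto
    then show "\<bar>(u x (t + h) - u x t) / h\<bar> \<le> 2 * B / h" using assms(2) by (simp add: divide_right_mono)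
  qed
qed

definition energy :: "nat \<Rightarrow> real \<Rightarrow> real \<Rightarrow> real" where
  "energy m h t = (LINT x:U|lborel. excess M (dq h x t) ^ Suc (Suc m))"

lemma energy_nonneg: "energy m h t \<ge> 0"
  unfolding energy_def set_lebesgue_integral_def
  by (intro Bochner_Integration.integral_nonneg) (simp add: excess_nonneg)

lemma excess_dq_continuous: "continuous_on (closure U) (\<lambda>x. excess M (dq h x t))"
  "continuous_on (closure U) (\<lambda>x. excess_force M m (dq h x t))" if "t > 0" "h > 0"
  by (rule continuous_on_compose2[OF continuous_excess dq_continuous[OF that] subset_UNIV],
      rule continuous_on_compose2[OF continuous_excess_force dq_continuous[OF that] subset_UNIV])

lemma energy_derivative:
  assumes m: "m \<ge> 1" and t: "t > 0" and h: "h > 0"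
  shows "(energy m h has_real_derivative
    (LINT x:U|lborel. real (Suc (Suc m)) * excess_force M m (dq h x t) * ((u x (t + h) - u x t) / h))) (at t)"
proof -
  obtain B where B: "B \<ge> 0" "\<And>x s. x \<in> closure U \<Longrightarrow> t / 2 \<le> s \<Longrightarrow> s \<le> 2 * t \<Longrightarrow> \<bar>dq h x s\<bar> \<le> B"
    "\<And>x s. x \<in> closure U \<Longrightarrow> t / 2 \<le> s \<Longrightarrow> s \<le> 2 * t \<Longrightarrow> \<bar>(u x (s + h) - u x s) / h\<bar> \<le> 2 * B / h"
    using dq_bounded[of "t / 2" h "2 * t"] t h by auto
  show ?thesis
    unfolding energy_def
  proof (rule has_real_derivative_set_integral[where \<delta> = "t / 2" and B = "real (Suc (Suc m)) * B ^ Suc m * (2 * B / h)"])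
    fix x s assume x: "x \<in> U" and "\<bar>s - t\<bar> < t / 2"
    then have s: "t / 2 \<le> s" "s \<le> 2 * t" "s > 0" using t by linarith+
    show "((\<lambda>t. excess M (dq h x t) ^ Suc (Suc m)) has_real_derivative
        real (Suc (Suc m)) * excess_force M m (dq h x s) * ((u x (s + h) - u x s) / h)) (at s)"
      by (rule DERIV_chain2[OF excess_force_derivative(2)[OF M_nonneg m] dq_time_derivative[OF U_closure[OF x] s(3) h]])
    have "\<bar>excess_force M m (dq h x s)\<bar> \<le> B ^ Suc m"
      unfolding abs_excess_force[OF M_nonneg]
    proof (rule power_mono[OF _ excess_nonneg])
      show "excess M (dq h x s) \<le> B"
        using B(2)[OF U_closure[OF x] s(1,2)] M_nonneg B(1) by (simp add: excess_def)
    qed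
    then have "\<bar>real (Suc (Suc m)) * excess_force M m (dq h x s)\<bar> \<le> real (Suc (Suc m)) * B ^ Suc m"
      unfolding abs_mult by (intro mult_mono) auto
    then show "\<bar>real (Suc (Suc m)) * excess_force M m (dq h x s) * ((u x (s + h) - u x s) / h)\<bar>
        \<le> real (Suc (Suc m)) * B ^ Suc m * (2 * B / h)"
      unfolding abs_mult[of "real (Suc (Suc m)) * excess_force M m (dq h x s)"]
      using B(3)[OF U_closure[OF x] s(1,2)] B(1) by (intro mult_mono) auto
  next
    fix s assume "\<bar>s - t\<bar> < t / 2"
    then have "s > 0" using t by linarith
    then show "set_integrable lborel U (\<lambda>x. excess M (dq h x s) ^ Suc (Suc m))"
      by (intro set_integrable_continuous_closure[OF open_U bounded_U] continuous_intros excess_dq_continuous h)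
  qed (use t open_U bounded_U in auto)
qed

text \<open>Subtracting the equations at the times \<open>t + h\<close> and \<open>t\<close>.\<close>

lemma flux_increment_field:
  assumes t: "t > 0" and h: "h > 0"
  obtains F' where "divergence_field U (\<lambda>x. law (grad_p (t + h) x) - law (grad_p t x)) F'
    (\<lambda>x. deriv (p x) (t + h) - deriv (p x) t)"
proof -
  let ?fl = "\<lambda>s. flux (forch_K k a \<alpha>) U (\<lambda>y. p y s)"
  have *: "\<exists>F'. (\<forall>x\<in>U. (?fl s has_derivative F' x) (at x)) \<and>
    (\<forall>C. compact C \<longrightarrow> C \<subseteq> U \<longrightarrow> (\<exists>L. \<forall>x\<in>C. \<forall>v. norm (F' x v) \<le> L * norm v)) \<and>
    (\<forall>x\<in>U. deriv (p x) s = (\<Sum>b\<in>Basis. F' x b \<bullet> b))" if s: "s > 0" for s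
  proof -
    have "C2_on U (\<lambda>x. p x s)" using solution s by (auto simp: IBVP_I_def)
    from flux_derivative[OF open_U this] obtain F' where
      F': "\<forall>x\<in>U. (?fl s has_derivative F' x) (at x)"
        "\<forall>C. compact C \<longrightarrow> C \<subseteq> U \<longrightarrow> (\<exists>L. \<forall>x\<in>C. \<forall>v. norm (F' x v) \<le> L * norm v)"
      by blast
    have "deriv (p x) s = (\<Sum>b\<in>Basis. F' x b \<bullet> b)" if x: "x \<in> U" for x
    proof -
      have "deriv (p x) s = divergence (?fl s) x" using solution x s by (auto simp: IBVP_I_def)
      moreover have "frechet_derivative (?fl s) (at x) = F' x"
        using frechet_derivative_at[of "?fl s" "F' x" x] F'(1) x by simp
      ultimately show ?thesis by (simp add: divergence_def)
    qed
    with F' show ?thesis by blast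
  qed
  obtain F1 where "(\<forall>x\<in>U. (?fl (t + h) has_derivative F1 x) (at x)) \<and>
    (\<forall>C. compact C \<longrightarrow> C \<subseteq> U \<longrightarrow> (\<exists>L. \<forall>x\<in>C. \<forall>v. norm (F1 x v) \<le> L * norm v)) \<and>
    (\<forall>x\<in>U. deriv (p x) (t + h) = (\<Sum>b\<in>Basis. F1 x b \<bullet> b))"
    using *[OF add_pos_pos[OF t h]] ..
  then have F1: "\<And>x. x \<in> U \<Longrightarrow> (?fl (t + h) has_derivative F1 x) (at x)"
    "\<And>C. compact C \<Longrightarrow> C \<subseteq> U \<Longrightarrow> \<exists>L. \<forall>x\<in>C. \<forall>v. norm (F1 x v) \<le> L * norm v"
    "\<And>x. x \<in> U \<Longrightarrow> deriv (p x) (t + h) = (\<Sum>b\<in>Basis. F1 x b \<bullet> b)"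
    by blast+
  obtain F2 where "(\<forall>x\<in>U. (?fl t has_derivative F2 x) (at x)) \<and>
    (\<forall>C. compact C \<longrightarrow> C \<subseteq> U \<longrightarrow> (\<exists>L. \<forall>x\<in>C. \<forall>v. norm (F2 x v) \<le> L * norm v)) \<and>
    (\<forall>x\<in>U. deriv (p x) t = (\<Sum>b\<in>Basis. F2 x b \<bullet> b))"
    using *[OF t] ..
  then have F2: "\<And>x. x \<in> U \<Longrightarrow> (?fl t has_derivative F2 x) (at x)"
    "\<And>C. compact C \<Longrightarrow> C \<subseteq> U \<Longrightarrow> \<exists>L. \<forall>x\<in>C. \<forall>v. norm (F2 x v) \<le> L * norm v"
    "\<And>x. x \<in> U \<Longrightarrow> deriv (p x) t = (\<Sum>b\<in>Basis. F2 x b \<bullet> b)"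
    by blast+
  have "divergence_field U (\<lambda>x. law (grad_p (t + h) x) - law (grad_p t x)) (\<lambda>x v. F1 x v - F2 x v)
    (\<lambda>x. deriv (p x) (t + h) - deriv (p x) t)"
  proof
    show "bounded_C2_domain U" by (rule domain)
    show "continuous_on (closure U) (\<lambda>x. law (grad_p (t + h) x) - law (grad_p t x))"
      using t h
      by (intro continuous_intros continuous_on_compose2[OF continuous_on_law[of UNIV] C1_continuous(5)[OF C1_p]]) auto
    show "continuous_on (closure U) (\<lambda>x. deriv (p x) (t + h) - deriv (p x) t)"
      using t h by (intro continuous_intros C1_continuous(4)[OF C1_p]) auto
    fix x assume x: "x \<in> U"
    show "((\<lambda>x. law (grad_p (t + h) x) - law (grad_p t x)) has_derivative (\<lambda>v. F1 x v - F2 x v)) (at x)"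
      using has_derivative_diff[OF F1(1)[OF x] F2(1)[OF x]] by (simp add: flux_eq_law)
    show "deriv (p x) (t + h) - deriv (p x) t = (\<Sum>b\<in>Basis. (F1 x b - F2 x b) \<bullet> b)"
      using F1(3)[OF x] F2(3)[OF x] by (simp add: inner_diff_left sum_subtractf)
  next
    fix C assume C: "compact C" "C \<subseteq> U"
    obtain L1 L2 where L: "\<forall>x\<in>C. \<forall>v. norm (F1 x v) \<le> L1 * norm v" "\<forall>x\<in>C. \<forall>v. norm (F2 x v) \<le> L2 * norm v"
      using F1(2)[OF C] F2(2)[OF C] by blast
    have "norm (F1 x v - F2 x v) \<le> (L1 + L2) * norm v" if "x \<in> C" for x v
      using norm_triangle_ineq4[of "F1 x v" "F2 x v"] L that
      by (smt (verit, ccfv_SIG) distrib_right)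
    then show "\<exists>L. \<forall>x\<in>C. \<forall>v. norm (F1 x v - F2 x v) \<le> L * norm v" by blast
  qed
  then show thesis by (rule that)
qed

lemma flux_increment_normal:
  assumes "x \<in> \<Gamma>e" "t > 0" "h > 0"
  shows "(law (grad_p (t + h) x) - law (grad_p t x)) \<bullet> outward_normal U x = 0"
proof -
  have "grad_p s x \<bullet> outward_normal U x = 0" if "s > 0" for s
    using solution assms(1) that by (auto simp: IBVP_I_def normal_derivative_def)
  from this[of t] this[of "t + h"] show ?thesis
    using assms by (simp add: law_def inner_diff_left)
qed

text \<open>The test function vanishes on \<open>\<Gamma>\<^sub>i\<close> by the bound on \<open>dq\<close>, and the flux increment is tangential on \<open>\<Gamma>\<^sub>e\<close>, so
  Green's identity has no boundary term.\<close>

lemma tested_equation: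
  assumes m: "m \<ge> 1" and t: "t \<ge> 1" and h: "h > 0"
  shows "(LINT x:U|lborel. excess_force M m (dq h x t) * (deriv (p x) (t + h) - deriv (p x) t))
    = - (LINT x:U|lborel. (law (grad_p (t + h) x) - law (grad_p t x)) \<bullet>
          ((real (Suc m) * excess M (dq h x t) ^ m) *\<^sub>R dq_grad h x t))"
proof -
  have t0: "t > 0" using t by simp
  obtain F' where "divergence_field U (\<lambda>x. law (grad_p (t + h) x) - law (grad_p t x)) F'
    (\<lambda>x. deriv (p x) (t + h) - deriv (p x) t)"
    by (rule flux_increment_field[OF t0 h])
  then interpret div: divergence_field U "\<lambda>x. law (grad_p (t + h) x) - law (grad_p t x)" F'
    "\<lambda>x. deriv (p x) (t + h) - deriv (p x) t" .
  show ?thesis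
  proof (rule div.green_identity)
    show "div.test_function (\<lambda>x. excess_force M m (dq h x t)) (\<lambda>x. (real (Suc m) * excess M (dq h x t) ^ m) *\<^sub>R dq_grad h x t)"
      unfolding div.test_function_def
    proof (intro conjI ballI)
      show "continuous_on (closure U) (\<lambda>x. excess_force M m (dq h x t))"
        by (rule excess_dq_continuous(2)[OF t0 h])
      show "continuous_on (closure U) (\<lambda>x. (real (Suc m) * excess M (dq h x t) ^ m) *\<^sub>R dq_grad h x t)"
        by (intro continuous_intros excess_dq_continuous(1)[OF t0 h] dq_grad_continuous[OF t0 h])
    next
      fix x assume x: "x \<in> U"
      have "((\<lambda>y. excess_force M m (dq h y t)) has_derivative (\<lambda>v. (real (Suc m) * excess M (dq h x t) ^ m) * (dq_grad h x t \<bullet> v))) (at x)"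
        by (rule has_derivative_compose[where f = "\<lambda>y. dq h y t" and f' = "\<lambda>v. dq_grad h x t \<bullet> v" and g = "excess_force M m"
              and g' = "(*) (real (Suc m) * excess M (dq h x t) ^ m)"])
           (rule dq_space_derivative[OF x t0 h], use excess_force_derivative(1)[OF M_nonneg m] in \<open>simp add: has_field_derivative_def\<close>)
      then show "((\<lambda>y. excess_force M m (dq h y t)) has_derivative (\<lambda>v. ((real (Suc m) * excess M (dq h x t) ^ m) *\<^sub>R dq_grad h x t) \<bullet> v)) (at x)"
        by (rule has_derivative_eq_rhs) auto
    next
      fix x assume "x \<in> frontier U"
      then consider "x \<in> \<Gamma>e" | "x \<in> \<Gamma>i" using frontier by blast
      then show "excess_force M m (dq h x t) = 0 \<or> (law (grad_p (t + h) x) - law (grad_p t x)) \<bullet> outward_normal U x = 0"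
      proof cases
        case 1
        then show ?thesis using flux_increment_normal t0 h by blast
      next
        case 2
        then have "excess M (dq h x t) = 0" using dq_boundary[OF 2 t h] by (simp add: excess_def)
        then have "\<bar>excess_force M m (dq h x t)\<bar> = 0" by (simp add: abs_excess_force[OF M_nonneg])
        then show ?thesis by simp
      qed
    qed
  qed
qed

section \<open>The energy estimate\<close>

text \<open>The time derivative of the energy splits into a diffusion and a forcing part. The former is bounded by
  \<open>tested_equation\<close> and \<open>law_pairing_lower_bound\<close>, the latter directly, and the two mixed integrals by the scaled
  Young inequality \<open>integral_power_mult_le\<close>.\<close>

lemma energy_rate_le:
  assumes m: "m \<ge> 1" and t: "t \<ge> 1" and h: "h > 0" and \<mu>: "\<mu> > 0" and \<nu>: "\<nu> > 0"
    and X: "(LINT x:U|lborel. (norm (grad_\<Psi> (t + h) x - grad_\<Psi> t x) / h) ^ Suc (Suc m)) \<le> \<mu> ^ Suc (Suc m)"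
    and Y: "(LINT x:U|lborel. (\<bar>deriv (\<Psi> x) (t + h) - deriv (\<Psi> x) t\<bar> / h) ^ Suc (Suc m)) \<le> \<nu> ^ Suc (Suc m)"
  shows "(LINT x:U|lborel. real (Suc (Suc m)) * excess_force M m (dq h x t) * ((u x (t + h) - u x t) / h))
    \<le> (1 + energy m h t) * (real (Suc (Suc m)) * real (Suc m) / (4 * a 0) * \<mu>\<^sup>2 + real (Suc (Suc m)) * \<nu>)"
proof -
  have t0: "t > 0" "t + h > 0" using t h by auto
  define N where "N = real (Suc (Suc m))"
  define P where "P x = excess M (dq h x t)" for x
  define \<phi> where "\<phi> x = excess_force M m (dq h x t)" for x
  define Xf where "Xf x = norm (grad_\<Psi> (t + h) x - grad_\<Psi> t x) / h" for x
  define Yf where "Yf x = \<bar>deriv (\<Psi> x) (t + h) - deriv (\<Psi> x) t\<bar> / h" for x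
  define Fl where "Fl x = law (grad_p (t + h) x) - law (grad_p t x)" for x
  define c where "c = real (Suc m) / (4 * a 0)"
  have c: "c \<ge> 0" using a0_pos by (simp add: c_def)
  have N: "N \<ge> 0" by (simp add: N_def)
  have P_nonneg: "P x \<ge> 0" for x by (simp add: P_def excess_nonneg)
  have cont: "continuous_on (closure U) P" "continuous_on (closure U) \<phi>"
    unfolding P_def \<phi>_def using excess_dq_continuous t0(1) h by blast+
  have contX: "continuous_on (closure U) Xf"
    unfolding Xf_def using t0 h by (intro continuous_intros C1_continuous(5)[OF C1_\<Psi>]) auto
  have contY: "continuous_on (closure U) Yf" "continuous_on (closure U) (\<lambda>x. (deriv (\<Psi> x) (t + h) - deriv (\<Psi> x) t) / h)"
    unfolding Yf_def using t0 h by (intro continuous_intros C1_continuous(4)[OF C1_\<Psi>]; simp)+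
  have contp: "continuous_on (closure U) (\<lambda>x. deriv (p x) (t + h) - deriv (p x) t)"
    using t0 by (intro continuous_intros C1_continuous(4)[OF C1_p])
  have contF: "continuous_on (closure U) Fl"
    unfolding Fl_def using t0
    by (intro continuous_intros continuous_on_compose2[OF continuous_on_law[of UNIV] C1_continuous(5)[OF C1_p]]) auto
  note int = set_integrable_continuous_closure[OF open_U bounded_U]
  have neg: "(LINT x:U|lborel. - G x) = - (LINT x:U|lborel. G x)" for G :: "'a \<Rightarrow> real"
    by (simp add: set_lebesgue_integral_def)
  have diffusion: "(LINT x:U|lborel. \<phi> x * (deriv (p x) (t + h) - deriv (p x) t)) \<le> h * (c * (\<mu>\<^sup>2 * (1 + energy m h t)))"
  proof -
    have "(LINT x:U|lborel. \<phi> x * (deriv (p x) (t + h) - deriv (p x) t))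
       = (LINT x:U|lborel. - (Fl x \<bullet> ((real (Suc m) * P x ^ m) *\<^sub>R dq_grad h x t)))"
      using tested_equation[OF m t h] unfolding neg \<phi>_def Fl_def P_def .
    also have "\<dots> \<le> (LINT x:U|lborel. h * (c * (P x ^ m * Xf x ^ 2)))"
    proof (rule set_integral_mono)
      show "set_integrable lborel U (\<lambda>x. - (Fl x \<bullet> ((real (Suc m) * P x ^ m) *\<^sub>R dq_grad h x t)))"
        by (intro int continuous_intros contF cont dq_grad_continuous t0(1) h)
      show "set_integrable lborel U (\<lambda>x. h * (c * (P x ^ m * Xf x ^ 2)))"
        by (intro int continuous_intros contX cont)
      fix x assume "x \<in> U"
      define \<theta> where "\<theta> = grad_\<Psi> (t + h) x - grad_\<Psi> t x"
      have "- (Fl x \<bullet> ((real (Suc m) * P x ^ m) *\<^sub>R dq_grad h x t))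
          = (real (Suc m) * P x ^ m / h) * - (Fl x \<bullet> ((grad_p (t + h) x - grad_p t x) - \<theta>))"
        by (simp add: dq_grad_def \<theta>_def)
      also have "\<dots> \<le> (real (Suc m) * P x ^ m / h) * ((norm \<theta>)\<^sup>2 / (4 * a 0))"
        unfolding Fl_def using h P_nonneg by (intro mult_left_mono law_pairing_lower_bound) auto
      also have "\<dots> = h * (c * (P x ^ m * Xf x ^ 2))"
      proof -
        have "(S * q / h) * (B\<^sup>2 / (4 * d)) = h * (S / (4 * d) * (q * (B / h)\<^sup>2))" if "d > 0" for S q B d :: real
          using h that by (simp add: field_simps power2_eq_square)
        from this[OF a0_pos] show ?thesis unfolding c_def Xf_def \<theta>_def .
      qed
      finally show "- (Fl x \<bullet> ((real (Suc m) * P x ^ m) *\<^sub>R dq_grad h x t)) \<le> h * (c * (P x ^ m * Xf x ^ 2))" .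
    qed
    also have "\<dots> = h * (c * (LINT x:U|lborel. P x ^ m * Xf x ^ 2))" by simp
    also have "(LINT x:U|lborel. P x ^ m * Xf x ^ 2) \<le> \<mu>\<^sup>2 * (1 + (LINT x:U|lborel. P x ^ (m + 2)))"
      by (rule integral_power_mult_le[OF open_U bounded_U cont(1) contX P_nonneg _ \<mu>])
         (use X h in \<open>auto simp: Xf_def\<close>)
    also have "(LINT x:U|lborel. P x ^ (m + 2)) = energy m h t" by (simp add: energy_def P_def)
    finally show ?thesis using h c by (simp add: mult_left_mono)
  qed
  have forcing: "(LINT x:U|lborel. - (\<phi> x * ((deriv (\<Psi> x) (t + h) - deriv (\<Psi> x) t) / h))) \<le> \<nu> * (1 + energy m h t)"
  proof -
    have "(LINT x:U|lborel. - (\<phi> x * ((deriv (\<Psi> x) (t + h) - deriv (\<Psi> x) t) / h)))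
        \<le> (LINT x:U|lborel. P x ^ Suc m * Yf x ^ 1)"
    proof (rule set_integral_mono)
      show "set_integrable lborel U (\<lambda>x. - (\<phi> x * ((deriv (\<Psi> x) (t + h) - deriv (\<Psi> x) t) / h)))"
        by (intro int continuous_on_minus continuous_on_mult cont contY)
      show "set_integrable lborel U (\<lambda>x. P x ^ Suc m * Yf x ^ 1)"
        by (intro int continuous_intros cont contY)
      fix x assume "x \<in> U"
      have "- (\<phi> x * ((deriv (\<Psi> x) (t + h) - deriv (\<Psi> x) t) / h)) \<le> \<bar>\<phi> x * ((deriv (\<Psi> x) (t + h) - deriv (\<Psi> x) t) / h)\<bar>"
        by linarith
      also have "\<dots> = P x ^ Suc m * Yf x ^ 1"
        using h by (simp only: abs_mult \<phi>_def abs_excess_force[OF M_nonneg] P_def Yf_def power_one_right abs_divide abs_of_pos)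
      finally show "- (\<phi> x * ((deriv (\<Psi> x) (t + h) - deriv (\<Psi> x) t) / h)) \<le> P x ^ Suc m * Yf x ^ 1" .
    qed
    also have "\<dots> \<le> \<nu> ^ 1 * (1 + (LINT x:U|lborel. P x ^ (Suc m + 1)))"
      by (rule integral_power_mult_le[OF open_U bounded_U cont(1) contY(1) P_nonneg _ \<nu>])
         (use Y h in \<open>auto simp: Yf_def\<close>)
    finally show ?thesis by (simp add: energy_def P_def)
  qed
  have "(LINT x:U|lborel. N * \<phi> x * ((u x (t + h) - u x t) / h))
      = (LINT x:U|lborel. N / h * (\<phi> x * (deriv (p x) (t + h) - deriv (p x) t))
           + N * - (\<phi> x * ((deriv (\<Psi> x) (t + h) - deriv (\<Psi> x) t) / h)))"
    by (rule set_lebesgue_integral_cong) (use open_U h in \<open>auto simp: u_def field_simps\<close>)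
  also have "\<dots> = N / h * (LINT x:U|lborel. \<phi> x * (deriv (p x) (t + h) - deriv (p x) t))
      + N * (LINT x:U|lborel. - (\<phi> x * ((deriv (\<Psi> x) (t + h) - deriv (\<Psi> x) t) / h)))"
  proof -
    have i: "set_integrable lborel U (\<lambda>x. N / h * (\<phi> x * (deriv (p x) (t + h) - deriv (p x) t)))"
      "set_integrable lborel U (\<lambda>x. N * - (\<phi> x * ((deriv (\<Psi> x) (t + h) - deriv (\<Psi> x) t) / h)))"
      by (intro set_integrable_mult_right int continuous_on_minus continuous_on_mult cont contp contY)+
    show ?thesis by (simp only: set_integral_add(2)[OF i] set_integral_mult_right)
  qed
  also have "\<dots> \<le> N / h * (h * (c * (\<mu>\<^sup>2 * (1 + energy m h t)))) + N * (\<nu> * (1 + energy m h t))"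
    using N h by (intro add_mono mult_left_mono diffusion forcing) auto
  also have "\<dots> = (1 + energy m h t) * (N * c * \<mu>\<^sup>2 + N * \<nu>)"
    using h by (simp add: algebra_simps)
  finally show ?thesis by (simp add: N_def \<phi>_def c_def)
qed

definition data_rate :: "nat \<Rightarrow> real \<Rightarrow> real" where
  "data_rate N t = L_norm (real N) U (\<lambda>x. deriv (deriv (\<Psi> x)) t) + (L_norm (real N) U (grad_\<Psi>t t))\<^sup>2"

lemma data_rate_nonneg: "data_rate N t \<ge> 0"
  by (simp add: data_rate_def L_norm_nonneg)

lemma data_rate_continuous: "N \<ge> 1 \<Longrightarrow> continuous_on {0<..} (data_rate N)"
  unfolding data_rate_def
  using L_norm_continuous_in_time[OF open_U bounded_U C1_continuous(1)[OF C1_\<Psi>t], of N]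
    L_norm_continuous_in_time[OF open_U bounded_U C1_continuous(2)[OF C1_\<Psi>t], of N]
  by (auto intro!: continuous_intros)

lemma integral_data_rate_le:
  assumes "N \<ge> 1" and data: "(\<integral>\<^sup>+ \<tau> \<in> {1..}. ennreal (data_rate N \<tau>) \<partial>lborel) \<le> ennreal C" and T: "1 \<le> T"
  shows "data_rate N integrable_on {1..T}" "integral {1..T} (data_rate N) \<le> max 0 C"
proof -
  have cont: "continuous_on {1..T} (data_rate N)"
    by (rule continuous_on_subset[OF data_rate_continuous[OF assms(1)]]) auto
  show "data_rate N integrable_on {1..T}" by (rule integrable_continuous_interval[OF cont])
  have int: "set_integrable lborel {1..T} (data_rate N)"
    using borel_integrable_compact[OF compact_Icc cont]
    by (simp add: set_integrable_def indicator_scaleR_eq_if)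
  have "ennreal (LINT t:{1..T}|lborel. data_rate N t) = (\<integral>\<^sup>+t. ennreal (indicator {1..T} t *\<^sub>R data_rate N t) \<partial>lborel)"
    unfolding set_lebesgue_integral_def
    by (rule nn_integral_eq_integral[symmetric])
       (use int data_rate_nonneg in \<open>auto simp: set_integrable_def\<close>)
  also have "\<dots> \<le> (\<integral>\<^sup>+ \<tau> \<in> {1..}. ennreal (data_rate N \<tau>) \<partial>lborel)"
    by (rule nn_integral_mono) (auto simp: indicator_def)
  also have "\<dots> \<le> ennreal (max 0 C)"
    using data by (simp add: ennreal_max_0)
  finally have "(LINT t:{1..T}|lborel. data_rate N t) \<le> max 0 C" by (simp add: ennreal_le_iff)
  then show "integral {1..T} (data_rate N) \<le> max 0 C"
    using set_borel_integral_eq_integral(2)[OF int] by simp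
qed

text \<open>Up to an error \<open>e\<close>, uniform on \<open>[1, T]\<close>, the data terms of \<open>energy_rate_le\<close> are norms of \<open>\<nabla>\<Psi>\<^sub>t\<close> and
  \<open>\<Psi>\<^sub>t\<^sub>t\<close>: difference quotients are averages or intermediate values of these, which are uniformly continuous in time.\<close>

lemma \<Psi>_increments_le:
  assumes N: "N \<ge> 1" and e: "e > 0"
  shows "\<exists>h0>0. \<forall>h t. 0 < h \<longrightarrow> h \<le> h0 \<longrightarrow> 1 \<le> t \<longrightarrow> t \<le> T \<longrightarrow>
      (LINT x:U|lborel. (norm (grad_\<Psi> (t + h) x - grad_\<Psi> t x) / h) ^ N) \<le> (L_norm (real N) U (grad_\<Psi>t t) + e) ^ N \<and>
      (LINT x:U|lborel. (\<bar>deriv (\<Psi> x) (t + h) - deriv (\<Psi> x) t\<bar> / h) ^ N)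
        \<le> (L_norm (real N) U (\<lambda>x. deriv (deriv (\<Psi> x)) t) + e) ^ N"
proof -
  note contG = C1_continuous(2)[OF C1_\<Psi>t] and contT = C1_continuous(1)[OF C1_\<Psi>t]
  obtain \<delta>1 where \<delta>1: "\<delta>1 > 0"
    "\<And>t X. 1 \<le> t \<Longrightarrow> t \<le> T \<Longrightarrow> continuous_on (closure U) X \<Longrightarrow>
      (\<And>x. x \<in> U \<Longrightarrow> 0 \<le> X x \<and> X x \<le> norm (grad_\<Psi>t t x) + \<delta>1) \<Longrightarrow>
      (LINT x:U|lborel. X x ^ N) \<le> (L_norm (real N) U (grad_\<Psi>t t) + e) ^ N"
    using L_norm_perturbation[OF open_U bounded_U contG N e, of T ?thesis] unfolding fst_conv snd_conv by metis
  obtain \<delta>2 where \<delta>2: "\<delta>2 > 0"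
    "\<And>t X. 1 \<le> t \<Longrightarrow> t \<le> T \<Longrightarrow> continuous_on (closure U) X \<Longrightarrow>
      (\<And>x. x \<in> U \<Longrightarrow> 0 \<le> X x \<and> X x \<le> norm (deriv (deriv (\<Psi> x)) t) + \<delta>2) \<Longrightarrow>
      (LINT x:U|lborel. X x ^ N) \<le> (L_norm (real N) U (\<lambda>x. deriv (deriv (\<Psi> x)) t) + e) ^ N"
    using L_norm_perturbation[OF open_U bounded_U contT N e, of T ?thesis] unfolding fst_conv snd_conv by metis
  obtain h1 where h1: "h1 > 0" "\<And>x t s. x \<in> closure U \<Longrightarrow> 1 \<le> t \<Longrightarrow> t \<le> T \<Longrightarrow> t \<le> s \<Longrightarrow> s \<le> t + h1 \<Longrightarrow>
      dist (grad_\<Psi>t s x) (grad_\<Psi>t t x) < \<delta>1"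
    using uniform_continuity_in_time[OF bounded_U contG \<delta>1(1), of T ?thesis] unfolding fst_conv snd_conv by metis
  obtain h2 where h2: "h2 > 0" "\<And>x t s. x \<in> closure U \<Longrightarrow> 1 \<le> t \<Longrightarrow> t \<le> T \<Longrightarrow> t \<le> s \<Longrightarrow> s \<le> t + h2 \<Longrightarrow>
      dist (deriv (deriv (\<Psi> x)) s) (deriv (deriv (\<Psi> x)) t) < \<delta>2"
    using uniform_continuity_in_time[OF bounded_U contT \<delta>2(1), of T ?thesis] unfolding fst_conv snd_conv by metis
  show ?thesis
  proof (intro exI[of _ "min h1 h2"] conjI allI impI)
    show "min h1 h2 > 0" using h1(1) h2(1) by simp
  next
    fix h t assume h: "0 < h" "h \<le> min h1 h2" and t: "1 \<le> t" "t \<le> T"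
    show "(LINT x:U|lborel. (norm (grad_\<Psi> (t + h) x - grad_\<Psi> t x) / h) ^ N) \<le> (L_norm (real N) U (grad_\<Psi>t t) + e) ^ N"
    proof (rule \<delta>1(2)[OF t])
      show "continuous_on (closure U) (\<lambda>x. norm (grad_\<Psi> (t + h) x - grad_\<Psi> t x) / h)"
        using t h by (intro continuous_intros C1_continuous(5)[OF C1_\<Psi>]) auto
      fix x assume x: "x \<in> U"
      have "norm (grad_\<Psi> (t + h) x - grad_\<Psi> t x) \<le> (norm (grad_\<Psi>t t x) + \<delta>1) * (t + h - t)"
      proof (rule grad_increment_le[OF open_U x C1_\<Psi> C1_\<Psi>t])
        fix \<tau> assume "\<tau> \<in> {t..t + h}"
        then have "dist (grad_\<Psi>t \<tau> x) (grad_\<Psi>t t x) < \<delta>1"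
          using h by (intro h1(2)[OF U_closure[OF x] t]) auto
        then show "norm (grad_\<Psi>t \<tau> x) \<le> norm (grad_\<Psi>t t x) + \<delta>1"
          using norm_triangle_sub[of "grad_\<Psi>t \<tau> x" "grad_\<Psi>t t x"] by (simp add: dist_norm)
      qed (use t h in auto)
      then show "0 \<le> norm (grad_\<Psi> (t + h) x - grad_\<Psi> t x) / h \<and>
          norm (grad_\<Psi> (t + h) x - grad_\<Psi> t x) / h \<le> norm (grad_\<Psi>t t x) + \<delta>1"
        using h by (simp add: divide_le_eq)
    qed
    show "(LINT x:U|lborel. (\<bar>deriv (\<Psi> x) (t + h) - deriv (\<Psi> x) t\<bar> / h) ^ N)
        \<le> (L_norm (real N) U (\<lambda>x. deriv (deriv (\<Psi> x)) t) + e) ^ N"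
    proof (rule \<delta>2(2)[OF t])
      show "continuous_on (closure U) (\<lambda>x. \<bar>deriv (\<Psi> x) (t + h) - deriv (\<Psi> x) t\<bar> / h)"
        using t h by (intro continuous_intros C1_continuous(4)[OF C1_\<Psi>]) auto
      fix x assume x: "x \<in> U"
      have der: "(deriv (\<Psi> x) has_real_derivative deriv (deriv (\<Psi> x)) s) (at s)" if "s > 0" for s
        by (rule time_derivative[OF C1_\<Psi>t U_closure[OF x] that])
      obtain s where s: "t < s" "s < t + h"
        "deriv (\<Psi> x) (t + h) - deriv (\<Psi> x) t = (t + h - t) * deriv (deriv (\<Psi> x)) s"
        using MVT2[of t "t + h" "deriv (\<Psi> x)" "deriv (deriv (\<Psi> x))"] der t h by force
      have "dist (deriv (deriv (\<Psi> x)) s) (deriv (deriv (\<Psi> x)) t) < \<delta>2"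
        using h s by (intro h2(2)[OF U_closure[OF x] t]) auto
      then show "0 \<le> \<bar>deriv (\<Psi> x) (t + h) - deriv (\<Psi> x) t\<bar> / h \<and>
          \<bar>deriv (\<Psi> x) (t + h) - deriv (\<Psi> x) t\<bar> / h \<le> norm (deriv (deriv (\<Psi> x)) t) + \<delta>2"
        using h s(3) by (simp add: abs_mult dist_real_def)
    qed
  qed
qed

text \<open>The step size has to be small depending on \<open>T\<close>, but the constant \<open>D\<close> does not depend on \<open>T\<close>: the error
  \<open>e\<close> committed in replacing difference quotients of the data by derivatives is chosen so small that its integral
  over \<open>[1, T]\<close> contributes at most \<open>1\<close>.\<close>

lemma energy_growth:
  assumes m: "m \<ge> 1"
    and data: "(\<integral>\<^sup>+ \<tau> \<in> {1..}. ennreal (data_rate (Suc (Suc m)) \<tau>) \<partial>lborel) \<le> ennreal C"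
  obtains D where "\<And>T. 1 \<le> T \<Longrightarrow> \<exists>h0>0. \<forall>h. 0 < h \<longrightarrow> h \<le> h0 \<longrightarrow> 1 + energy m h T \<le> (1 + energy m h 1) * exp D"
proof -
  define N where "N = Suc (Suc m)"
  have N: "N \<ge> 1" by (simp add: N_def)
  define c1 where "c1 = real N * real (Suc m) / (4 * a 0)"
  have c1: "c1 \<ge> 0" using a0_pos by (simp add: c1_def)
  define K where "K = 2 * c1 + real N"
  have K: "K \<ge> 0" using c1 by (simp add: K_def)
  define D where "D = K * max 0 C + 1"
  have "\<exists>h0>0. \<forall>h. 0 < h \<longrightarrow> h \<le> h0 \<longrightarrow> 1 + energy m h T \<le> (1 + energy m h 1) * exp D" if T: "1 \<le> T" for T
  proof -
    define e where "e = 1 / (1 + K * T)"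
    have KT: "K * T \<ge> 0" using K T by simp
    have e: "e > 0" "e \<le> 1" using KT by (auto simp: e_def divide_le_eq)
    have KTe: "K * T * e \<le> 1" using KT by (simp add: e_def divide_le_eq)
    obtain h0 where "h0 > 0 \<and> (\<forall>h t. 0 < h \<longrightarrow> h \<le> h0 \<longrightarrow> 1 \<le> t \<longrightarrow> t \<le> T \<longrightarrow>
      (LINT x:U|lborel. (norm (grad_\<Psi> (t + h) x - grad_\<Psi> t x) / h) ^ N) \<le> (L_norm (real N) U (grad_\<Psi>t t) + e) ^ N \<and>
      (LINT x:U|lborel. (\<bar>deriv (\<Psi> x) (t + h) - deriv (\<Psi> x) t\<bar> / h) ^ N)
        \<le> (L_norm (real N) U (\<lambda>x. deriv (deriv (\<Psi> x)) t) + e) ^ N)"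
      using \<Psi>_increments_le[OF N e(1), of T] ..
    then have h0: "h0 > 0"
      "\<And>h t. 0 < h \<Longrightarrow> h \<le> h0 \<Longrightarrow> 1 \<le> t \<Longrightarrow> t \<le> T \<Longrightarrow>
        (LINT x:U|lborel. (norm (grad_\<Psi> (t + h) x - grad_\<Psi> t x) / h) ^ N) \<le> (L_norm (real N) U (grad_\<Psi>t t) + e) ^ N"
      "\<And>h t. 0 < h \<Longrightarrow> h \<le> h0 \<Longrightarrow> 1 \<le> t \<Longrightarrow> t \<le> T \<Longrightarrow>
        (LINT x:U|lborel. (\<bar>deriv (\<Psi> x) (t + h) - deriv (\<Psi> x) t\<bar> / h) ^ N)
          \<le> (L_norm (real N) U (\<lambda>x. deriv (deriv (\<Psi> x)) t) + e) ^ N"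
      by blast+
    have "1 + energy m h T \<le> (1 + energy m h 1) * exp D" if h: "0 < h" "h \<le> h0" for h
    proof (rule gronwall_one_plus[OF T])
      fix t assume "t \<in> {1..T}"
      then have t: "1 \<le> t" "t \<le> T" by auto
      show "(energy m h has_real_derivative
        (LINT x:U|lborel. real (Suc (Suc m)) * excess_force M m (dq h x t) * ((u x (t + h) - u x t) / h))) (at t)"
        using t by (intro energy_derivative m h) simp
      show "energy m h t \<ge> 0" by (rule energy_nonneg)
      define L1 where "L1 = L_norm (real N) U (grad_\<Psi>t t)"
      define L2 where "L2 = L_norm (real N) U (\<lambda>x. deriv (deriv (\<Psi> x)) t)"
      have L: "L1 \<ge> 0" "L2 \<ge> 0" by (simp_all add: L1_def L2_def L_norm_nonneg)
      have "(LINT x:U|lborel. real (Suc (Suc m)) * excess_force M m (dq h x t) * ((u x (t + h) - u x t) / h))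
          \<le> (1 + energy m h t) * (c1 * (L1 + e)\<^sup>2 + real N * (L2 + e))"
        unfolding c1_def N_def
      proof (rule energy_rate_le[OF m t(1) h(1)])
        show "0 < L1 + e" "0 < L2 + e" using L e by auto
      qed (use h0(2,3)[OF h t] in \<open>simp_all only: N_def L1_def L2_def\<close>)
      also have "\<dots> \<le> (1 + energy m h t) * (K * data_rate N t + K * e)"
      proof (rule mult_left_mono)
        have "(L1 + e)\<^sup>2 \<le> 2 * L1\<^sup>2 + 2 * e\<^sup>2"
          using sum_squares_bound[of L1 e] by (simp add: power2_sum)
        moreover have "e\<^sup>2 \<le> e" using e by (simp add: power2_eq_square mult_left_le)
        ultimately have "c1 * (L1 + e)\<^sup>2 \<le> c1 * (2 * L1\<^sup>2 + 2 * e)"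
          using c1 by (intro mult_left_mono) linarith+
        moreover have "0 \<le> 2 * c1 * L2" "0 \<le> real N * L1\<^sup>2" using c1 L by auto
        moreover have "K * data_rate N t + K * e
            = c1 * (2 * L1\<^sup>2 + 2 * e) + 2 * c1 * L2 + real N * L1\<^sup>2 + real N * (L2 + e)"
          unfolding data_rate_def L1_def[symmetric] L2_def[symmetric] K_def
          by (simp add: algebra_simps)
        ultimately show "c1 * (L1 + e)\<^sup>2 + real N * (L2 + e) \<le> K * data_rate N t + K * e"
          by linarith
        show "0 \<le> 1 + energy m h t" using energy_nonneg[of m h t] by simp
      qed
      finally show "(LINT x:U|lborel. real (Suc (Suc m)) * excess_force M m (dq h x t) * ((u x (t + h) - u x t) / h))
          \<le> (1 + energy m h t) * (K * data_rate N t + K * e)" .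
    next
      note rate = integral_data_rate_le[OF N data[folded N_def] T]
      show "(\<lambda>t. K * data_rate N t + K * e) integrable_on {1..T}"
        by (intro integrable_add integrable_on_mult_right rate(1) integrable_const_ivl)
      have "integral {1..T} (\<lambda>t. K * data_rate N t + K * e) = K * integral {1..T} (data_rate N) + (T - 1) * (K * e)"
        using T by (subst integral_add) (auto intro!: integrable_on_mult_right rate(1) simp: integral_mult_right)
      also have "\<dots> \<le> K * max 0 C + T * (K * e)"
        using K e by (intro add_mono mult_left_mono mult_right_mono rate(2)) auto
      also have "\<dots> \<le> D" using KTe by (simp add: D_def algebra_simps)
      finally show "integral {1..T} (\<lambda>t. K * data_rate N t + K * e) \<le> D" .
    qed
    with h0(1) show ?thesis by blast
  qed
  then show thesis by (rule that)
qed

lemma energy_tendsto: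
  assumes t: "t > 0"
  shows "(\<lambda>n. energy m (inverse (real (Suc n))) t) \<longlonglongrightarrow> (LINT x:U|lborel. excess M (u x t) ^ Suc (Suc m))"
proof -
  define h where "h n = inverse (real (Suc n))" for n
  have h: "0 < h n" "h n \<le> 1" for n by (auto simp: h_def divide_simps)
  have h_lim: "filterlim h (at 0) sequentially"
  proof -
    have "h \<longlonglongrightarrow> 0" unfolding h_def by (rule LIMSEQ_inverse_real_of_nat)
    then show ?thesis unfolding filterlim_at using h(1) by (auto simp: less_imp_neq[symmetric])
  qed
  obtain B where B: "B \<ge> 0" "\<And>x s. x \<in> closure U \<Longrightarrow> t \<le> s \<Longrightarrow> s \<le> t + 1 \<Longrightarrow> \<bar>u x s\<bar> \<le> B"
    using bounded_in_time_interval[OF bounded_U u_continuous t] by (metis fst_conv snd_conv real_norm_def)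
  have "(\<lambda>n. energy m (h n) t) \<longlonglongrightarrow> (LINT x:U|lborel. excess M (u x t) ^ Suc (Suc m))"
    unfolding energy_def
  proof (rule bounded_convergence_on(1)[OF _ bounded_U])
    show "U \<in> sets borel" using open_U by simp
    show "set_borel_measurable lborel U (\<lambda>x. excess M (dq (h n) x t) ^ Suc (Suc m))" for n
    proof -
      have "set_integrable lborel U (\<lambda>x. excess M (dq (h n) x t) ^ Suc (Suc m))"
        by (intro set_integrable_continuous_closure[OF open_U bounded_U] continuous_intros excess_dq_continuous t h)
      then show ?thesis by (simp add: set_integrable_def set_borel_measurable_def borel_measurable_integrable)
    qed
    show "\<bar>excess M (dq (h n) x t) ^ Suc (Suc m)\<bar> \<le> B ^ Suc (Suc m)" if x: "x \<in> U" for n x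
    proof -
      obtain s where "t < s" "s < t + h n" "dq (h n) x t = u x s"
        using dq_mean_value[OF U_closure[OF x] t h(1)] by metis
      then have "\<bar>dq (h n) x t\<bar> \<le> B" using B(2)[OF U_closure[OF x], of s] h(2)[of n] by auto
      then have "excess M (dq (h n) x t) \<le> B" using M_nonneg B(1) by (simp add: excess_def)
      then show ?thesis unfolding power_abs by (intro power_mono) (simp_all add: excess_nonneg)
    qed
    show "(\<lambda>n. excess M (dq (h n) x t) ^ Suc (Suc m)) \<longlonglongrightarrow> excess M (u x t) ^ Suc (Suc m)" if "x \<in> U" for x
    proof -
      have "(\<lambda>n. dq (h n) x t) \<longlonglongrightarrow> u x t"
        by (rule filterlim_compose[OF dq_tendsto[OF U_closure[OF that] t] h_lim])
      then show ?thesis unfolding excess_def by (intro tendsto_intros)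
    qed
  qed
  then show ?thesis by (simp only: h_def)
qed

text \<open>Let \<open>h \<rightarrow> 0\<close> in \<open>energy_growth\<close> at the two times \<open>1\<close> and \<open>t\<close>.\<close>

lemma excess_moment_bounded:
  assumes m: "m \<ge> 1"
    and data: "(\<integral>\<^sup>+ \<tau> \<in> {1..}. ennreal (data_rate (Suc (Suc m)) \<tau>) \<partial>lborel) \<le> ennreal C"
  obtains D where "\<And>t. 1 \<le> t \<Longrightarrow> (LINT x:U|lborel. excess M (u x t) ^ Suc (Suc m)) \<le> D"
proof -
  define E where "E t = (LINT x:U|lborel. excess M (u x t) ^ Suc (Suc m))" for t
  obtain D where D: "\<And>T. 1 \<le> T \<Longrightarrow> \<exists>h0>0. \<forall>h. 0 < h \<longrightarrow> h \<le> h0 \<longrightarrow> 1 + energy m h T \<le> (1 + energy m h 1) * exp D"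
    by (rule energy_growth[OF m data]) blast
  have bound: "1 + E t \<le> (1 + E 1) * exp D" if t: "1 \<le> t" for t
  proof -
    let ?h = "\<lambda>n. inverse (real (Suc n))"
    obtain h0 where h0: "h0 > 0" "\<And>h. 0 < h \<Longrightarrow> h \<le> h0 \<Longrightarrow> 1 + energy m h t \<le> (1 + energy m h 1) * exp D"
      using D[OF t] by blast
    have lim: "(\<lambda>n. 1 + energy m (?h n) t) \<longlonglongrightarrow> 1 + E t" "(\<lambda>n. (1 + energy m (?h n) 1) * exp D) \<longlonglongrightarrow> (1 + E 1) * exp D"
      unfolding E_def using t by (intro tendsto_intros energy_tendsto; simp)+
    have "\<forall>\<^sub>F n in sequentially. 1 + energy m (?h n) t \<le> (1 + energy m (?h n) 1) * exp D"
    proof -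
      have "\<forall>\<^sub>F n in sequentially. ?h n < h0"
        by (rule order_tendstoD(2)[OF LIMSEQ_inverse_real_of_nat h0(1)])
      then show ?thesis by (rule eventually_mono) (intro h0(2), auto)
    qed
    then show ?thesis by (rule tendsto_le[OF sequentially_bot lim(2) lim(1)])
  qed
  have "E t \<le> (1 + E 1) * exp D" if "1 \<le> t" for t using bound[OF that] by simp
  then show thesis unfolding E_def by (rule that)
qed

lemma powr_le_excess_power:
  assumes "\<beta> \<le> real n" "\<beta> \<ge> 0" "n \<ge> 1"
  shows "\<bar>s\<bar> powr \<beta> \<le> 1 + 2 ^ n * (M ^ n + excess M s ^ n)"
proof (cases "\<bar>s\<bar> \<le> 1")
  case True
  then have "\<bar>s\<bar> powr \<beta> \<le> 1 powr \<beta>" using assms by (intro powr_mono2) auto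
  moreover have "0 \<le> 2 ^ n * (M ^ n + excess M s ^ n)" using M_nonneg excess_nonneg by simp
  ultimately show ?thesis by simp
next
  case False
  have "\<bar>s\<bar> \<le> 2 * max M (excess M s)" by (auto simp: excess_def max_def)
  then have "\<bar>s\<bar> ^ n \<le> (2 * max M (excess M s)) ^ n" by (intro power_mono) auto
  also have "\<dots> = 2 ^ n * max M (excess M s) ^ n" by (simp add: power_mult_distrib)
  also have "\<dots> \<le> 2 ^ n * (M ^ n + excess M s ^ n)"
    using M_nonneg excess_nonneg[of M s] by (intro mult_left_mono) (auto simp: max_def)
  finally have "\<bar>s\<bar> ^ n \<le> 2 ^ n * (M ^ n + excess M s ^ n)" .
  moreover have "\<bar>s\<bar> powr \<beta> \<le> \<bar>s\<bar> powr real n" using assms False by (intro powr_mono) auto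
  moreover have "\<bar>s\<bar> powr real n = \<bar>s\<bar> ^ n" using False by (intro powr_realpow) auto
  ultimately show ?thesis by simp
qed

lemma rate_moment_bounded:
  assumes \<beta>: "\<beta> \<ge> 0"
    and data: "\<And>N. N \<ge> 2 \<Longrightarrow> \<exists>C. (\<integral>\<^sup>+ \<tau> \<in> {1..}. ennreal (data_rate N \<tau>) \<partial>lborel) \<le> ennreal C"
  shows "\<exists>C. \<forall>t\<ge>1. (\<integral>\<^sup>+ x \<in> U. ennreal (\<bar>u x t\<bar> powr \<beta>) \<partial>lborel) \<le> ennreal C"
proof -
  \<comment> \<open>The exponent \<open>n = m + 2\<close> exceeds \<open>\<beta>\<close>, and \<open>m \<ge> 1\<close> makes the test function differentiable.\<close>
  define m where "m = Suc (nat \<lceil>\<beta>\<rceil>)"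
  define n where "n = Suc (Suc m)"
  have m: "m \<ge> 1" and n: "n \<ge> 1" "\<beta> \<le> real n" by (simp_all add: m_def n_def) linarith
  obtain C where C: "(\<integral>\<^sup>+ \<tau> \<in> {1..}. ennreal (data_rate (Suc (Suc m)) \<tau>) \<partial>lborel) \<le> ennreal C"
    using data[of "Suc (Suc m)"] by auto
  obtain D where D: "\<And>t. 1 \<le> t \<Longrightarrow> (LINT x:U|lborel. excess M (u x t) ^ n) \<le> D"
    unfolding n_def by (rule excess_moment_bounded[OF m C]) blast
  define B where "B = measure lborel U * (1 + 2 ^ n * M ^ n) + 2 ^ n * D"
  have "(\<integral>\<^sup>+ x \<in> U. ennreal (\<bar>u x t\<bar> powr \<beta>) \<partial>lborel) \<le> ennreal B" if t: "1 \<le> t" for t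
  proof -
    have cont: "continuous_on (closure U) (\<lambda>x. excess M (u x t) ^ n)"
      unfolding excess_def using continuous_at_fixed_time[OF u_continuous, of t] t
      by (intro continuous_intros) auto
    note int = set_integrable_continuous_closure[OF open_U bounded_U]
    let ?F = "\<lambda>x. (1 + 2 ^ n * M ^ n) + 2 ^ n * excess M (u x t) ^ n"
    have intF: "set_integrable lborel U ?F" by (intro int continuous_intros cont)
    have nonneg: "?F x \<ge> 0" for x using M_nonneg excess_nonneg by (intro add_nonneg_nonneg) auto
    have "(\<integral>\<^sup>+ x \<in> U. ennreal (\<bar>u x t\<bar> powr \<beta>) \<partial>lborel) \<le> (\<integral>\<^sup>+ x. ennreal (indicator U x *\<^sub>R ?F x) \<partial>lborel)"
    proof (rule nn_integral_mono)
      fix x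
      have "\<bar>u x t\<bar> powr \<beta> \<le> ?F x"
        using powr_le_excess_power[OF n(2) \<beta> n(1), of "u x t"] by (simp add: algebra_simps)
      then show "ennreal (\<bar>u x t\<bar> powr \<beta>) * indicator U x \<le> ennreal (indicator U x *\<^sub>R ?F x)"
        by (auto simp: indicator_def intro: ennreal_leI)
    qed
    also have "\<dots> = ennreal (LINT x:U|lborel. ?F x)"
      unfolding set_lebesgue_integral_def
      by (rule nn_integral_eq_integral) (use intF nonneg in \<open>auto simp: set_integrable_def\<close>)
    also have "(LINT x:U|lborel. ?F x) = (LINT x:U|lborel. 1 + 2 ^ n * M ^ n) + 2 ^ n * (LINT x:U|lborel. excess M (u x t) ^ n)"
      by (subst set_integral_add(2)) (auto intro!: int continuous_intros cont)
    also have "(LINT x:U|lborel. 1 + 2 ^ n * M ^ n) = measure lborel U * (1 + 2 ^ n * M ^ n)"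
      using open_U by (simp add: set_lebesgue_integral_def)
    also have "ennreal (measure lborel U * (1 + 2 ^ n * M ^ n) + 2 ^ n * (LINT x:U|lborel. excess M (u x t) ^ n)) \<le> ennreal B"
      unfolding B_def using D[OF t] by (intro ennreal_leI add_left_mono mult_left_mono) auto
    finally show ?thesis .
  qed
  then show ?thesis by blast
qed

end

theorem theorem4p8:
  fixes U \<Gamma>i \<Gamma>e :: "(real ^ 'n) set"
    and k :: nat and a \<alpha> :: "nat \<Rightarrow> real" and K :: "real \<Rightarrow> real"
    and Q \<gamma> :: "real \<Rightarrow> real" and Qs A :: real
    and p \<psi> \<Psi> ps pbar psbar :: "real ^ 'n \<Rightarrow> real \<Rightarrow> real"
    and p0 \<phi> \<Phi> W :: "real ^ 'n \<Rightarrow> real"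
  assumes n: "CARD('n) \<ge> 3"
    and U: "bounded_C2_domain U"
    and bdry: "frontier U = \<Gamma>e \<union> \<Gamma>i" "\<Gamma>e \<in> sets borel" "\<Gamma>i \<in> sets borel"
    and exponents: "k \<ge> 1" "\<alpha> 1 > 0" "strict_mono_on {1..k} \<alpha>"
    and coeffs: "\<And>j. j \<le> k \<Longrightarrow> a j > 0"
    and degree: "\<alpha> k > 4 / (real CARD('n) - 2)"
    and K_def: "K = forch_K k a \<alpha>"
    and p: "IBVP_I K U \<Gamma>i \<Gamma>e Q \<psi> p0 p \<gamma>"
    and Psi: "lateral_extension U \<Gamma>i \<psi> \<Psi>"
    and A_def: "A = Qs / measure lborel U"
    and W: "PSS_profile K U \<Gamma>i \<Gamma>e A \<phi> W"
    and Phi: "continuous_on (closure U) \<Phi>" "\<And>x. x \<in> \<Gamma>i \<Longrightarrow> \<Phi> x = \<phi> x"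
    and ps_def: "ps = PSS_solution A W"
    and pbar_def: "pbar = (\<lambda>x t. p x t - \<Psi> x t)"
    and psbar_def: "psbar = (\<lambda>x t. ps x t - \<Phi> x)"
    and data_bound: "\<And>\<beta>::real. \<beta> \<ge> 2 \<Longrightarrow> \<exists>C::real. \<forall>t\<ge>1.
        ennreal (\<bar>deriv (\<lambda>s. \<gamma> s + A * s) t\<bar> + \<bar>Q t - Qs\<bar>)
        + (\<integral>\<^sup>+ \<tau> \<in> {1..}. ennreal (L_norm \<beta> U (\<lambda>x. deriv (deriv (\<Psi> x)) \<tau>)
             + (L_norm \<beta> U (\<lambda>x. grad (closure U) (\<lambda>y. deriv (\<Psi> y) \<tau>) x))\<^sup>2) \<partial>lborel)
        \<le> ennreal C"
  shows "\<forall>\<beta>::real. \<beta> \<ge> 2 \<longrightarrow> (\<exists>C::real. \<forall>t\<ge>1.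
        (\<integral>\<^sup>+ x \<in> U. ennreal (\<bar>deriv (pbar x) t - deriv (psbar x) t\<bar> powr \<beta>) \<partial>lborel)
          = (\<integral>\<^sup>+ x \<in> U. ennreal (\<bar>deriv (pbar x) t + A\<bar> powr \<beta>) \<partial>lborel) \<and>
        (\<integral>\<^sup>+ x \<in> U. ennreal (\<bar>deriv (pbar x) t + A\<bar> powr \<beta>) \<partial>lborel) \<le> ennreal C)"
proof (intro allI impI)
  fix \<beta> :: real assume \<beta>: "\<beta> \<ge> 2"
  have exponent_pos: "\<alpha> j > 0" if "j \<in> {1..k}" for j
  proof -
    have "\<alpha> 1 \<le> \<alpha> j"
      using strict_mono_onD[OF exponents(3), of 1 j] that by (cases "j = 1") auto
    then show ?thesis using exponents(2) by simp
  qed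
  obtain M0 where M0: "\<And>t. t \<ge> 1 \<Longrightarrow> ennreal (\<bar>deriv (\<lambda>s. \<gamma> s + A * s) t\<bar> + \<bar>Q t - Qs\<bar>) \<le> ennreal M0"
    using data_bound[of 2] by (meson add_increasing2 le_add1 le_iff_add order_trans order_refl)
  have rate: "\<bar>deriv (\<lambda>s. \<gamma> s + A * s) t\<bar> \<le> max 0 M0" if "t \<ge> 1" for t
  proof -
    have "ennreal (\<bar>deriv (\<lambda>s. \<gamma> s + A * s) t\<bar> + \<bar>Q t - Qs\<bar>) \<le> ennreal (max 0 M0)"
      using M0[OF that] by (simp only: ennreal_max_0)
    then have "\<bar>deriv (\<lambda>s. \<gamma> s + A * s) t\<bar> + \<bar>Q t - Qs\<bar> \<le> max 0 M0"
      by (subst (asm) ennreal_le_iff) auto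
    then show ?thesis by linarith
  qed
  interpret forchheimer_flow k a \<alpha> U \<Gamma>i \<Gamma>e Q \<gamma> A "max 0 M0" p \<psi> \<Psi> p0
    by unfold_locales (use coeffs exponent_pos U bdry p K_def Psi rate in auto)
  have "\<exists>C. (\<integral>\<^sup>+ \<tau> \<in> {1..}. ennreal (data_rate N \<tau>) \<partial>lborel) \<le> ennreal C" if N: "N \<ge> 2" for N
  proof -
    have "real N \<ge> 2" using N by simp
    from data_bound[OF this, folded data_rate_def] obtain C where
      C: "\<forall>t\<ge>1. ennreal (\<bar>deriv (\<lambda>s. \<gamma> s + A * s) t\<bar> + \<bar>Q t - Qs\<bar>)
        + (\<integral>\<^sup>+ \<tau> \<in> {1..}. ennreal (data_rate N \<tau>) \<partial>lborel) \<le> ennreal C" ..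
    have "(\<integral>\<^sup>+ \<tau> \<in> {1..}. ennreal (data_rate N \<tau>) \<partial>lborel) \<le> ennreal C"
      by (rule order_trans[OF add_increasing[OF zero_le order_refl] C[rule_format, OF order_refl]])
    then show ?thesis ..
  qed
  from rate_moment_bounded[OF _ this, of \<beta>] \<beta>
  obtain C where C: "\<And>t. t \<ge> 1 \<Longrightarrow> (\<integral>\<^sup>+ x \<in> U. ennreal (\<bar>u x t\<bar> powr \<beta>) \<partial>lborel) \<le> ennreal C"
    by auto
  have pbar: "deriv (pbar x) t + A = u x t" if "x \<in> U" "t \<ge> 1" for x t
  proof -
    have "(pbar x has_real_derivative deriv (p x) t - deriv (\<Psi> x) t) (at t)"
      unfolding pbar_def using that U_closure
      by (intro DERIV_diff time_derivative C1_p C1_\<Psi>) auto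
    then show ?thesis by (simp add: u_def DERIV_imp_deriv)
  qed
  have psbar: "deriv (psbar x) t = - A" for x t
  proof -
    have "(psbar x has_real_derivative - A) (at t)"
      unfolding psbar_def ps_def PSS_solution_def by (auto intro!: derivative_eq_intros)
    then show ?thesis by (rule DERIV_imp_deriv)
  qed
  have "(\<integral>\<^sup>+ x \<in> U. ennreal (\<bar>deriv (pbar x) t + A\<bar> powr \<beta>) \<partial>lborel) \<le> ennreal C" if "t \<ge> 1" for t
  proof -
    have "(\<integral>\<^sup>+ x \<in> U. ennreal (\<bar>deriv (pbar x) t + A\<bar> powr \<beta>) \<partial>lborel) = (\<integral>\<^sup>+ x \<in> U. ennreal (\<bar>u x t\<bar> powr \<beta>) \<partial>lborel)"
      by (rule nn_integral_cong) (simp add: pbar that indicator_def)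
    then show ?thesis using C[OF that] by simp
  qed
  then show "\<exists>C::real. \<forall>t\<ge>1.
        (\<integral>\<^sup>+ x \<in> U. ennreal (\<bar>deriv (pbar x) t - deriv (psbar x) t\<bar> powr \<beta>) \<partial>lborel)
          = (\<integral>\<^sup>+ x \<in> U. ennreal (\<bar>deriv (pbar x) t + A\<bar> powr \<beta>) \<partial>lborel) \<and>
        (\<integral>\<^sup>+ x \<in> U. ennreal (\<bar>deriv (pbar x) t + A\<bar> powr \<beta>) \<partial>lborel) \<le> ennreal C"
    by (intro exI[of _ C]) (simp add: psbar)
qed

end
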